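(* Let $G$ be a group with a ramification data $\mathfrak{r}=\sum_{C\in\mathcal{C}}\mathfrak{r}_C C$ and let $K$ be an arbitrary field. Then $L_K(\Gamma_{G,\mathfrak{r}})$ is purely infinite simple if and only if $S_{G,\mathfrak{r}}=G$ and $\sum_{C\in\mathcal{C}}\mathfrak{r}_C|C|\ge 2$.
   Context: Leavitt path algebra. A (directed) graph $E=(E^0,E^1,r,s)$ consists of disjoint sets $E^0$ (vertices) and $E^1$ (edges) and maps $r,s:E^1\to E^0$ (range, source). For a field $K$, $L_K(E)$ is the (not necessarily unital) associative $K$-algebra generated by $E^0\cup E^1\cup\{e^*: e\in E^1\}$ subject to, for all $v,w\in E^0$ and $e,f\in E^1$: (i) $vw=\delta_{v,w}w$; (ii) $s(e)e=e=e\,r(e)$ and $r(e)e^*=e^*=e^*s(e)$; (iii) $e^*f=\delta_{e,f}r(e)$; (iv) $v=\sum_{e\in s^{-1}(v)}ee^*$ for every vertex $v$ with $0<|s^{-1}(v)|<\infty$. Hopf graphs. Let $G$ be a group and $\mathcal{C}$ its set of conjugacy classes. A ramification data of $G$ is a function $\mathfrak{r}:\mathcal{C}\to\mathbb{N}=\{0,1,2,\dots\}$, written $\mathfrak{r}=\sum_{C\in\mathcal{C}}\mathfrak{r}_C C$ with $\mathfrak{r}_C=\mathfrak{r}(C)$; $\mathrm{supp}(\mathfrak{r})=\{C:\mathfrak{r}_C>0\}$. The Hopf graph $\Gamma_{G,\mathfrak{r}}$ has vertex set $G$ and, for each $x\in G$, $C\in\mathcal{C}$ and $c\in C$, exactly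 $\mathfrak{r}_C$ edges from $x$ to $xc$. $S_{G,\mathfrak{r}}$ is the subsemigroup of $G$ generated by $\bigcup_{C\in\mathrm{supp}(\mathfrak{r})}C$ (empty if $\mathfrak{r}=0$). The sum $\sum_{C}\mathfrak{r}_C|C|$ is a cardinal, possibly infinite. Purely infinite simple. An idempotent $e$ in a ring $R$ is infinite if $eR$ is isomorphic, as a right $R$-module, to a proper direct summand of itself. $R$ is purely infinite if every nonzero right ideal of $R$ contains an infinite idempotent. $R$ is purely infinite simple if it is both purely infinite and simple. *)

theory Defs
  imports "HOL-Algebra.Module" "HOL-Algebra.AbelCoset" "HOL-Algebra.Group_Action" "Graph_Theory.Digraph"
begin

unbundle cardinal_syntax

section \<open>Rings and algebras without unit\<close>

text \<open>
  The algebras considered here need not have a unit, so the ring locales of HOL-Algebra do not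
  apply. The record types of HOL-Algebra are reused; their field \<open>one\<close> is ignored throughout.
\<close>

locale nonunital_ring = abelian_group R for R (structure) +
  assumes m_closed: "\<lbrakk>x \<in> carrier R; y \<in> carrier R\<rbrakk> \<Longrightarrow> x \<otimes> y \<in> carrier R"
    and m_assoc: "\<lbrakk>x \<in> carrier R; y \<in> carrier R; z \<in> carrier R\<rbrakk> \<Longrightarrow>
          (x \<otimes> y) \<otimes> z = x \<otimes> (y \<otimes> z)"
    and l_distr: "\<lbrakk>x \<in> carrier R; y \<in> carrier R; z \<in> carrier R\<rbrakk> \<Longrightarrow>
          (x \<oplus> y) \<otimes> z = x \<otimes> z \<oplus> y \<otimes> z"
    and r_distr: "\<lbrakk>x \<in> carrier R; y \<in> carrier R; z \<in> carrier R\<rbrakk> \<Longrightarrow>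
          z \<otimes> (x \<oplus> y) = z \<otimes> x \<oplus> z \<otimes> y"

locale nonunital_algebra = Module.module K A + nonunital_ring A for K and A (structure) +
  assumes smult_mult_l: "\<lbrakk>a \<in> carrier K; x \<in> carrier A; y \<in> carrier A\<rbrakk> \<Longrightarrow>
          (a \<odot> x) \<otimes> y = a \<odot> (x \<otimes> y)"
    and smult_mult_r: "\<lbrakk>a \<in> carrier K; x \<in> carrier A; y \<in> carrier A\<rbrakk> \<Longrightarrow>
          x \<otimes> (a \<odot> y) = a \<odot> (x \<otimes> y)"

definition right_ideal :: "('a, 'm) ring_scheme \<Rightarrow> 'a set \<Rightarrow> bool" where
  "right_ideal R I \<longleftrightarrow>
     additive_subgroup I R \<and> (\<forall>x\<in>I. \<forall>a\<in>carrier R. x \<otimes>\<^bsub>R\<^esub> a \<in> I)"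

definition two_sided_ideal :: "('a, 'm) ring_scheme \<Rightarrow> 'a set \<Rightarrow> bool" where
  "two_sided_ideal R I \<longleftrightarrow>
     additive_subgroup I R \<and>
     (\<forall>x\<in>I. \<forall>a\<in>carrier R. x \<otimes>\<^bsub>R\<^esub> a \<in> I \<and> a \<otimes>\<^bsub>R\<^esub> x \<in> I)"

text \<open>The usual convention for rings without unit: zero multiplication is excluded.\<close>

definition simple_ring :: "('a, 'm) ring_scheme \<Rightarrow> bool" where
  "simple_ring R \<longleftrightarrow>
     (\<exists>x\<in>carrier R. \<exists>y\<in>carrier R. x \<otimes>\<^bsub>R\<^esub> y \<noteq> \<zero>\<^bsub>R\<^esub>) \<and>
     (\<forall>I. two_sided_ideal R I \<longrightarrow> I = {\<zero>\<^bsub>R\<^esub>} \<or> I = carrier R)"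

text \<open>
  The right \<open>R\<close>-modules below are right ideals of \<open>R\<close>: the submodules of \<open>eR\<close> are exactly the
  right ideals of \<open>R\<close> contained in \<open>eR\<close>.
\<close>

definition right_module_iso :: "('a, 'm) ring_scheme \<Rightarrow> 'a set \<Rightarrow> 'a set \<Rightarrow> bool" where
  "right_module_iso R M N \<longleftrightarrow>
     (\<exists>f. bij_betw f M N \<and>
          (\<forall>x\<in>M. \<forall>y\<in>M. f (x \<oplus>\<^bsub>R\<^esub> y) = f x \<oplus>\<^bsub>R\<^esub> f y) \<and>
          (\<forall>x\<in>M. \<forall>a\<in>carrier R. f (x \<otimes>\<^bsub>R\<^esub> a) = f x \<otimes>\<^bsub>R\<^esub> a))"

definition proper_direct_summand :: "('a, 'm) ring_scheme \<Rightarrow> 'a set \<Rightarrow> 'a set \<Rightarrow> bool" where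
  "proper_direct_summand R N M \<longleftrightarrow>
     right_ideal R N \<and> N \<noteq> M \<and>
     (\<exists>N'. right_ideal R N' \<and> N \<inter> N' = {\<zero>\<^bsub>R\<^esub>} \<and> N <+>\<^bsub>R\<^esub> N' = M)"

definition infinite_idempotent :: "('a, 'm) ring_scheme \<Rightarrow> 'a \<Rightarrow> bool" where
  "infinite_idempotent R e \<longleftrightarrow>
     e \<in> carrier R \<and> e \<otimes>\<^bsub>R\<^esub> e = e \<and>
     (\<exists>N. proper_direct_summand R N (e <#\<^bsub>R\<^esub> carrier R) \<and>
          right_module_iso R (e <#\<^bsub>R\<^esub> carrier R) N)"

definition purely_infinite :: "('a, 'm) ring_scheme \<Rightarrow> bool" where
  "purely_infinite R \<longleftrightarrow>
     (\<forall>I. right_ideal R I \<and> I \<noteq> {\<zero>\<^bsub>R\<^esub>} \<longrightarrow> (\<exists>e\<in>I. infinite_idempotent R e))"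

definition purely_infinite_simple :: "('a, 'm) ring_scheme \<Rightarrow> bool" where
  "purely_infinite_simple R \<longleftrightarrow> purely_infinite R \<and> simple_ring R"


section \<open>Algebras given by generators and relations\<close>

text \<open>
  The not necessarily unital associative \<open>K\<close>-algebra generated by a set \<open>X\<close> subject to a set
  of relations is the algebra of terms over \<open>X\<close> modulo the smallest congruence that contains
  the relations and all instances of the \<open>K\<close>-algebra axioms.
\<close>

datatype ('k, 'g) alg_term =
    TGen 'g
  | TZero
  | TAdd "('k, 'g) alg_term" "('k, 'g) alg_term"
  | TNeg "('k, 'g) alg_term"
  | TMult "('k, 'g) alg_term" "('k, 'g) alg_term"
  | TSmult 'k "('k, 'g) alg_term"

inductive_set alg_terms :: "('k, 'n) ring_scheme \<Rightarrow> 'g set \<Rightarrow> ('k, 'g) alg_term set"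
  for K :: "('k, 'n) ring_scheme" and X :: "'g set" where
  gen: "x \<in> X \<Longrightarrow> TGen x \<in> alg_terms K X"
| zero: "TZero \<in> alg_terms K X"
| add: "\<lbrakk>s \<in> alg_terms K X; t \<in> alg_terms K X\<rbrakk> \<Longrightarrow> TAdd s t \<in> alg_terms K X"
| neg: "t \<in> alg_terms K X \<Longrightarrow> TNeg t \<in> alg_terms K X"
| mult: "\<lbrakk>s \<in> alg_terms K X; t \<in> alg_terms K X\<rbrakk> \<Longrightarrow> TMult s t \<in> alg_terms K X"
| smult: "\<lbrakk>a \<in> carrier K; t \<in> alg_terms K X\<rbrakk> \<Longrightarrow> TSmult a t \<in> alg_terms K X"

inductive_set alg_cong ::
    "('k, 'n) ring_scheme \<Rightarrow> 'g set \<Rightarrow> (('k, 'g) alg_term \<times> ('k, 'g) alg_term) set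
      \<Rightarrow> (('k, 'g) alg_term \<times> ('k, 'g) alg_term) set"
  for K :: "('k, 'n) ring_scheme" and X :: "'g set"
    and Rel :: "(('k, 'g) alg_term \<times> ('k, 'g) alg_term) set" where
  rel: "\<lbrakk>(s, t) \<in> Rel; s \<in> alg_terms K X; t \<in> alg_terms K X\<rbrakk> \<Longrightarrow> (s, t) \<in> alg_cong K X Rel"
| refl: "t \<in> alg_terms K X \<Longrightarrow> (t, t) \<in> alg_cong K X Rel"
| sym: "(s, t) \<in> alg_cong K X Rel \<Longrightarrow> (t, s) \<in> alg_cong K X Rel"
| trans: "\<lbrakk>(s, t) \<in> alg_cong K X Rel; (t, u) \<in> alg_cong K X Rel\<rbrakk> \<Longrightarrow> (s, u) \<in> alg_cong K X Rel"
| add_cong: "\<lbrakk>(s, s') \<in> alg_cong K X Rel; (t, t') \<in> alg_cong K X Rel\<rbrakk> \<Longrightarrow>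
    (TAdd s t, TAdd s' t') \<in> alg_cong K X Rel"
| neg_cong: "(t, t') \<in> alg_cong K X Rel \<Longrightarrow> (TNeg t, TNeg t') \<in> alg_cong K X Rel"
| mult_cong: "\<lbrakk>(s, s') \<in> alg_cong K X Rel; (t, t') \<in> alg_cong K X Rel\<rbrakk> \<Longrightarrow>
    (TMult s t, TMult s' t') \<in> alg_cong K X Rel"
| smult_cong: "\<lbrakk>a \<in> carrier K; (t, t') \<in> alg_cong K X Rel\<rbrakk> \<Longrightarrow>
    (TSmult a t, TSmult a t') \<in> alg_cong K X Rel"
| add_assoc: "\<lbrakk>s \<in> alg_terms K X; t \<in> alg_terms K X; u \<in> alg_terms K X\<rbrakk> \<Longrightarrow>
    (TAdd (TAdd s t) u, TAdd s (TAdd t u)) \<in> alg_cong K X Rel"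
| add_comm: "\<lbrakk>s \<in> alg_terms K X; t \<in> alg_terms K X\<rbrakk> \<Longrightarrow>
    (TAdd s t, TAdd t s) \<in> alg_cong K X Rel"
| add_zero: "t \<in> alg_terms K X \<Longrightarrow> (TAdd TZero t, t) \<in> alg_cong K X Rel"
| add_neg: "t \<in> alg_terms K X \<Longrightarrow> (TAdd (TNeg t) t, TZero) \<in> alg_cong K X Rel"
| mult_assoc: "\<lbrakk>s \<in> alg_terms K X; t \<in> alg_terms K X; u \<in> alg_terms K X\<rbrakk> \<Longrightarrow>
    (TMult (TMult s t) u, TMult s (TMult t u)) \<in> alg_cong K X Rel"
| distrib_l: "\<lbrakk>s \<in> alg_terms K X; t \<in> alg_terms K X; u \<in> alg_terms K X\<rbrakk> \<Longrightarrow>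
    (TMult (TAdd s t) u, TAdd (TMult s u) (TMult t u)) \<in> alg_cong K X Rel"
| distrib_r: "\<lbrakk>s \<in> alg_terms K X; t \<in> alg_terms K X; u \<in> alg_terms K X\<rbrakk> \<Longrightarrow>
    (TMult u (TAdd s t), TAdd (TMult u s) (TMult u t)) \<in> alg_cong K X Rel"
| smult_add_l: "\<lbrakk>a \<in> carrier K; b \<in> carrier K; t \<in> alg_terms K X\<rbrakk> \<Longrightarrow>
    (TSmult (a \<oplus>\<^bsub>K\<^esub> b) t, TAdd (TSmult a t) (TSmult b t)) \<in> alg_cong K X Rel"
| smult_add_r: "\<lbrakk>a \<in> carrier K; s \<in> alg_terms K X; t \<in> alg_terms K X\<rbrakk> \<Longrightarrow>
    (TSmult a (TAdd s t), TAdd (TSmult a s) (TSmult a t)) \<in> alg_cong K X Rel"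
| smult_smult: "\<lbrakk>a \<in> carrier K; b \<in> carrier K; t \<in> alg_terms K X\<rbrakk> \<Longrightarrow>
    (TSmult (a \<otimes>\<^bsub>K\<^esub> b) t, TSmult a (TSmult b t)) \<in> alg_cong K X Rel"
| smult_one: "t \<in> alg_terms K X \<Longrightarrow> (TSmult \<one>\<^bsub>K\<^esub> t, t) \<in> alg_cong K X Rel"
| smult_mult_l: "\<lbrakk>a \<in> carrier K; s \<in> alg_terms K X; t \<in> alg_terms K X\<rbrakk> \<Longrightarrow>
    (TMult (TSmult a s) t, TSmult a (TMult s t)) \<in> alg_cong K X Rel"
| smult_mult_r: "\<lbrakk>a \<in> carrier K; s \<in> alg_terms K X; t \<in> alg_terms K X\<rbrakk> \<Longrightarrow>
    (TMult s (TSmult a t), TSmult a (TMult s t)) \<in> alg_cong K X Rel"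

definition presented_algebra ::
    "('k, 'n) ring_scheme \<Rightarrow> 'g set \<Rightarrow> (('k, 'g) alg_term \<times> ('k, 'g) alg_term) set
      \<Rightarrow> ('k, ('k, 'g) alg_term set) module" where
  "presented_algebra K X Rel =
     \<lparr>carrier = alg_terms K X // alg_cong K X Rel,
      mult = (\<lambda>S T. \<Union>s\<in>S. \<Union>t\<in>T. alg_cong K X Rel `` {TMult s t}),
      one = undefined,
      zero = alg_cong K X Rel `` {TZero},
      add = (\<lambda>S T. \<Union>s\<in>S. \<Union>t\<in>T. alg_cong K X Rel `` {TAdd s t}),
      smult = (\<lambda>a T. \<Union>t\<in>T. alg_cong K X Rel `` {TSmult a t})\<rparr>"

lemma alg_cong_in_terms:
  assumes "(s, t) \<in> alg_cong K X Rel" and "cring K"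
  shows "s \<in> alg_terms K X \<and> t \<in> alg_terms K X"
proof -
  interpret cring K by fact
  show ?thesis using assms(1)
    by induction (auto intro: alg_terms.intros)
qed

lemma equiv_alg_cong:
  assumes "cring K"
  shows "equiv (alg_terms K X) (alg_cong K X Rel)"
  using alg_cong_in_terms[OF _ assms]
  by (intro equivI refl_onI symI transI) (auto intro: alg_cong.refl alg_cong.sym alg_cong.trans)

context
  fixes K :: "('k, 'n) ring_scheme" and X :: "'g set"
    and Rel :: "(('k, 'g) alg_term \<times> ('k, 'g) alg_term) set"
  assumes cring: "cring K"
begin

lemma presented_algebra_ops:
  assumes "s \<in> alg_terms K X" and "t \<in> alg_terms K X"
  shows "alg_cong K X Rel `` {s} \<oplus>\<^bsub>presented_algebra K X Rel\<^esub> alg_cong K X Rel `` {t} =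
           alg_cong K X Rel `` {TAdd s t}"
    and "alg_cong K X Rel `` {s} \<otimes>\<^bsub>presented_algebra K X Rel\<^esub> alg_cong K X Rel `` {t} =
           alg_cong K X Rel `` {TMult s t}"
    and "a \<in> carrier K \<Longrightarrow> a \<odot>\<^bsub>presented_algebra K X Rel\<^esub> alg_cong K X Rel `` {t} =
           alg_cong K X Rel `` {TSmult a t}"
proof -
  note eq = equiv_alg_cong[OF cring, of X Rel]
  have "congruent2 (alg_cong K X Rel) (alg_cong K X Rel)
          (\<lambda>s t. alg_cong K X Rel `` {TAdd s t})"
    by (intro congruent2I') (auto intro!: equiv_class_eq[OF eq] alg_cong.add_cong)
  from UN_equiv_class2[OF eq eq this assms]
  show "alg_cong K X Rel `` {s} \<oplus>\<^bsub>presented_algebra K X Rel\<^esub> alg_cong K X Rel `` {t} =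
           alg_cong K X Rel `` {TAdd s t}"
    by (simp add: presented_algebra_def)
  have "congruent2 (alg_cong K X Rel) (alg_cong K X Rel)
          (\<lambda>s t. alg_cong K X Rel `` {TMult s t})"
    by (intro congruent2I') (auto intro!: equiv_class_eq[OF eq] alg_cong.mult_cong)
  from UN_equiv_class2[OF eq eq this assms]
  show "alg_cong K X Rel `` {s} \<otimes>\<^bsub>presented_algebra K X Rel\<^esub> alg_cong K X Rel `` {t} =
           alg_cong K X Rel `` {TMult s t}"
    by (simp add: presented_algebra_def)
  show "a \<odot>\<^bsub>presented_algebra K X Rel\<^esub> alg_cong K X Rel `` {t} =
           alg_cong K X Rel `` {TSmult a t}" if "a \<in> carrier K"
  proof -
    have "congruent (alg_cong K X Rel) (\<lambda>t. alg_cong K X Rel `` {TSmult a t})"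
      using that by (intro congruentI) (auto intro!: equiv_class_eq[OF eq] alg_cong.smult_cong)
    from UN_equiv_class[OF eq this assms(2)] show ?thesis
      by (simp add: presented_algebra_def)
  qed
qed

lemma presented_algebra_carrierE:
  assumes "x \<in> carrier (presented_algebra K X Rel)"
  obtains t where "t \<in> alg_terms K X" and "x = alg_cong K X Rel `` {t}"
  using assms by (auto simp: presented_algebra_def elim: quotientE)

lemma presented_algebra_carrierI:
  "t \<in> alg_terms K X \<Longrightarrow> alg_cong K X Rel `` {t} \<in> carrier (presented_algebra K X Rel)"
  by (auto simp: presented_algebra_def intro: quotientI)

lemma presented_algebra_zero:
  "\<zero>\<^bsub>presented_algebra K X Rel\<^esub> = alg_cong K X Rel `` {TZero}"
  by (simp add: presented_algebra_def)

lemma nonunital_algebra_presented_algebra: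
  "nonunital_algebra K (presented_algebra K X Rel)"
proof -
  interpret cring K by (rule cring)
  note eq = equiv_class_eq[OF equiv_alg_cong[OF cring]]
  note [simp] = presented_algebra_ops presented_algebra_zero alg_terms.intros
    presented_algebra_carrierI
  show ?thesis
  proof (intro nonunital_algebra.intro nonunital_algebra_axioms.intro moduleI
      nonunital_ring.intro nonunital_ring_axioms.intro cring)
    show "abelian_group (presented_algebra K X Rel)"
    proof (rule abelian_groupI)
      fix x assume "x \<in> carrier (presented_algebra K X Rel)"
      then obtain t where t: "t \<in> alg_terms K X" "x = alg_cong K X Rel `` {t}"
        by (rule presented_algebra_carrierE)
      then show "\<exists>y\<in>carrier (presented_algebra K X Rel).
          y \<oplus>\<^bsub>presented_algebra K X Rel\<^esub> x = \<zero>\<^bsub>presented_algebra K X Rel\<^esub>"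
        by (intro bexI[of _ "alg_cong K X Rel `` {TNeg t}"])
           (auto intro!: eq alg_cong.add_neg)
    qed ((elim presented_algebra_carrierE,
          simp add: eq[OF alg_cong.add_assoc] eq[OF alg_cong.add_zero]) | simp |
         (rule eq[OF alg_cong.add_comm], assumption, assumption))+
    then show "abelian_group (presented_algebra K X Rel)" .
  qed (elim presented_algebra_carrierE,
       simp add: eq[OF alg_cong.mult_assoc] eq[OF alg_cong.distrib_l] eq[OF alg_cong.distrib_r]
          eq[OF alg_cong.smult_add_l] eq[OF alg_cong.smult_add_r] eq[OF alg_cong.smult_smult]
          eq[OF alg_cong.smult_one] eq[OF alg_cong.smult_mult_l] eq[OF alg_cong.smult_mult_r])+
qed

end

text \<open>Well-definedness of evaluation in any algebra where the relations hold (universal property).\<close>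

primrec alg_eval :: "('k, 'b, 'm) module_scheme \<Rightarrow> ('g \<Rightarrow> 'b) \<Rightarrow> ('k, 'g) alg_term \<Rightarrow> 'b" where
  "alg_eval A f (TGen x) = f x"
| "alg_eval A f TZero = \<zero>\<^bsub>A\<^esub>"
| "alg_eval A f (TAdd s t) = alg_eval A f s \<oplus>\<^bsub>A\<^esub> alg_eval A f t"
| "alg_eval A f (TNeg t) = \<ominus>\<^bsub>A\<^esub> alg_eval A f t"
| "alg_eval A f (TMult s t) = alg_eval A f s \<otimes>\<^bsub>A\<^esub> alg_eval A f t"
| "alg_eval A f (TSmult a t) = a \<odot>\<^bsub>A\<^esub> alg_eval A f t"

lemma alg_eval_cong:
  assumes "nonunital_algebra K A" and f: "f \<in> X \<rightarrow> carrier A"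
    and rel: "\<And>s t. \<lbrakk>(s, t) \<in> Rel; s \<in> alg_terms K X; t \<in> alg_terms K X\<rbrakk> \<Longrightarrow>
                alg_eval A f s = alg_eval A f t"
    and "(s, t) \<in> alg_cong K X Rel"
  shows "alg_eval A f s = alg_eval A f t"
proof -
  interpret A: nonunital_algebra K A by fact
  have *: "alg_eval A f t \<in> carrier A" if "t \<in> alg_terms K X" for t
    using that by induction (use f in \<open>auto intro: A.m_closed\<close>)
  from assms(4) show ?thesis
    by induction
      (auto simp: * rel A.m_assoc A.M.a_ac A.l_distr A.r_distr A.M.r_neg A.M.l_neg
         A.smult_l_distr A.smult_r_distr A.smult_assoc1 A.smult_mult_l A.smult_mult_r)
qed


section \<open>Leavitt path algebras\<close>

text \<open>
  For a directed graph \<open>E\<close>, the source and range maps are \<open>tail E\<close> and \<open>head E\<close>.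
\<close>

datatype ('v, 'e) leavitt_gen = Vertex 'v | Edge 'e | Ghost 'e

definition leavitt_gens :: "('v, 'e) pre_digraph \<Rightarrow> ('v, 'e) leavitt_gen set" where
  "leavitt_gens E = Vertex ` verts E \<union> Edge ` arcs E \<union> Ghost ` arcs E"

abbreviation TV :: "'v \<Rightarrow> ('k, ('v, 'e) leavitt_gen) alg_term" where
  "TV v \<equiv> TGen (Vertex v)"

abbreviation TE :: "'e \<Rightarrow> ('k, ('v, 'e) leavitt_gen) alg_term" where
  "TE e \<equiv> TGen (Edge e)"

abbreviation TG :: "'e \<Rightarrow> ('k, ('v, 'e) leavitt_gen) alg_term" where
  "TG e \<equiv> TGen (Ghost e)"

text \<open>
  In the last rule the finite set of edges starting at \<open>v\<close> is enumerated by a list \<open>es\<close>; the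
  choice of the enumeration is irrelevant modulo the algebra axioms.
\<close>

inductive_set leavitt_rels ::
    "('v, 'e) pre_digraph \<Rightarrow>
       (('k, ('v, 'e) leavitt_gen) alg_term \<times> ('k, ('v, 'e) leavitt_gen) alg_term) set"
  for E :: "('v, 'e) pre_digraph" where
  vertex_idem: "v \<in> verts E \<Longrightarrow> (TMult (TV v) (TV v), TV v) \<in> leavitt_rels E"
| vertex_orth: "\<lbrakk>v \<in> verts E; w \<in> verts E; v \<noteq> w\<rbrakk> \<Longrightarrow>
    (TMult (TV v) (TV w), TZero) \<in> leavitt_rels E"
| tail_edge: "e \<in> arcs E \<Longrightarrow> (TMult (TV (tail E e)) (TE e), TE e) \<in> leavitt_rels E"
| edge_head: "e \<in> arcs E \<Longrightarrow> (TMult (TE e) (TV (head E e)), TE e) \<in> leavitt_rels E"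
| head_ghost: "e \<in> arcs E \<Longrightarrow> (TMult (TV (head E e)) (TG e), TG e) \<in> leavitt_rels E"
| ghost_tail: "e \<in> arcs E \<Longrightarrow> (TMult (TG e) (TV (tail E e)), TG e) \<in> leavitt_rels E"
| ghost_edge: "e \<in> arcs E \<Longrightarrow> (TMult (TG e) (TE e), TV (head E e)) \<in> leavitt_rels E"
| ghost_edge_orth: "\<lbrakk>e \<in> arcs E; f \<in> arcs E; e \<noteq> f\<rbrakk> \<Longrightarrow>
    (TMult (TG e) (TE f), TZero) \<in> leavitt_rels E"
| vertex_sum: "\<lbrakk>v \<in> verts E; finite (out_arcs E v); out_arcs E v \<noteq> {};
      distinct es; set es = out_arcs E v\<rbrakk> \<Longrightarrow>
    (TV v, foldr (\<lambda>e. TAdd (TMult (TE e) (TG e))) es TZero) \<in> leavitt_rels E"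

definition leavitt_path_algebra ::
    "('k, 'n) ring_scheme \<Rightarrow> ('v, 'e) pre_digraph \<Rightarrow>
       ('k, ('k, ('v, 'e) leavitt_gen) alg_term set) module" where
  "leavitt_path_algebra K E = presented_algebra K (leavitt_gens E) (leavitt_rels E)"


section \<open>Hopf graphs\<close>

definition conjugacy_classes :: "('a, 'm) monoid_scheme \<Rightarrow> 'a set set" where
  "conjugacy_classes G = orbits G (carrier G) (\<lambda>g x. g \<otimes>\<^bsub>G\<^esub> x \<otimes>\<^bsub>G\<^esub> inv\<^bsub>G\<^esub> g)"

text \<open>
  A ramification data is a function \<open>r :: 'a set \<Rightarrow> nat\<close> of which only the values on
  \<open>conjugacy_classes G\<close> are used.
\<close>

definition ramification_support :: "('a, 'm) monoid_scheme \<Rightarrow> ('a set \<Rightarrow> nat) \<Rightarrow> 'a set set" where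
  "ramification_support G r = {C \<in> conjugacy_classes G. r C > 0}"

text \<open>The arc \<open>(x, C, c, i)\<close> is the \<open>i\<close>-th of the \<open>r C\<close> edges from \<open>x\<close> to \<open>x c\<close>, \<open>c \<in> C\<close>.\<close>

definition hopf_graph ::
    "('a, 'm) monoid_scheme \<Rightarrow> ('a set \<Rightarrow> nat) \<Rightarrow> ('a, 'a \<times> 'a set \<times> 'a \<times> nat) pre_digraph" where
  "hopf_graph G r =
     \<lparr>verts = carrier G,
      arcs = {(x, C, c, i). x \<in> carrier G \<and> C \<in> conjugacy_classes G \<and> c \<in> C \<and> i < r C},
      tail = (\<lambda>(x, C, c, i). x),
      head = (\<lambda>(x, C, c, i). x \<otimes>\<^bsub>G\<^esub> c)\<rparr>"

lemma wf_digraph_hopf_graph: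
  assumes "group G"
  shows "wf_digraph (hopf_graph G r)"
proof -
  interpret group G by fact
  show ?thesis
    by standard
      (auto simp: hopf_graph_def conjugacy_classes_def orbits_def orbit_def)
qed

inductive_set subsemigroup_generated :: "('a, 'm) monoid_scheme \<Rightarrow> 'a set \<Rightarrow> 'a set"
  for G :: "('a, 'm) monoid_scheme" and X :: "'a set" where
  incl: "x \<in> X \<Longrightarrow> x \<in> subsemigroup_generated G X"
| mult: "\<lbrakk>x \<in> subsemigroup_generated G X; y \<in> subsemigroup_generated G X\<rbrakk> \<Longrightarrow>
    x \<otimes>\<^bsub>G\<^esub> y \<in> subsemigroup_generated G X"

definition ramification_semigroup :: "('a, 'm) monoid_scheme \<Rightarrow> ('a set \<Rightarrow> nat) \<Rightarrow> 'a set" where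
  "ramification_semigroup G r = subsemigroup_generated G (\<Union> (ramification_support G r))"

text \<open>
  A sum of cardinals, possibly infinite. Neither \<open>sum\<close> nor \<open>card\<close> would do, both being \<open>0\<close> on
  infinite sets.
\<close>

definition ramification_degree ::
    "('a, 'm) monoid_scheme \<Rightarrow> ('a set \<Rightarrow> nat) \<Rightarrow> ('a set \<times> nat \<times> 'a) rel" where
  "ramification_degree G r = (CSUM C : |conjugacy_classes G|. |{..<r C}| *c |C| )"

end

theory Submission
  imports Defs "Graph_Theory.Arc_Walk" "HOL-Library.Sublist"
begin

text \<open>
  Sufficiency: if every vertex emits at least two edges and any two vertices are joined by a path,
  then every nonzero \<open>x\<close> can be reduced to a vertex, \<open>a x b = w\<close>. First \<open>x\<close> is multiplied on the
  right by edges until it involves no ghost edges; multiplying by the adjoint of a shortest path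
  occurring in it gives \<open>k v + z\<close>, where \<open>z\<close> is a combination of nontrivial closed paths at \<open>v\<close>, and
  \<open>z\<close> is killed by compressing with a path \<open>\<delta>\<close> that is not a prefix of \<open>\<beta> \<delta>\<close> for any of these closed
  paths \<open>\<beta>\<close>. Simplicity follows at once, and a closed path at \<open>w\<close> makes \<open>x b w a\<close> an infinite
  idempotent.

  Necessity: if \<open>1 \<notin> S\<close>, the graph is acyclic, so finitely many elements lie in a finite-dimensional
  subalgebra, in which \<open>t s = e\<close> forces \<open>s t = e\<close>. If \<open>1 \<in> S \<noteq> G\<close>, the functions on the infinite walks
  that avoid the hereditary set \<open>S\<close> form a module whose annihilator is a proper nonzero ideal. If
  \<open>S = G\<close> and there is one edge per vertex, the corner of each vertex is commutative.
\<close>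

text \<open>Two obstacles shape the argument. A vertex v may emit infinitely many edges, so an
  element x killed by every edge at v cannot always be discarded by writing v as a sum. The remedy
  is to cut with v minus a finite partial sum over a set F of edges: this gives x = p (v - sum) with
  p free of ghost edges, and an edge outside F would annihilate p. That is impossible, since the
  compressing path \<delta> may be made to begin with a prescribed edge. Secondly, the presentation
  does not show by itself that vertices are nonzero or paths independent. Nonvanishing comes from
  the action on functions on infinite walks (with nothing to avoid); a minimal number of terms takes
  the place of linear independence. Infinite idempotents are handled through elements s, t of eAe
  with ts = e and st \<noteq> e, because endomorphisms of eA are left multiplications by elements of
  eAe. Finally, G acts on the Hopf graph by left translation, so all vertices look alike and the
  degree can be read off at the identity.\<close>

section \<open>Rings without unit\<close>

context nonunital_ring
begin

lemma r_null: "x \<in> carrier R \<Longrightarrow> x \<otimes> \<zero> = \<zero>"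
  by (metis add.l_cancel_one' local.r_distr m_closed r_zero zero_closed)

lemma l_null: "x \<in> carrier R \<Longrightarrow> \<zero> \<otimes> x = \<zero>"
  by (metis add.l_cancel_one' l_distr m_closed r_zero zero_closed)

lemma r_minus:
  assumes "x \<in> carrier R" "y \<in> carrier R"
  shows "x \<otimes> (\<ominus> y) = \<ominus> (x \<otimes> y)"
proof (rule minus_equality[symmetric])
  show "x \<otimes> (\<ominus> y) \<oplus> x \<otimes> y = \<zero>"
    using assms by (simp add: r_distr[symmetric] l_neg r_null)
qed (use assms in \<open>auto intro: m_closed\<close>)

lemma l_minus:
  assumes "x \<in> carrier R" "y \<in> carrier R"
  shows "(\<ominus> x) \<otimes> y = \<ominus> (x \<otimes> y)"
proof (rule minus_equality[symmetric])
  show "(\<ominus> x) \<otimes> y \<oplus> x \<otimes> y = \<zero>"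
    using assms by (simp add: l_distr[symmetric] l_neg l_null)
qed (use assms in \<open>auto intro: m_closed\<close>)

lemma r_diff:
  "\<lbrakk>x \<in> carrier R; y \<in> carrier R; z \<in> carrier R\<rbrakk> \<Longrightarrow> z \<otimes> (x \<ominus> y) = z \<otimes> x \<ominus> z \<otimes> y"
  by (simp add: minus_eq r_distr r_minus)

lemma l_diff:
  "\<lbrakk>x \<in> carrier R; y \<in> carrier R; z \<in> carrier R\<rbrakk> \<Longrightarrow> (x \<ominus> y) \<otimes> z = x \<otimes> z \<ominus> y \<otimes> z"
  by (simp add: minus_eq l_distr l_minus)

lemma diff_self: "x \<in> carrier R \<Longrightarrow> x \<ominus> x = \<zero>"
  by (simp add: minus_eq r_neg)

lemma commute_mult:
  assumes "x \<in> carrier R" "y \<in> carrier R" "z \<in> carrier R" "x \<otimes> y = y \<otimes> x" "x \<otimes> z = z \<otimes> x"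
  shows "x \<otimes> (y \<otimes> z) = (y \<otimes> z) \<otimes> x"
proof -
  have "x \<otimes> (y \<otimes> z) = (y \<otimes> x) \<otimes> z" using assms by (simp add: m_assoc[symmetric])
  also have "\<dots> = y \<otimes> (z \<otimes> x)" using assms m_assoc[of y x z] by simp
  finally show ?thesis using assms by (simp add: m_assoc)
qed

lemma finsum_mult_left:
  assumes "finite F" "f \<in> F \<rightarrow> carrier R" "a \<in> carrier R"
  shows "a \<otimes> finsum R f F = finsum R (\<lambda>i. a \<otimes> f i) F"
  using assms by (induction F rule: finite_induct) (auto simp: r_null r_distr m_closed Pi_iff)

lemma finsum_mult_right:
  assumes "finite F" "f \<in> F \<rightarrow> carrier R" "a \<in> carrier R"
  shows "finsum R f F \<otimes> a = finsum R (\<lambda>i. f i \<otimes> a) F"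
  using assms by (induction F rule: finite_induct) (auto simp: l_null l_distr m_closed Pi_iff)

lemma additive_subgroupI':
  assumes "I \<subseteq> carrier R" "\<zero> \<in> I" "\<And>x y. \<lbrakk>x \<in> I; y \<in> I\<rbrakk> \<Longrightarrow> x \<oplus> y \<in> I"
    "\<And>x. x \<in> I \<Longrightarrow> \<ominus> x \<in> I"
  shows "additive_subgroup I R"
proof (rule additive_subgroup.intro, rule add.subgroupI)
  show "I \<noteq> {}" using assms(2) by auto
qed (use assms in auto)

lemma principal_right_ideal:
  assumes "e \<in> carrier R" "e \<otimes> e = e"
  shows "e <# carrier R = {x \<in> carrier R. e \<otimes> x = x}"
proof (intro equalityI subsetI)
  fix x assume "x \<in> e <# carrier R"
  then obtain y where y: "y \<in> carrier R" "x = e \<otimes> y" by (auto simp: l_coset_def)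
  then have "e \<otimes> x = x" using assms m_assoc[of e e y] by simp
  then show "x \<in> {x \<in> carrier R. e \<otimes> x = x}" using y assms by (simp add: m_closed)
next
  fix x assume "x \<in> {x \<in> carrier R. e \<otimes> x = x}"
  then have "x \<in> carrier R" "x = e \<otimes> x" by simp_all
  then show "x \<in> e <# carrier R" unfolding l_coset_def by blast
qed

lemma right_ideal_Int:
  assumes "right_ideal R I" "right_ideal R J"
  shows "right_ideal R (I \<inter> J)"
proof -
  interpret I: additive_subgroup I R using assms by (simp add: right_ideal_def)
  interpret J: additive_subgroup J R using assms by (simp add: right_ideal_def)
  show ?thesis
    using assms unfolding right_ideal_def by (intro conjI additive_subgroupI') auto
qed

lemma right_ideal_annihilator:
  assumes "h \<in> carrier R"
  shows "right_ideal R {x \<in> carrier R. h \<otimes> x = \<zero>}"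
  unfolding right_ideal_def
  by (intro conjI additive_subgroupI' ballI)
    (use assms in \<open>auto simp: r_distr m_closed r_null r_minus m_assoc[symmetric] l_null\<close>)

lemma right_ideal_fixed:
  assumes "h \<in> carrier R"
  shows "right_ideal R {x \<in> carrier R. h \<otimes> x = x}"
  unfolding right_ideal_def
  by (intro conjI additive_subgroupI')
    (use assms in \<open>auto simp: r_distr m_closed r_null r_minus m_assoc[symmetric]\<close>)

text \<open>Left multiplication by \<open>s\<close> carries eR onto hR for the idempotent h = st,
  with inverse left multiplication by \<open>t\<close>; the complement of hR in eR is the part
  annihilated by h. The condition st \<noteq> e makes the summand proper.\<close>

lemma infinite_idempotentI:
  assumes carr: "e \<in> carrier R" "s \<in> carrier R" "t \<in> carrier R"
    and e: "e \<otimes> e = e" and s: "e \<otimes> s = s" "s \<otimes> e = s" and t: "e \<otimes> t = t" "t \<otimes> e = t"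
    and ts: "t \<otimes> s = e" and st: "s \<otimes> t \<noteq> e"
  shows "infinite_idempotent R e"
proof -
  define h where "h = s \<otimes> t"
  define M where "M = {x \<in> carrier R. e \<otimes> x = x}"
  define N where "N = {x \<in> carrier R. h \<otimes> x = x}"
  define N' where "N' = {x \<in> carrier R. e \<otimes> x = x \<and> h \<otimes> x = \<zero>}"
  have h: "h \<in> carrier R" using carr by (simp add: h_def m_closed)
  have eh: "e \<otimes> h = h" using m_assoc[of e s t] carr s(1) by (simp add: h_def)
  have he: "h \<otimes> e = h" using m_assoc[of s t e] carr t(2) by (simp add: h_def)
  have hs: "h \<otimes> s = s" using m_assoc[of s t s] carr ts s(2) by (simp add: h_def)
  have hh: "h \<otimes> h = h" using m_assoc[of h s t] h hs carr by (simp add: h_def)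
  have NM: "e \<otimes> x = x" if "x \<in> N" for x
    using that m_assoc[of e h x] carr(1) h eh by (simp add: N_def)
  have "proper_direct_summand R N M"
    unfolding proper_direct_summand_def
  proof (intro conjI exI[of _ N'])
    show "right_ideal R N" unfolding N_def by (rule right_ideal_fixed[OF h])
    show "right_ideal R N'" 
      using right_ideal_Int[OF right_ideal_fixed[OF carr(1)] right_ideal_annihilator[OF h]]
      unfolding N'_def by (simp add: Int_def conj_ac cong: conj_cong)
    have "e \<in> M" "e \<notin> N" using carr e st he by (auto simp: M_def N_def h_def)
    then show "N \<noteq> M" by blast
    show "N \<inter> N' = {\<zero>}" using carr h by (auto simp: N_def N'_def r_null)
    show "N <+>\<^bsub>R\<^esub> N' = M"
    proof (intro equalityI subsetI)
      fix x assume "x \<in> N <+>\<^bsub>R\<^esub> N'"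
      then obtain a b where ab: "a \<in> N" "b \<in> N'" "x = a \<oplus> b"
        by (auto simp: set_add_def')
      then show "x \<in> M" using NM[OF ab(1)] carr
        by (auto simp: M_def N_def N'_def r_distr)
    next
      fix x assume x: "x \<in> M"
      then have xc: "x \<in> carrier R" and ex: "e \<otimes> x = x" by (auto simp: M_def)
      \<comment> \<open>Peirce decomposition with respect to \<open>h\<close>: the second component
        is (e - h)x, written x - hx because ex = x.\<close>
      have "h \<otimes> x \<in> N" using xc h hh by (simp add: N_def m_closed m_assoc[symmetric])
      moreover have "x \<ominus> h \<otimes> x \<in> N'"
        using xc h hh carr ex eh
        by (simp add: N'_def m_closed r_diff m_assoc[symmetric] diff_self)
      moreover have "x = h \<otimes> x \<oplus> (x \<ominus> h \<otimes> x)"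
        using xc h by (simp add: minus_eq m_closed a_ac r_neg)
      ultimately show "x \<in> N <+>\<^bsub>R\<^esub> N'" by (auto simp: set_add_def')
    qed
  qed
  moreover have "right_module_iso R M N"
    unfolding right_module_iso_def
  proof (intro exI[of _ "\<lambda>x. s \<otimes> x"] conjI ballI)
    show "bij_betw ((\<otimes>) s) M N"
    proof (rule bij_betw_byWitness[where f' = "(\<otimes>) t"])
      show "\<forall>a\<in>M. t \<otimes> (s \<otimes> a) = a"
        using carr ts by (auto simp: M_def m_assoc[symmetric])
      show "\<forall>a\<in>N. s \<otimes> (t \<otimes> a) = a"
        using carr by (auto simp: N_def h_def m_assoc[symmetric])
      show "(\<otimes>) s ` M \<subseteq> N"
        using carr h hs by (auto simp: M_def N_def m_closed m_assoc[symmetric])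
      show "(\<otimes>) t ` N \<subseteq> M"
        using carr t by (auto simp: M_def N_def m_closed m_assoc[symmetric])
    qed
  qed (use carr in \<open>auto simp: M_def r_distr m_assoc\<close>)
  ultimately show ?thesis
    unfolding infinite_idempotent_def principal_right_ideal[OF carr(1) e] M_def[symmetric]
    using carr e by auto
qed

text \<open>Every x in eR is ex, so the given isomorphism \<open>f\<close> is left multiplication by
  s = f(e). Splitting e = n + n' along the direct sum gives a left identity \<open>n\<close> of the
  summand, and its preimage \<open>t\<close> satisfies st = n.\<close>

lemma infinite_idempotentE:
  assumes "infinite_idempotent R e"
  obtains s t where "e \<in> carrier R" "s \<in> carrier R" "t \<in> carrier R" "e \<otimes> e = e"
    "e \<otimes> s = s" "s \<otimes> e = s" "e \<otimes> t = t" "t \<otimes> e = t" "t \<otimes> s = e" "s \<otimes> t \<noteq> e"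
proof -
  define M where "M = {x \<in> carrier R. e \<otimes> x = x}"
  from assms have e: "e \<in> carrier R" and ee: "e \<otimes> e = e"
    by (auto simp: infinite_idempotent_def)
  from assms obtain N where N: "proper_direct_summand R N M" "right_module_iso R M N"
    unfolding infinite_idempotent_def principal_right_ideal[OF e ee] M_def[symmetric] by auto
  obtain N' where ri: "right_ideal R N" "right_ideal R N'" and ne: "N \<noteq> M"
    and int: "N \<inter> N' = {\<zero>}" and sum: "N <+>\<^bsub>R\<^esub> N' = M"
    using N(1) by (auto simp: proper_direct_summand_def)
  obtain f where f: "bij_betw f M N" and
    fm: "\<And>x a. \<lbrakk>x \<in> M; a \<in> carrier R\<rbrakk> \<Longrightarrow> f (x \<otimes> a) = f x \<otimes> a"
    using N(2) by (auto simp: right_module_iso_def)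
  interpret N: additive_subgroup N R using ri by (simp add: right_ideal_def)
  interpret N': additive_subgroup N' R using ri by (simp add: right_ideal_def)
  have Nm: "x \<otimes> a \<in> N" if "x \<in> N" "a \<in> carrier R" for x a
    using ri that by (auto simp: right_ideal_def)
  have Nm': "x \<otimes> a \<in> N'" if "x \<in> N'" "a \<in> carrier R" for x a
    using ri that by (auto simp: right_ideal_def)
  have NM: "N \<subseteq> M"
  proof
    fix x assume "x \<in> N"
    then have "x \<oplus> \<zero> \<in> N <+>\<^bsub>R\<^esub> N'" using N'.zero_closed unfolding set_add_def' by blast
    then show "x \<in> M" using sum N.a_Hcarr[OF \<open>x \<in> N\<close>] by simp
  qed
  have eM: "e \<in> M" using e ee by (simp add: M_def)
  then obtain n n' where n: "n \<in> N" "n' \<in> N'" "e = n \<oplus> n'"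
    using sum by (auto simp: set_add_def')
  have nc: "n \<in> carrier R" "n' \<in> carrier R" using n by auto
  define s where "s = f e"
  obtain t where t: "t \<in> M" "f t = n" using f n(1) by (metis bij_betw_iff_bijections)
  have sN: "s \<in> N" using f eM by (auto simp: s_def bij_betw_def)
  then have sM: "s \<in> M" using NM by auto
  have sc: "s \<in> carrier R" "e \<otimes> s = s" using sM by (auto simp: M_def)
  have tc: "t \<in> carrier R" "e \<otimes> t = t" using t by (auto simp: M_def)
  have se: "s \<otimes> e = s" using fm[OF eM e] ee by (simp add: s_def)
  have st: "s \<otimes> t = n" using fm[OF eM tc(1)] tc t by (simp add: s_def)
  \<comment> \<open>The sum is direct: n'x = x - nx lies in both summands, hence vanishes.\<close>
  have fixn: "n \<otimes> x = x" if x: "x \<in> N" for x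
  proof -
    have xc: "x \<in> carrier R" "e \<otimes> x = x" using x NM by (auto simp: M_def)
    have eq: "x = n \<otimes> x \<oplus> n' \<otimes> x" using xc n nc by (metis l_distr)
    then have "n' \<otimes> x = \<ominus> (n \<otimes> x) \<oplus> x"
      using xc nc by (metis add.inv_solve_left m_closed)
    also have "\<dots> \<in> N" using x n Nm xc by auto
    finally have "n' \<otimes> x = \<zero>" using Nm'[OF n(2) xc(1)] int by auto
    then show ?thesis using eq xc nc by (simp add: m_closed)
  qed
  have inj: "inj_on f M" using f by (simp add: bij_betw_def)
  have "f (t \<otimes> s) = f e" using fm[OF t(1) sc(1)] t(2) fixn[OF sN] by (simp add: s_def)
  moreover have "t \<otimes> s \<in> M" using tc sc e by (auto simp: M_def m_closed m_assoc[symmetric])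
  ultimately have ts: "t \<otimes> s = e" using inj eM by (auto dest: inj_onD)
  have "n \<otimes> e \<noteq> e"
  proof
    assume "n \<otimes> e = e"
    then have "e \<in> N" using Nm[OF n(1) e] by simp
    then have "M \<subseteq> N" using Nm[of e] by (auto simp: M_def) (metis)
    then show False using NM ne by auto
  qed
  \<comment> \<open>So far only et = t is known. Passing to \<open>t \<otimes> e\<close> adds te =
    t, keeps ts = e because se = s and ts = e, and turns st into ne, which was just seen to differ
    from e.\<close>
  then show ?thesis
    using that[of s "t \<otimes> e"] e ee sc se tc ts st
    by (simp add: m_closed m_assoc) (simp add: m_closed m_assoc[symmetric])
qed

end

section \<open>Linear spans\<close>

text \<open>One scaled generator is added at a time, so that induction treats a linear combination
  term by term; closure under sums and scalars is derived afterwards.\<close>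

inductive_set lspan :: "('k, 'n) ring_scheme \<Rightarrow> ('k, 'b, 'm) module_scheme \<Rightarrow> 'b set \<Rightarrow> 'b set"
  for K :: "('k, 'n) ring_scheme" and A :: "('k, 'b, 'm) module_scheme" and M :: "'b set" where
  lspan_zero: "\<zero>\<^bsub>A\<^esub> \<in> lspan K A M"
| lspan_add: "\<lbrakk>k \<in> carrier K; m \<in> M; x \<in> lspan K A M\<rbrakk> \<Longrightarrow>
    k \<odot>\<^bsub>A\<^esub> m \<oplus>\<^bsub>A\<^esub> x \<in> lspan K A M"

lemma lspan_mono: "\<lbrakk>x \<in> lspan K A M; M \<subseteq> N\<rbrakk> \<Longrightarrow> x \<in> lspan K A N"
  by (induction rule: lspan.induct) (auto intro: lspan.intros)

context nonunital_algebra
begin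

abbreviation span :: "'c set \<Rightarrow> 'c set" where "span \<equiv> lspan K A"

lemma lspan_closed: "\<lbrakk>x \<in> span M; M \<subseteq> carrier A\<rbrakk> \<Longrightarrow> x \<in> carrier A"
  by (induction rule: lspan.induct) auto

lemma lspan_incl: "\<lbrakk>m \<in> M; M \<subseteq> carrier A\<rbrakk> \<Longrightarrow> m \<in> span M"
  using lspan_add[OF R.one_closed _ lspan_zero, of m M A] by auto

lemma lspan_finite: "x \<in> span M \<Longrightarrow> \<exists>F. finite F \<and> F \<subseteq> M \<and> x \<in> span F"
proof (induction rule: lspan.induct)
  case (lspan_add k m x)
  then obtain F where F: "finite F" "F \<subseteq> M" "x \<in> span F" by blast
  have "k \<odot> m \<oplus> x \<in> span (insert m F)"
    using lspan.lspan_add[OF lspan_add(1), of m "insert m F" x A] lspan_mono[OF F(3), of "insert m F"]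
    by blast
  then show ?case using F lspan_add(2) by (intro exI[of _ "insert m F"]) auto
qed (auto intro: lspan_zero)

lemma lspan_plus:
  assumes "x \<in> span M" "y \<in> span M" and M: "M \<subseteq> carrier A"
  shows "x \<oplus> y \<in> span M"
  using assms(1)
proof induction
  case lspan_zero
  then show ?case using assms lspan_closed by simp
next
  case (lspan_add k m x)
  then show ?case
    using lspan.lspan_add[of k K m M "x \<oplus> y" A] M lspan_closed[OF assms(2) M] lspan_closed[of x M]
    by (auto simp: a_assoc subset_iff)
qed

lemma lspan_smult:
  assumes "x \<in> span M" "k \<in> carrier K" and M: "M \<subseteq> carrier A"
  shows "k \<odot> x \<in> span M"
  using assms(1)
proof induction
  case lspan_zero
  then show ?case using assms by (simp add: lspan.lspan_zero)
next
  case (lspan_add l m x)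
  then show ?case
    using lspan.lspan_add[of "k \<otimes>\<^bsub>K\<^esub> l" K m M "k \<odot> x" A] M assms(2) lspan_closed[of x M]
    by (auto simp: smult_r_distr smult_assoc1 subset_iff)
qed

lemma lspan_minus:
  assumes "x \<in> span M" and M: "M \<subseteq> carrier A"
  shows "\<ominus> x \<in> span M"
proof -
  have "\<ominus> x = (\<ominus>\<^bsub>K\<^esub> \<one>\<^bsub>K\<^esub>) \<odot> x"
    using lspan_closed[OF assms] by (simp add: smult_l_minus)
  then show ?thesis using lspan_smult[OF assms(1) _ M, of "\<ominus>\<^bsub>K\<^esub> \<one>\<^bsub>K\<^esub>"] by simp
qed

lemma lspan_mult_right:
  assumes "x \<in> span M" and M: "M \<subseteq> carrier A" and N: "N \<subseteq> carrier A" and c: "c \<in> carrier A"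
    and step: "\<And>m. m \<in> M \<Longrightarrow> m \<otimes> c \<in> span N"
  shows "x \<otimes> c \<in> span N"
  using assms(1)
proof induction
  case lspan_zero
  then show ?case using c by (simp add: lspan.lspan_zero l_null)
next
  case (lspan_add k m x)
  have "(k \<odot> m \<oplus> x) \<otimes> c = k \<odot> (m \<otimes> c) \<oplus> x \<otimes> c"
    using lspan_add M c lspan_closed[of x M] by (auto simp: l_distr smult_mult_l subset_iff)
  then show ?case using lspan_plus[OF lspan_smult[OF step] lspan_add.IH N] lspan_add N by simp
qed

lemma lspan_mult_left:
  assumes "x \<in> span M" and M: "M \<subseteq> carrier A" and N: "N \<subseteq> carrier A" and c: "c \<in> carrier A"
    and step: "\<And>m. m \<in> M \<Longrightarrow> c \<otimes> m \<in> span N"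
  shows "c \<otimes> x \<in> span N"
  using assms(1)
proof induction
  case lspan_zero
  then show ?case using c by (simp add: lspan.lspan_zero r_null)
next
  case (lspan_add k m x)
  have "c \<otimes> (k \<odot> m \<oplus> x) = k \<odot> (c \<otimes> m) \<oplus> c \<otimes> x"
    using lspan_add M c lspan_closed[of x M] by (auto simp: r_distr smult_mult_r subset_iff)
  then show ?case using lspan_plus[OF lspan_smult[OF step] lspan_add.IH N] lspan_add N by simp
qed

lemma lspan_mult:
  assumes x: "x \<in> span M" and y: "y \<in> span N"
    and M: "M \<subseteq> carrier A" and N: "N \<subseteq> carrier A" and P: "P \<subseteq> carrier A"
    and step: "\<And>m n. \<lbrakk>m \<in> M; n \<in> N\<rbrakk> \<Longrightarrow> m \<otimes> n \<in> span P"
  shows "x \<otimes> y \<in> span P"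
proof (rule lspan_mult_right[OF x M P lspan_closed[OF y N]])
  fix m assume m: "m \<in> M"
  then show "m \<otimes> y \<in> span P"
    by (intro lspan_mult_left[OF y N P]) (use M step in auto)
qed

text \<open>Commutation passes to spans in one argument at a time: \<open>y\<close> commutes with
  each generator, hence with \<open>x\<close>.\<close>

lemma lspan_commute:
  assumes x: "x \<in> span M" and y: "y \<in> span M" and M: "M \<subseteq> carrier A"
    and comm: "\<And>m n. \<lbrakk>m \<in> M; n \<in> M\<rbrakk> \<Longrightarrow> m \<otimes> n = n \<otimes> m"
  shows "x \<otimes> y = y \<otimes> x"
proof -
  have *: "z \<otimes> m = m \<otimes> z" if "m \<in> carrier A" "\<And>n. n \<in> M \<Longrightarrow> n \<otimes> m = m \<otimes> n" "z \<in> span M" for m z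
    using that(3)
  proof induction
    case lspan_zero
    show ?case using that by (simp add: l_null r_null)
  next
    case (lspan_add k n z)
    then show ?case using that M lspan_closed[of z M]
      by (auto simp: subset_iff l_distr r_distr smult_mult_l smult_mult_r)
  qed
  have yc: "y \<in> carrier A" using lspan_closed[OF y M] .
  have "n \<otimes> y = y \<otimes> n" if "n \<in> M" for n
    using *[of n y] that M comm y by auto
  then show ?thesis using * yc x by auto
qed

section \<open>Descending chains of subspaces\<close>

definition subspace :: "'c set \<Rightarrow> bool" where
  "subspace V \<longleftrightarrow> V \<subseteq> carrier A \<and> \<zero> \<in> V \<and> (\<forall>x\<in>V. \<forall>y\<in>V. x \<oplus> y \<in> V) \<and>
     (\<forall>k\<in>carrier K. \<forall>x\<in>V. k \<odot> x \<in> V)"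

lemma subspace_lspan: "M \<subseteq> carrier A \<Longrightarrow> subspace (span M)"
  by (auto simp: subspace_def lspan_closed lspan_plus lspan_smult lspan_zero)

lemma subspace_Int: "\<lbrakk>subspace V; subspace W\<rbrakk> \<Longrightarrow> subspace (V \<inter> W)"
  by (auto simp: subspace_def)

text \<open>Collects the occurrences of \<open>m\<close> into one coefficient; this serves to
  eliminate \<open>m\<close> in the chain argument and to isolate a leading path later.\<close>

lemma lspan_insertE:
  assumes "x \<in> span (insert m M)" and "m \<in> carrier A" and M: "M \<subseteq> carrier A"
  obtains k y where "k \<in> carrier K" "y \<in> span M" "x = k \<odot> m \<oplus> y"
proof -
  have "\<exists>k\<in>carrier K. \<exists>y\<in>span M. x = k \<odot> m \<oplus> y"
    using assms(1)
  proof induction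
    case lspan_zero
    show ?case using assms lspan.lspan_zero[of A K M] by (intro bexI[of _ "\<zero>\<^bsub>K\<^esub>"] bexI[of _ \<zero>]) auto
  next
    case (lspan_add l n x)
    then obtain k y where ky: "k \<in> carrier K" "y \<in> span M" "x = k \<odot> m \<oplus> y" by blast
    have yc: "y \<in> carrier A" using lspan_closed[OF ky(2) M] .
    show ?case
    proof (cases "n = m")
      case True
      have "l \<odot> n \<oplus> x = (l \<oplus>\<^bsub>K\<^esub> k) \<odot> m \<oplus> y"
        using True ky lspan_add assms(2) yc by (simp add: smult_l_distr a_assoc)
      then show ?thesis using ky lspan_add by blast
    next
      case False
      then have n: "n \<in> M" using lspan_add by auto
      have "l \<odot> n \<oplus> x = k \<odot> m \<oplus> (l \<odot> n \<oplus> y)"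
        using ky lspan_add assms(2) yc n M by (auto simp: a_ac subset_iff)
      then show ?thesis using ky lspan.lspan_add[OF lspan_add(1) n ky(2)] by blast
    qed
  qed
  then show ?thesis using that by blast
qed

text \<open>If a step of the chain becomes an equality after intersecting with the span of \<open>M\<close>, the
  next term already lies in that span; so at most one step is lost when \<open>m\<close> is removed.\<close>

lemma no_strictly_decreasing_subspaces:
  assumes "field K" and "finite M" "M \<subseteq> carrier A"
    and "\<And>i. subspace (V i)" "V 0 \<subseteq> span M" "\<And>i::nat. V (Suc i) \<subset> V i"
  shows False
  using assms(2-)
proof (induction M arbitrary: V rule: finite_induct)
  case empty
  have "x = \<zero>" if "x \<in> span {}" for x
    using that by induction auto
  then have "V 0 \<subseteq> {\<zero>}" using empty.prems(3) by auto
  then have "V 1 = {}"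
    using empty.prems(4)[of 0] by auto
  then show False using empty.prems(2)[of 1] by (auto simp: subspace_def)
next
  case (insert m M)
  interpret K: field K by fact
  have m: "m \<in> carrier A" and M: "M \<subseteq> carrier A" using insert.prems by auto
  have anti: "V j \<subseteq> V i" if "i \<le> j" for i j
    using that by (induction rule: dec_induct) (use insert.prems(4) in auto)
  have sub: "V i \<subseteq> span (insert m M)" for i
    using anti[of 0 i] insert.prems(3) by auto
  have drop: "V (Suc i) \<subseteq> span M" if eq: "V (Suc i) \<inter> span M = V i \<inter> span M" for i
  proof (rule ccontr)
    assume "\<not> V (Suc i) \<subseteq> span M"
    then obtain y where y: "y \<in> V (Suc i)" "y \<notin> span M" by auto
    obtain l y' where l: "l \<in> carrier K" "y' \<in> span M" "y = l \<odot> m \<oplus> y'"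
      using lspan_insertE[OF subsetD[OF sub y(1)] m M] by blast
    have y'c: "y' \<in> carrier A" using lspan_closed[OF l(2) M] .
    have l0: "l \<noteq> \<zero>\<^bsub>K\<^esub>" using y l m y'c by auto
    obtain x where x: "x \<in> V i" "x \<notin> V (Suc i)" using insert.prems(4)[of i] by auto
    obtain k x' where k: "k \<in> carrier K" "x' \<in> span M" "x = k \<odot> m \<oplus> x'"
      using lspan_insertE[OF subsetD[OF sub x(1)] m M] by blast
    have x'c: "x' \<in> carrier A" using lspan_closed[OF k(2) M] .
    \<comment> \<open>The multiple of \<open>y\<close> that cancels the \<open>m\<close>-component
      of \<open>x\<close>, so that \<open>z\<close> falls into the span of \<open>M\<close>.
      Dividing by \<open>l\<close> is where the scalars have to form a field.\<close>
    define c where "c = k \<otimes>\<^bsub>K\<^esub> inv\<^bsub>K\<^esub> l"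
    have c: "c \<in> carrier K" "c \<otimes>\<^bsub>K\<^esub> l = k"
      using k l l0 K.field_Units by (auto simp: c_def R.m_assoc)
    define z where "z = x \<oplus> (\<ominus>\<^bsub>K\<^esub> c) \<odot> y"
    have yi: "y \<in> V i" using y(1) insert.prems(4)[of i] by auto
    have carr: "x \<in> carrier A" "y \<in> carrier A" using x(1) yi insert.prems(2)[of i] by (auto simp: subspace_def)
    have "z \<in> V i" using x(1) yi insert.prems(2)[of i] c by (auto simp: subspace_def z_def)
    moreover have "z = x' \<oplus> (\<ominus>\<^bsub>K\<^esub> c) \<odot> y'"
    proof -
      have "z = (k \<odot> m \<oplus> x') \<oplus> (\<ominus> (k \<odot> m) \<oplus> (\<ominus>\<^bsub>K\<^esub> c) \<odot> y')"
        using c l k m y'c x'c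
        by (simp add: z_def smult_r_distr smult_l_minus smult_assoc1[symmetric] minus_add R.l_minus)
      also have "\<dots> = (k \<odot> m \<oplus> \<ominus> (k \<odot> m)) \<oplus> (x' \<oplus> (\<ominus>\<^bsub>K\<^esub> c) \<odot> y')"
        using c l k m y'c x'c by (simp add: a_ac)
      finally show ?thesis using c k m y'c x'c by (simp add: r_neg)
    qed
    then have "z \<in> span M" using k l c lspan_plus lspan_smult M by auto
    ultimately have "z \<in> V (Suc i)" using eq by auto
    then have "z \<oplus> c \<odot> y \<in> V (Suc i)"
      using insert.prems(2)[of "Suc i"] y c by (auto simp: subspace_def)
    moreover have "z \<oplus> c \<odot> y = x"
      using carr c by (simp add: z_def smult_l_minus a_assoc l_neg)
    ultimately show False using x by simp
  qed
  show False
  \<comment> \<open>If some term enters the smaller span, the chain from there on contradicts the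
    induction hypothesis; otherwise intersecting all terms with that span keeps every inclusion
    strict.\<close>
  proof (cases "\<exists>i. V (Suc i) \<subseteq> span M")
    case True
    then obtain i where i: "V (Suc i) \<subseteq> span M" by blast
    show False
      by (rule insert.IH[of "\<lambda>j. V (Suc i + j)"]) (use i M insert.prems in auto)
  next
    case False
    then have "V (Suc i) \<inter> span M \<noteq> V i \<inter> span M" for i using drop by blast
    then have "V (Suc i) \<inter> span M \<subset> V i \<inter> span M" for i using insert.prems(4)[of i] by blast
    then show False
      by (intro insert.IH[of "\<lambda>i. V i \<inter> span M"])
        (use M insert.prems subspace_Int subspace_lspan in auto)
  qed
qed

text \<open>Dedekind finiteness in finite dimension. With B the span of \<open>M\<close>, the sets
  s^i(eB) would form an endless strictly decreasing chain: the first step misses e, and strictness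
  propagates because \<open>t\<close> inverts left multiplication by \<open>s\<close> on eB.\<close>

lemma no_infinite_idempotent_finite_span:
  assumes "field K" and M: "finite M" "M \<subseteq> carrier A"
    and mult: "\<And>m n. \<lbrakk>m \<in> M; n \<in> M\<rbrakk> \<Longrightarrow> m \<otimes> n \<in> span M"
    and st: "s \<in> span M" "t \<in> span M" and ts: "t \<otimes> s = e" and e: "e \<otimes> e = e"
    and s: "e \<otimes> s = s" and t: "t \<otimes> e = t"
  shows "s \<otimes> t = e"
proof (rule ccontr)
  assume ne: "s \<otimes> t \<noteq> e"
  have carr: "s \<in> carrier A" "t \<in> carrier A" using st lspan_closed M by auto
  then have ec: "e \<in> carrier A" using ts m_closed by auto
  have cl: "x \<otimes> y \<in> span M" if "x \<in> span M" "y \<in> span M" for x y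
    using lspan_mult[OF that M(2) M(2) M(2) mult] .
  have eM: "e \<in> span M" using cl st ts by auto
  define V where "V = (\<lambda>i. ((\<otimes>) s ^^ i) ` {x \<in> span M. e \<otimes> x = x})"
  have V0: "V 0 = {x \<in> span M. e \<otimes> x = x}" by (simp add: V_def)
  have Vs: "V (Suc i) = (\<otimes>) s ` V i" for i by (simp add: V_def image_comp)
  have sub: "subspace (V i)" for i
  proof (induction i)
    case 0
    show ?case using M ec subspace_lspan[OF M(2)]
      by (auto simp: V0 subspace_def r_null r_distr smult_mult_r subset_iff)
  next
    case (Suc i)
    have "\<zero> \<in> (\<otimes>) s ` V i"
      using Suc carr by (intro image_eqI[of _ _ \<zero>]) (auto simp: subspace_def r_null)
    moreover have "s \<otimes> x \<oplus> s \<otimes> y \<in> (\<otimes>) s ` V i" if "x \<in> V i" "y \<in> V i" for x y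
      using Suc carr that by (intro image_eqI[of _ _ "x \<oplus> y"]) (auto simp: subspace_def r_distr subset_iff)
    moreover have "k \<odot> (s \<otimes> x) \<in> (\<otimes>) s ` V i" if "x \<in> V i" "k \<in> carrier K" for x k
      using Suc carr that by (intro image_eqI[of _ _ "k \<odot> x"]) (auto simp: subspace_def smult_mult_r subset_iff)
    ultimately show ?case using Suc carr by (auto simp: Vs subspace_def subset_iff m_closed)
  qed
  have e0: "e \<in> V 0" "e \<notin> V 1"
  proof -
    show "e \<in> V 0" using eM e by (simp add: V0)
    show "e \<notin> V 1"
    proof
      assume "e \<in> V 1"
      then obtain y where y: "y \<in> span M" "e \<otimes> y = y" "e = s \<otimes> y"
        using Vs[of 0] by (auto simp: V0)
      have yc: "y \<in> carrier A" using y lspan_closed M by auto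
      \<comment> \<open>t = te = t(sy) = (ts)y = ey = y, so e = sy would already be st.\<close>
      have "t = y" using carr yc ts t y by (metis m_assoc)
      then show False using y ne by simp
    qed
  qed
  have sub0: "V (Suc i) \<subseteq> V i \<and> V i \<subseteq> V 0" for i
  proof (induction i)
    case 0
    show ?case using Vs[of 0] cl st s carr ec lspan_closed M by (auto simp: V0 m_assoc[symmetric])
  next
    case (Suc i)
    then show ?case using Vs by blast
  qed
  have inj: "inj_on ((\<otimes>) s) (V 0)"
    by (rule inj_on_inverseI[of _ "(\<otimes>) t"])
      (use carr ts lspan_closed M in \<open>auto simp: V0 m_assoc[symmetric]\<close>)
  have strict: "V (Suc i) \<subset> V i" for i
  proof (induction i)
    case 0
    show ?case using sub0[of 0] e0 by auto
  next
    case (Suc i)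
    then have "(\<otimes>) s ` V (Suc i) \<subset> (\<otimes>) s ` V i"
      using inj sub0[of i] sub0[of "Suc i"] by (intro image_strict_mono) (auto intro: inj_on_subset)
    then show ?case by (simp add: Vs)
  qed
  show False
    by (rule no_strictly_decreasing_subspaces[OF assms(1) M, of V]) (use sub strict V0 in auto)
qed

end

section \<open>Algebras satisfying the Leavitt relations\<close>

text \<open>Only the relations and generation are assumed, so that computations use the algebra
  operations instead of congruence classes; \<open>generated\<close> is the induction principle that
  replaces inspection of terms. A vertex may still be zero here.\<close>

locale leavitt_algebra = nonunital_algebra K A + wf_digraph E
  for K :: "('k, 'n) ring_scheme" and A :: "('k, 'b, 'm) module_scheme" (structure)
    and E :: "('v, 'e) pre_digraph" +
  fixes vx :: "'v \<Rightarrow> 'b" and ed :: "'e \<Rightarrow> 'b" and gh :: "'e \<Rightarrow> 'b"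
  assumes field: "field K"
    and vx_closed [simp]: "v \<in> verts E \<Longrightarrow> vx v \<in> carrier A"
    and ed_closed [simp]: "e \<in> arcs E \<Longrightarrow> ed e \<in> carrier A"
    and gh_closed [simp]: "e \<in> arcs E \<Longrightarrow> gh e \<in> carrier A"
    and vx_idem [simp]: "v \<in> verts E \<Longrightarrow> vx v \<otimes> vx v = vx v"
    and vx_orth: "\<lbrakk>v \<in> verts E; w \<in> verts E; v \<noteq> w\<rbrakk> \<Longrightarrow> vx v \<otimes> vx w = \<zero>"
    and tail_ed [simp]: "e \<in> arcs E \<Longrightarrow> vx (tail E e) \<otimes> ed e = ed e"
    and ed_head [simp]: "e \<in> arcs E \<Longrightarrow> ed e \<otimes> vx (head E e) = ed e"
    and head_gh [simp]: "e \<in> arcs E \<Longrightarrow> vx (head E e) \<otimes> gh e = gh e"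
    and gh_tail [simp]: "e \<in> arcs E \<Longrightarrow> gh e \<otimes> vx (tail E e) = gh e"
    and gh_ed: "e \<in> arcs E \<Longrightarrow> gh e \<otimes> ed e = vx (head E e)"
    and gh_ed_orth: "\<lbrakk>e \<in> arcs E; f \<in> arcs E; e \<noteq> f\<rbrakk> \<Longrightarrow> gh e \<otimes> ed f = \<zero>"
    and vx_sum: "\<lbrakk>v \<in> verts E; finite (out_arcs E v); out_arcs E v \<noteq> {}\<rbrakk> \<Longrightarrow>
          vx v = (\<Oplus>\<^bsub>A\<^esub>e\<in>out_arcs E v. ed e \<otimes> gh e)"
    and generated [consumes 1, case_names vx ed gh zero add neg mult smult]:
      "\<lbrakk>x \<in> carrier A; \<And>v. v \<in> verts E \<Longrightarrow> P (vx v); \<And>e. e \<in> arcs E \<Longrightarrow> P (ed e);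
        \<And>e. e \<in> arcs E \<Longrightarrow> P (gh e); P \<zero>;
        \<And>x y. \<lbrakk>x \<in> carrier A; y \<in> carrier A; P x; P y\<rbrakk> \<Longrightarrow> P (x \<oplus> y);
        \<And>x. \<lbrakk>x \<in> carrier A; P x\<rbrakk> \<Longrightarrow> P (\<ominus> x);
        \<And>x y. \<lbrakk>x \<in> carrier A; y \<in> carrier A; P x; P y\<rbrakk> \<Longrightarrow> P (x \<otimes> y);
        \<And>k x. \<lbrakk>k \<in> carrier K; x \<in> carrier A; P x\<rbrakk> \<Longrightarrow> P (k \<odot> x)\<rbrakk> \<Longrightarrow> P x"
begin

declare m_closed [simp, intro] awalk_append_iff [simp del]

section \<open>Walks and their adjoints as elements of the algebra\<close>

lemma awalk_appendE: "\<lbrakk>awalk u (p @ q) w; awalk u p v\<rbrakk> \<Longrightarrow> awalk v q w"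
  by (induction p arbitrary: u) (auto simp: awalk_simps)

text \<open>The start vertex is a separate argument because an empty list of edges does not
  determine it. The companion \<open>gpth\<close> is the adjoint, with the factors in reverse
  order.\<close>

primrec pth :: "'v \<Rightarrow> 'e list \<Rightarrow> 'b" where
  "pth u [] = vx u"
| "pth u (e # p) = ed e \<otimes> pth (head E e) p"

primrec gpth :: "'v \<Rightarrow> 'e list \<Rightarrow> 'b" where
  "gpth u [] = vx u"
| "gpth u (e # p) = gpth (head E e) p \<otimes> gh e"

lemma awalk_closed:
  assumes "awalk u p v"
  shows "pth u p \<in> carrier A" "gpth u p \<in> carrier A" "vx u \<in> carrier A" "vx v \<in> carrier A"
    "u \<in> verts E" "v \<in> verts E"
proof -
  show uv: "u \<in> verts E" "v \<in> verts E" using assms by auto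
  then show "vx u \<in> carrier A" "vx v \<in> carrier A" by auto
  show "pth u p \<in> carrier A" "gpth u p \<in> carrier A"
    using assms by (induction p arbitrary: u) (auto simp: awalk_simps)
qed

lemma vx_pth: "awalk u p v \<Longrightarrow> vx u \<otimes> pth u p = pth u p"
  by (cases p) (auto simp: awalk_simps awalk_closed m_assoc[symmetric])

lemma gpth_vx: "awalk u p v \<Longrightarrow> gpth u p \<otimes> vx u = gpth u p"
  by (cases p) (auto simp: awalk_simps awalk_closed m_assoc)

lemma pth_vx: "awalk u p v \<Longrightarrow> pth u p \<otimes> vx v = pth u p"
  by (induction p arbitrary: u) (auto simp: awalk_simps awalk_closed m_assoc)

lemma vx_gpth: "awalk u p v \<Longrightarrow> vx v \<otimes> gpth u p = gpth u p"
  by (induction p arbitrary: u) (auto simp: awalk_simps awalk_closed m_assoc[symmetric])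

lemma pth_append: "\<lbrakk>awalk u p v; awalk v q w\<rbrakk> \<Longrightarrow> pth u (p @ q) = pth u p \<otimes> pth v q"
  by (induction p arbitrary: u) (auto simp: awalk_simps awalk_closed m_assoc vx_pth)

lemma gpth_append: "\<lbrakk>awalk u p v; awalk v q w\<rbrakk> \<Longrightarrow> gpth u (p @ q) = gpth v q \<otimes> gpth u p"
  by (induction p arbitrary: u) (auto simp: awalk_simps awalk_closed m_assoc[symmetric] gpth_vx)

lemma gpth_pth: "awalk u p v \<Longrightarrow> gpth u p \<otimes> pth u p = vx v"
proof (induction p arbitrary: u)
  case (Cons e p)
  then have e: "e \<in> arcs E" and p: "awalk (head E e) p v" by (auto simp: awalk_simps)
  have "gpth u (e # p) \<otimes> pth u (e # p) = gpth (head E e) p \<otimes> ((gh e \<otimes> ed e) \<otimes> pth (head E e) p)"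
    using e p by (simp add: awalk_closed m_assoc)
  then show ?case using e Cons.IH[OF p] p by (simp add: gh_ed vx_pth)
qed (auto simp: awalk_simps)

lemma vx_pth_orth: "\<lbrakk>awalk u p v; w \<in> verts E; w \<noteq> u\<rbrakk> \<Longrightarrow> vx w \<otimes> pth u p = \<zero>"
  using vx_pth[of u p v] by (metis awalk_closed(1,3,5) l_null m_assoc vx_closed vx_orth)

lemma gpth_vx_orth: "\<lbrakk>awalk u p v; w \<in> verts E; w \<noteq> u\<rbrakk> \<Longrightarrow> gpth u p \<otimes> vx w = \<zero>"
  using gpth_vx[of u p v] by (metis awalk_closed(2,3,5) r_null m_assoc vx_closed vx_orth)

lemma gpth_pth_start_orth:
  assumes "awalk u p v" "awalk u' q w" "u \<noteq> u'"
  shows "gpth u p \<otimes> pth u' q = \<zero>"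
proof -
  have "gpth u p \<otimes> pth u' q = gpth u p \<otimes> (vx u \<otimes> pth u' q)"
    using assms by (simp add: m_assoc[symmetric] gpth_vx awalk_closed)
  then show ?thesis using assms by (simp add: vx_pth_orth awalk_closed r_null)
qed

text \<open>Equal first edges cancel through \<open>gh_ed\<close>. As neither walk is a prefix of
  the other, a first pair of different edges is reached, and there \<open>gh_ed_orth\<close> gives
  zero.\<close>

lemma gpth_pth_orth:
  "\<lbrakk>awalk u p v; awalk u q w; \<not> prefix p q; \<not> prefix q p\<rbrakk> \<Longrightarrow> gpth u p \<otimes> pth u q = \<zero>"
proof (induction p arbitrary: u q)
  case (Cons e p)
  then obtain f q' where q: "q = f # q'" by (cases q) auto
  have e: "e \<in> arcs E" "awalk (head E e) p v" and f: "f \<in> arcs E" "awalk (head E f) q' w"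
    using Cons.prems q by (auto simp: awalk_simps)
  have eq: "gpth u (e # p) \<otimes> pth u q = gpth (head E e) p \<otimes> ((gh e \<otimes> ed f) \<otimes> pth (head E f) q')"
    using e f by (simp add: awalk_closed m_assoc q)
  show ?case
  proof (cases "e = f")
    case True
    then show ?thesis using eq e f Cons.IH[OF e(2), of q'] Cons.prems by (simp add: q gh_ed vx_pth)
  next
    case False
    then show ?thesis using eq e f by (simp add: gh_ed_orth awalk_closed l_null r_null)
  qed
qed auto

text \<open>The product of the two middle factors of \<open>(\<alpha> \<beta>\<^sup>*) (\<gamma> \<delta>\<^sup>*)\<close>.\<close>

lemma gpth_pth_cases:
  assumes "awalk w q v" "awalk w' p v'"
  obtains "gpth w q \<otimes> pth w' p = \<zero>"
    | r where "w' = w" "p = q @ r" "awalk v r v'" "gpth w q \<otimes> pth w' p = pth v r"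
    | r where "w' = w" "q = p @ r" "awalk v' r v" "gpth w q \<otimes> pth w' p = gpth v' r"
proof (cases "w = w'")
  case False
  then show ?thesis using that(1) gpth_pth_start_orth assms by blast
next
  case True
  consider "prefix q p" | "prefix p q" | "\<not> prefix q p" "\<not> prefix p q" by blast
  then show ?thesis
  proof cases
    case 1
    then obtain r where r: "p = q @ r" by (auto simp: prefix_def)
    have rv: "awalk v r v'" using awalk_appendE[of w q r v' v] assms True r by simp
    have "gpth w q \<otimes> pth w' p = (gpth w q \<otimes> pth w q) \<otimes> pth v r"
      using assms rv r True pth_append[OF assms(1) rv] by (simp add: m_assoc awalk_closed)
    then show ?thesis using that(2)[of r] True r rv assms by (simp add: gpth_pth vx_pth)
  next
    case 2
    then obtain r where r: "q = p @ r" by (auto simp: prefix_def)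
    have rv: "awalk v' r v" using awalk_appendE[of w p r v v'] assms True r by simp
    have "gpth w q \<otimes> pth w' p = gpth v' r \<otimes> (gpth w p \<otimes> pth w p)"
      using assms rv r True gpth_append[OF _ rv] by (simp add: m_assoc awalk_closed)
    then show ?thesis using that(3)[of r] True r rv assms by (simp add: gpth_pth gpth_vx)
  next
    case 3
    then show ?thesis using that(1) gpth_pth_orth assms True by blast
  qed
qed

section \<open>Monomials and their span\<close>

definition monomials :: "'b set" where
  "monomials = {pth u p \<otimes> gpth w q | u p w q v. awalk u p v \<and> awalk w q v}"

lemma monomials_closed: "monomials \<subseteq> carrier A"
  by (auto simp: monomials_def awalk_closed)

text \<open>\<open>W\<close> bounds the start vertices of both walks and \<open>F\<close> their
  edges; \<open>W\<close> is what controls the empty walks. The family is closed under products up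
  to zero, and in an acyclic graph it is finite for finite \<open>W\<close> and
  \<open>F\<close>.\<close>

definition monomials_in :: "'v set \<Rightarrow> 'e set \<Rightarrow> 'b set" where
  "monomials_in W F = {pth u p \<otimes> gpth w q | u p w q v. awalk u p v \<and> awalk w q v \<and>
     u \<in> W \<and> w \<in> W \<and> set p \<subseteq> F \<and> set q \<subseteq> F}"

lemma monomials_in_UNIV: "monomials_in UNIV UNIV = monomials"
  by (simp add: monomials_in_def monomials_def)

text \<open>A nonzero product extends an outer walk by the remainder \<open>r\<close> of an inner
  one: the outer start vertices stay and no new edge appears.\<close>

lemma monomials_in_mult:
  assumes "m \<in> monomials_in W F" "n \<in> monomials_in W F"
  shows "m \<otimes> n = \<zero> \<or> m \<otimes> n \<in> monomials_in W F"
proof -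
  obtain u p w q v where m: "m = pth u p \<otimes> gpth w q" "awalk u p v" "awalk w q v"
    and mF: "u \<in> W" "w \<in> W" "set p \<subseteq> F" "set q \<subseteq> F"
    using assms(1) unfolding monomials_in_def by blast
  obtain u' p' w' q' v' where n: "n = pth u' p' \<otimes> gpth w' q'" "awalk u' p' v'" "awalk w' q' v'"
    and nF: "u' \<in> W" "w' \<in> W" "set p' \<subseteq> F" "set q' \<subseteq> F"
    using assms(2) unfolding monomials_in_def by blast
  have eq: "m \<otimes> n = pth u p \<otimes> (gpth w q \<otimes> pth u' p') \<otimes> gpth w' q'"
    using m n by (simp add: m_assoc awalk_closed)
  from m(3) n(2) show ?thesis
  proof (cases rule: gpth_pth_cases)
    case 1
    then show ?thesis using eq m n by (simp add: awalk_closed l_null r_null)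
  next
    case (2 r)
    then have "m \<otimes> n = pth u (p @ r) \<otimes> gpth w' q'" "awalk u (p @ r) v'" "set (p @ r) \<subseteq> F"
      using eq m n mF nF awalk_appendI[OF m(2) 2(3)] by (simp_all add: pth_append)
    then show ?thesis using n mF nF unfolding monomials_in_def by blast
  next
    case (3 r)
    then have "m \<otimes> n = pth u p \<otimes> gpth w' (q' @ r)" "awalk w' (q' @ r) v" "set (q' @ r) \<subseteq> F"
      using eq m n mF nF awalk_appendI[OF n(3) 3(3)] by (simp_all add: gpth_append awalk_closed m_assoc)
    then show ?thesis using m mF nF unfolding monomials_in_def by blast
  qed
qed

lemmas monomials_mult = monomials_in_mult[of _ UNIV UNIV, unfolded monomials_in_UNIV]

lemma pth_monomial: "awalk u p v \<Longrightarrow> pth u p \<in> monomials"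
  unfolding monomials_def using pth_vx[of u p v]
  by (intro CollectI exI[of _ u] exI[of _ p] exI[of _ v] exI[of _ "[]"] exI[of _ v])
    (auto simp: awalk_simps awalk_closed)

lemma gpth_monomial: "awalk u p v \<Longrightarrow> gpth u p \<in> monomials"
  unfolding monomials_def using vx_gpth[of u p v]
  by (intro CollectI exI[of _ v] exI[of _ "[]"] exI[of _ u] exI[of _ p] exI[of _ v])
    (auto simp: awalk_simps awalk_closed)

text \<open>Products of monomials are monomials or zero, so their span is closed under
  multiplication and contains everything that the generators generate.\<close>

lemma carrier_eq_lspan: "x \<in> carrier A \<Longrightarrow> x \<in> span monomials"
proof (induction rule: generated)
  case (vx v)
  then have "awalk v [] v" by (simp add: awalk_simps)
  from pth_monomial[OF this] show ?case using lspan_incl[OF _ monomials_closed] by auto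
next
  case (ed e)
  then have "awalk (tail E e) [e] (head E e)" by (simp add: awalk_simps)
  from pth_monomial[OF this] show ?case using lspan_incl[OF _ monomials_closed] ed by auto
next
  case (gh e)
  then have "awalk (tail E e) [e] (head E e)" by (simp add: awalk_simps)
  from gpth_monomial[OF this] show ?case using lspan_incl[OF _ monomials_closed] gh by auto
next
  case zero
  show ?case by (rule lspan_zero)
next
  case (mult x y)
  show ?case
    by (rule lspan_mult[OF mult(3,4) monomials_closed monomials_closed monomials_closed])
      (metis monomials_mult lspan_incl[OF _ monomials_closed] lspan_zero)
qed (intro lspan_plus lspan_minus lspan_smult monomials_closed; assumption)+

text \<open>A sum of sufficiently many vertices acts as a right unit on any given element; if all
  products of \<open>x\<close> with vertices vanished, so would \<open>x\<close>.\<close>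

lemma local_unit:
  assumes "x \<in> carrier A" "x \<noteq> \<zero>"
  shows "\<exists>v\<in>verts E. x \<otimes> vx v \<noteq> \<zero>"
proof (rule ccontr)
  assume "\<not> ?thesis"
  then have z: "x \<otimes> vx v = \<zero>" if "v \<in> verts E" for v using that by blast
  \<comment> \<open>Quantifying over all larger \<open>F'\<close> lets the sets found for the
    individual summands be united.\<close>
  have "\<exists>F. finite F \<and> F \<subseteq> verts E \<and>
      (\<forall>F'. finite F' \<longrightarrow> F \<subseteq> F' \<longrightarrow> F' \<subseteq> verts E \<longrightarrow> y \<otimes> finsum A vx F' = y)"
    if "y \<in> span monomials" for y
    using that
  proof induction
    case lspan_zero
    show ?case by (intro exI[of _ "{}"]) (auto intro!: l_null finsum_closed simp: subset_iff)
  next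
    case (lspan_add k m y)
    then obtain F where F: "finite F" "F \<subseteq> verts E"
      "\<And>F'. \<lbrakk>finite F'; F \<subseteq> F'; F' \<subseteq> verts E\<rbrakk> \<Longrightarrow> y \<otimes> finsum A vx F' = y" by blast
    obtain u p w q v where m: "m = pth u p \<otimes> gpth w q" "awalk u p v" "awalk w q v"
      using lspan_add by (auto simp: monomials_def)
    have mw: "m \<otimes> vx w = m" using m by (simp add: m_assoc awalk_closed gpth_vx)
    have mc: "m \<in> carrier A" using m by (simp add: awalk_closed)
    have yc: "y \<in> carrier A" using lspan_add lspan_closed monomials_closed by blast
    have "(k \<odot> m \<oplus> y) \<otimes> finsum A vx F' = k \<odot> m \<oplus> y"
      if F': "finite F'" "insert w F \<subseteq> F'" "F' \<subseteq> verts E" for F'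
    proof -
      have "m \<otimes> vx v = (if w = v then m else \<zero>)" if "v \<in> F'" for v
      proof (cases "w = v")
        case False
        have v: "v \<in> verts E" using that F' by auto
        have "m \<otimes> vx v = m \<otimes> (vx w \<otimes> vx v)"
          using m_assoc[of m "vx w" "vx v"] mw mc v m by (simp add: awalk_closed)
        then show ?thesis using vx_orth[of w v] v False mc m by (simp add: awalk_closed r_null)
      qed (use mw in simp)
      then have "m \<otimes> finsum A vx F' = (\<Oplus>\<^bsub>A\<^esub>v\<in>F'. if w = v then m else \<zero>)"
        using F' mc by (subst finsum_mult_left) (auto intro!: finsum_cong')
      also have "\<dots> = m" using F' mc finsum_singleton[of w F' "\<lambda>_. m"] by auto
      finally have m1: "m \<otimes> finsum A vx F' = m" .
      have "finsum A vx F' \<in> carrier A" using F' by (auto intro!: finsum_closed)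
      then show ?thesis using F(3)[of F'] F' m1 mc yc lspan_add
        by (simp add: l_distr smult_mult_l)
    qed
    moreover have "w \<in> verts E" using m by (simp add: awalk_closed)
    ultimately show ?case using F by (intro exI[of _ "insert w F"]) auto
  qed
  from this[OF carrier_eq_lspan[OF assms(1)]] obtain F where F: "finite F" "F \<subseteq> verts E"
    "x \<otimes> finsum A vx F = x" by blast
  have "x \<otimes> finsum A vx F = (\<Oplus>\<^bsub>A\<^esub>v\<in>F. x \<otimes> vx v)"
    using F assms by (intro finsum_mult_left) auto
  also have "\<dots> = (\<Oplus>\<^bsub>A\<^esub>v\<in>F. \<zero>)"
    using F z by (intro finsum_cong') auto
  finally have "x \<otimes> finsum A vx F = \<zero>" by simp
  then show False using assms F by simp
qed

end

section \<open>Reduction to a vertex\<close>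

context leavitt_algebra
begin

section \<open>Leading terms of combinations of paths without ghost edges\<close>

definition paths_to :: "'v \<Rightarrow> 'b set" where
  "paths_to v = {pth u p | u p. awalk u p v}"

definition cycles_at :: "'v \<Rightarrow> 'b set" where
  "cycles_at v = {pth v p | p. awalk v p v \<and> p \<noteq> []}"

lemma paths_to_closed: "paths_to v \<subseteq> carrier A"
  by (auto simp: paths_to_def awalk_closed)

lemma cycles_at_closed: "cycles_at v \<subseteq> carrier A"
  by (auto simp: cycles_at_def awalk_closed)

text \<open>Minimality of \<open>F\<close> makes the coefficient of the shortest path nonzero. All
  paths end at \<open>v\<close>, so what remains of another one after cancelling \<open>p\<close> is
  a closed path at \<open>v\<close>, nonempty because its term differs from the one singled
  out.\<close>

lemma leading_term:
  assumes "x \<in> span (paths_to v)" "x \<noteq> \<zero>"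
  obtains u p k z where "awalk u p v" "k \<in> carrier K" "k \<noteq> \<zero>\<^bsub>K\<^esub>" "z \<in> span (cycles_at v)"
    "gpth u p \<otimes> x = k \<odot> vx v \<oplus> z"
proof -
  define Q where "Q F \<longleftrightarrow> finite F \<and> F \<subseteq> paths_to v \<and> x \<in> span F" for F
  have "\<exists>F. Q F" using lspan_finite[OF assms(1)] by (auto simp: Q_def)
  then obtain F where F: "Q F" and min: "\<And>F'. Q F' \<Longrightarrow> card F \<le> card F'"
    using ex_has_least_nat[of Q _ card] by blast
  have Fc: "F \<subseteq> carrier A" using F paths_to_closed by (auto simp: Q_def)
  have "F \<noteq> {}"
  proof
    assume "F = {}"
    then have "x \<in> span {}" using F by (simp add: Q_def)
    then have "x = \<zero>" by (induction rule: lspan.induct) auto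
    then show False using assms by simp
  qed
  \<comment> \<open>One walk is fixed for each element, since different walks might represent the
    same element.\<close>
  have "\<forall>m\<in>F. \<exists>up. m = pth (fst up) (snd up) \<and> awalk (fst up) (snd up) v"
    using F by (fastforce simp: Q_def paths_to_def)
  then obtain g where g: "\<And>m. m \<in> F \<Longrightarrow> m = pth (fst (g m)) (snd (g m)) \<and> awalk (fst (g m)) (snd (g m)) v"
    by metis
  obtain m1 where m1: "m1 \<in> F" "\<And>m. m \<in> F \<Longrightarrow> length (snd (g m1)) \<le> length (snd (g m))"
    using ex_has_least_nat[of "\<lambda>m. m \<in> F" _ "\<lambda>m. length (snd (g m))"] \<open>F \<noteq> {}\<close> by blast
  define u p where "u = fst (g m1)" and "p = snd (g m1)"
  have up: "m1 = pth u p" "awalk u p v" using g[OF m1(1)] by (auto simp: u_def p_def)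
  have "x \<in> span (insert m1 (F - {m1}))" using F m1 by (simp add: Q_def insert_absorb)
  then obtain k y where ky: "k \<in> carrier K" "y \<in> span (F - {m1})" "x = k \<odot> m1 \<oplus> y"
    by (rule lspan_insertE) (use Fc m1 in auto)
  have yc: "y \<in> carrier A" using lspan_closed[OF ky(2)] Fc by auto
  have k0: "k \<noteq> \<zero>\<^bsub>K\<^esub>"
  proof
    assume "k = \<zero>\<^bsub>K\<^esub>"
    then have "x = y" using ky yc m1 Fc by auto
    then have "card F \<le> card (F - {m1})" using F ky by (intro min) (auto simp: Q_def)
    moreover have "card (F - {m1}) < card F" using F m1 by (intro card_Diff1_less) (auto simp: Q_def)
    ultimately show False by simp
  qed
  have "gpth u p \<otimes> m \<in> span (cycles_at v)" if m: "m \<in> F - {m1}" for m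
  proof -
    define w q where "w = fst (g m)" and "q = snd (g m)"
    have wq: "m = pth w q" "awalk w q v" using g[of m] m by (auto simp: w_def q_def)
    have len: "length p \<le> length q" using m1(2)[of m] m by (auto simp: p_def q_def)
    from up(2) wq(2) show ?thesis
    proof (cases rule: gpth_pth_cases)
      case 1
      then show ?thesis using wq by (simp add: lspan_zero)
    next
      case (2 r)
      then have "r \<noteq> []" using m up wq by auto
      then have "pth v r \<in> cycles_at v" using 2 by (auto simp: cycles_at_def)
      then show ?thesis using 2 wq lspan_incl[OF _ cycles_at_closed] by simp
    next
      case (3 r)
      \<comment> \<open>Since \<open>p\<close> is shortest, the remainder is empty and
        \<open>m\<close> would be the excluded term.\<close>
      then have "w = u" "q = p" using len by auto
      then show ?thesis using m up wq by auto
    qed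
  qed
  then have z: "gpth u p \<otimes> y \<in> span (cycles_at v)"
    by (intro lspan_mult_left[OF ky(2) _ cycles_at_closed]) (use Fc up awalk_closed in auto)
  have "gpth u p \<otimes> x = k \<odot> vx v \<oplus> gpth u p \<otimes> y"
    using ky up yc by (simp add: r_distr smult_mult_r awalk_closed gpth_pth)
  then show ?thesis using that up ky k0 z by blast
qed

section \<open>Lowering the number of ghost edges\<close>

definition bounded_monomials :: "nat \<Rightarrow> 'v \<Rightarrow> 'b set" where
  "bounded_monomials n v =
     {pth u p \<otimes> gpth v q | u p q w. awalk u p w \<and> awalk v q w \<and> length q \<le> n}"

lemma bounded_monomials_closed: "bounded_monomials n v \<subseteq> carrier A"
  by (auto simp: bounded_monomials_def awalk_closed)

lemma bounded_monomials_0: "bounded_monomials 0 v \<subseteq> paths_to v"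
  by (auto simp: bounded_monomials_def paths_to_def awalk_simps pth_vx) blast

lemma bounded_monomials_mono: "n \<le> n' \<Longrightarrow> bounded_monomials n v \<subseteq> bounded_monomials n' v"
  unfolding bounded_monomials_def using order_trans by blast

lemma ex_bounded_monomials:
  assumes "x \<in> carrier A" "v \<in> verts E"
  shows "\<exists>n. x \<otimes> vx v \<in> span (bounded_monomials n v)"
  using carrier_eq_lspan[OF assms(1)]
proof induction
  case lspan_zero
  then show ?case using assms by (simp add: l_null lspan.lspan_zero)
next
  case (lspan_add k m x)
  then obtain n where n: "x \<otimes> vx v \<in> span (bounded_monomials n v)" by blast
  have xc: "x \<in> carrier A" using lspan_closed[OF lspan_add.hyps(3) monomials_closed] .
  obtain u p w q y where m: "m = pth u p \<otimes> gpth w q" "awalk u p y" "awalk w q y"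
    using lspan_add by (auto simp: monomials_def)
  have "m \<otimes> vx v \<in> span (bounded_monomials (max n (length q)) v)"
  proof (cases "w = v")
    case True
    then have "m \<otimes> vx v = m" using m by (simp add: m_assoc awalk_closed gpth_vx)
    moreover have "m \<in> bounded_monomials (max n (length q)) v"
      using m True unfolding bounded_monomials_def
      by (intro CollectI exI[of _ u] exI[of _ p] exI[of _ q] exI[of _ y]) auto
    ultimately show ?thesis using lspan_incl[OF _ bounded_monomials_closed] by simp
  next
    case False
    then have "m \<otimes> vx v = \<zero>"
      using m assms by (simp add: m_assoc awalk_closed gpth_vx_orth r_null)
    then show ?thesis by (simp add: lspan.lspan_zero)
  qed
  moreover have "x \<otimes> vx v \<in> span (bounded_monomials (max n (length q)) v)"
    using lspan_mono[OF n bounded_monomials_mono] by simp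
  ultimately have "k \<odot> (m \<otimes> vx v) \<oplus> x \<otimes> vx v \<in> span (bounded_monomials (max n (length q)) v)"
    using lspan_add bounded_monomials_closed by (intro lspan_plus lspan_smult) auto
  moreover have "(k \<odot> m \<oplus> x) \<otimes> vx v = k \<odot> (m \<otimes> vx v) \<oplus> x \<otimes> vx v"
    using lspan_add m xc assms by (simp add: l_distr smult_mult_l awalk_closed)
  ultimately show ?case by auto
qed

text \<open>An edge kills a monomial, cancels the first edge of its ghost walk, or, if that walk is
  empty, lengthens the real part; in the last case there is no ghost edge at all, so any bound
  \<open>n\<close> holds.\<close>

lemma bounded_monomials_ed:
  assumes "x \<in> span (bounded_monomials (Suc n) v)" "e \<in> arcs E" "tail E e = v"
  shows "x \<otimes> ed e \<in> span (bounded_monomials n (head E e))"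
proof (rule lspan_mult_right[OF assms(1) bounded_monomials_closed bounded_monomials_closed])
  show "ed e \<in> carrier A" using assms by simp
  fix m assume "m \<in> bounded_monomials (Suc n) v"
  then obtain u p q w where m: "m = pth u p \<otimes> gpth v q" "awalk u p w" "awalk v q w" "length q \<le> Suc n"
    by (auto simp: bounded_monomials_def)
  have e: "awalk v [e] (head E e)" using assms by (auto simp: awalk_simps)
  have ede: "pth v [e] = ed e" using assms by simp
  have eq: "m \<otimes> ed e = pth u p \<otimes> (gpth v q \<otimes> pth v [e])"
    using m assms by (simp add: m_assoc awalk_closed)
  show "m \<otimes> ed e \<in> span (bounded_monomials n (head E e))"
  using m(3) e proof (cases rule: gpth_pth_cases)
    case 1
    then show ?thesis using eq m by (simp add: lspan_zero r_null awalk_closed)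
  next
    case (2 r)
    then have pr: "awalk u (p @ r) (head E e)" "m \<otimes> ed e = pth u (p @ r)"
      using eq m awalk_appendI[OF m(2)] by (simp_all add: pth_append)
    have "m \<otimes> ed e \<in> bounded_monomials n (head E e)"
      unfolding bounded_monomials_def
      by (intro CollectI exI[of _ u] exI[of _ "p @ r"] exI[of _ "[]"] exI[of _ "head E e"])
        (use pr pth_vx[OF pr(1)] in \<open>auto simp: awalk_simps awalk_closed\<close>)
    then show ?thesis using lspan_incl[OF _ bounded_monomials_closed] by simp
  next
    case (3 r)
    then have "m \<otimes> ed e \<in> bounded_monomials n (head E e)"
      unfolding bounded_monomials_def
      by (intro CollectI exI[of _ u] exI[of _ p] exI[of _ r] exI[of _ w]) (use eq m in auto)
    then show ?thesis using lspan_incl[OF _ bounded_monomials_closed] by simp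
  qed
qed

section \<open>Finite partial sums of the vertex relation\<close>

definition edge_sum :: "'e set \<Rightarrow> 'b" where
  "edge_sum F = (\<Oplus>\<^bsub>A\<^esub>e\<in>F. ed e \<otimes> gh e)"

lemma edge_sum_closed: "F \<subseteq> arcs E \<Longrightarrow> edge_sum F \<in> carrier A"
  by (auto simp: edge_sum_def intro!: finsum_closed)

lemma gh_edge_sum:
  assumes "finite F" "F \<subseteq> arcs E" "f \<in> F"
  shows "gh f \<otimes> edge_sum F = gh f"
proof -
  have f: "f \<in> arcs E" using assms by auto
  have "gh f \<otimes> edge_sum F = (\<Oplus>\<^bsub>A\<^esub>e\<in>F. gh f \<otimes> (ed e \<otimes> gh e))"
    unfolding edge_sum_def using assms f by (subst finsum_mult_left) auto
  also have "\<dots> = (\<Oplus>\<^bsub>A\<^esub>e\<in>F. if f = e then gh f else \<zero>)"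
    using assms f
    by (intro finsum_cong') (auto simp: m_assoc[symmetric] gh_ed gh_ed_orth l_null subset_iff)
  also have "\<dots> = gh f" using assms f finsum_singleton[of f F "\<lambda>_. gh f"] by auto
  finally show ?thesis .
qed

lemma edge_sum_ed:
  assumes "finite F" "F \<subseteq> arcs E" "f \<in> arcs E - F"
  shows "edge_sum F \<otimes> ed f = \<zero>"
proof -
  have "edge_sum F \<otimes> ed f = (\<Oplus>\<^bsub>A\<^esub>e\<in>F. (ed e \<otimes> gh e) \<otimes> ed f)"
    unfolding edge_sum_def using assms by (subst finsum_mult_right) auto
  also have "\<dots> = (\<Oplus>\<^bsub>A\<^esub>e\<in>F. \<zero>)"
  proof (rule finsum_cong')
    fix e assume "e \<in> F"
    then show "(ed e \<otimes> gh e) \<otimes> ed f = \<zero>"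
      using assms gh_ed_orth[of e f] by (cases "e = f") (auto simp: m_assoc r_null subset_iff)
  qed auto
  finally show ?thesis by simp
qed

text \<open>Right multiplication by \<open>v - \<Sum>\<^sub>F e e\<^sup>*\<close> kills every monomial \<open>\<alpha> \<beta>\<^sup>*\<close> whose \<open>\<beta>\<close> starts in \<open>F\<close>.\<close>

lemma ex_real_part:
  assumes "x \<in> span (bounded_monomials n v)" "v \<in> verts E"
  shows "\<exists>F p. finite F \<and> F \<subseteq> out_arcs E v \<and> p \<in> span (paths_to v) \<and>
    (\<forall>F'. finite F' \<longrightarrow> F \<subseteq> F' \<longrightarrow> F' \<subseteq> out_arcs E v \<longrightarrow>
       x \<otimes> (vx v \<ominus> edge_sum F') = p \<otimes> (vx v \<ominus> edge_sum F'))"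
  using assms(1)
proof induction
  case lspan_zero
  show ?case by (intro exI[of _ "{}"] exI[of _ \<zero>]) (auto intro: lspan.lspan_zero)
next
  case (lspan_add k m x)
  then obtain F p where F: "finite F" "F \<subseteq> out_arcs E v" "p \<in> span (paths_to v)"
    "\<And>F'. \<lbrakk>finite F'; F \<subseteq> F'; F' \<subseteq> out_arcs E v\<rbrakk> \<Longrightarrow>
       x \<otimes> (vx v \<ominus> edge_sum F') = p \<otimes> (vx v \<ominus> edge_sum F')" by blast
  obtain u a b w where m: "m = pth u a \<otimes> gpth v b" "awalk u a w" "awalk v b w"
    using lspan_add by (auto simp: bounded_monomials_def)
  have mc: "m \<in> carrier A" using m by (simp add: awalk_closed)
  have xc: "x \<in> carrier A" using lspan_closed[OF lspan_add.hyps(3) bounded_monomials_closed] .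
  have pc: "p \<in> carrier A" using lspan_closed[OF F(3) paths_to_closed] .
  have Fc: "edge_sum F' \<in> carrier A" if "F' \<subseteq> out_arcs E v" for F'
    using that by (intro edge_sum_closed) auto
  show ?case
  proof (cases b)
    case Nil
    then have "m \<in> paths_to v" using m by (auto simp: paths_to_def awalk_simps pth_vx)
    then have p': "k \<odot> m \<oplus> p \<in> span (paths_to v)" using F lspan_add by (intro lspan.lspan_add)
    have "(k \<odot> m \<oplus> x) \<otimes> (vx v \<ominus> edge_sum F') = (k \<odot> m \<oplus> p) \<otimes> (vx v \<ominus> edge_sum F')"
      if "finite F'" "F \<subseteq> F'" "F' \<subseteq> out_arcs E v" for F'
      using F(4)[OF that] Fc[OF that(3)] mc xc pc lspan_add assms by (simp add: l_distr)
    then show ?thesis using F p' by blast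
  next
    case (Cons f b')
    have f: "f \<in> out_arcs E v" "awalk (head E f) b' w" using m Cons by (auto simp: awalk_simps)
    have "(k \<odot> m \<oplus> x) \<otimes> (vx v \<ominus> edge_sum F') = p \<otimes> (vx v \<ominus> edge_sum F')"
      if F': "finite F'" "insert f F \<subseteq> F'" "F' \<subseteq> out_arcs E v" for F'
    proof -
      have q: "vx v \<ominus> edge_sum F' \<in> carrier A" using Fc F' assms by simp
      have "gh f \<otimes> (vx v \<ominus> edge_sum F') = gh f \<ominus> gh f"
        using f F' Fc[OF F'(3)] assms by (subst r_diff) (auto intro!: arg_cong2[where f = "\<lambda>a b. a \<ominus> b"] gh_edge_sum)
      also have "\<dots> = \<zero>" using f by (simp add: diff_self)
      finally have "m \<otimes> (vx v \<ominus> edge_sum F') = \<zero>"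
        using m f q by (simp add: Cons m_assoc awalk_closed r_null)
      then show ?thesis using F(4)[of F'] F' mc xc lspan_add q pc
        by (simp add: l_distr smult_mult_l)
    qed
    then show ?thesis using F f by (intro exI[of _ "insert f F"] exI[of _ p]) auto
  qed
qed

end

section \<open>Strongly connected graphs with at least two edges at every vertex\<close>

locale branching_leavitt_algebra = leavitt_algebra +
  assumes branching: "v \<in> verts E \<Longrightarrow> \<exists>e\<in>out_arcs E v. \<exists>f\<in>out_arcs E v. e \<noteq> f"
    and connected: "\<lbrakk>u \<in> verts E; v \<in> verts E\<rbrakk> \<Longrightarrow> \<exists>p. awalk u p v"
    and vx_nonzero: "v \<in> verts E \<Longrightarrow> vx v \<noteq> \<zero>"
    and verts_nonempty: "verts E \<noteq> {}"
begin

text \<open>The product is the adjoint of D times the path bD, which vanishes unless one walk is a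
  prefix of the other; bD is too long to be a prefix of D.\<close>

lemma compression_closed_walk:
  assumes "awalk v D w" "awalk v b v" "b \<noteq> []" "\<not> prefix D (b @ D)"
  shows "gpth v D \<otimes> pth v b \<otimes> pth v D = \<zero>"
proof -
  have "\<not> prefix (b @ D) D" using assms(3) prefix_length_le by fastforce
  then have "gpth v D \<otimes> pth v (b @ D) = \<zero>"
    using gpth_pth_orth[OF assms(1) awalk_appendI[OF assms(2,1)] assms(4)] by simp
  then show ?thesis using assms by (simp add: pth_append m_assoc awalk_closed)
qed

text \<open>If D is a prefix of bD, then bD = Dc with c nonempty, and branching supplies an edge
  different from the first edge of c. Appending it to D makes the two walks part at that
  place.\<close>

lemma ex_not_prefix:
  assumes "awalk v D w" "awalk v b v" "b \<noteq> []"
  obtains d w' where "awalk w d w'" "\<not> prefix (D @ d) (b @ D @ d)"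
proof (cases "prefix D (b @ D)")
  case True
  then obtain c where c: "b @ D = D @ c" by (auto simp: prefix_def)
  have cne: "c \<noteq> []" using c assms(3) by (metis append_self_conv2 append.right_neutral)
  have w: "w \<in> verts E" using assms by (simp add: awalk_closed)
  obtain f where f: "f \<in> out_arcs E w" "f \<noteq> hd c" using branching[OF w] by metis
  have "\<not> prefix (D @ [f]) (b @ D @ [f])"
  proof
    assume "prefix (D @ [f]) (b @ D @ [f])"
    moreover have "b @ D @ [f] = D @ c @ [f]" using c by (metis append.assoc)
    ultimately show False using cne f by (cases c) auto
  qed
  moreover have "awalk w [f] (head E f)" using f by (auto simp: awalk_simps)
  ultimately show ?thesis using that by blast
next
  case False
  then show ?thesis using that[of "[]" w] assms by (auto simp: awalk_simps awalk_closed)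
qed

text \<open>Induction over the closed paths in \<open>z\<close>, prolonging the compressing walk for
  each. What is already annihilated stays so, because compression by the longer walk is compression
  by the shorter one followed by another. The prescribed beginning \<open>d0\<close> allows a first
  edge to be forced.\<close>

lemma compression:
  assumes "z \<in> span (cycles_at v)" "awalk v d0 w0"
  shows "\<exists>d w. awalk w0 d w \<and> gpth v (d0 @ d) \<otimes> z \<otimes> pth v (d0 @ d) = \<zero>"
  using assms(1)
proof induction
  case lspan_zero
  show ?case using assms(2)
    by (intro exI[of _ "[]"] exI[of _ w0]) (auto simp: awalk_simps awalk_closed r_null l_null)
next
  case (lspan_add k m z)
  then obtain d w where d: "awalk w0 d w" "gpth v (d0 @ d) \<otimes> z \<otimes> pth v (d0 @ d) = \<zero>" by blast
  obtain b where b: "m = pth v b" "awalk v b v" "b \<noteq> []" using lspan_add by (auto simp: cycles_at_def)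
  have zc: "z \<in> carrier A" using lspan_closed[OF lspan_add.hyps(3) cycles_at_closed] .
  have D: "awalk v (d0 @ d) w" using assms d awalk_appendI by blast
  obtain d' w' where d': "awalk w d' w'" "\<not> prefix ((d0 @ d) @ d') (b @ (d0 @ d) @ d')"
    using ex_not_prefix[OF D b(2,3)] by blast
  define D' where "D' = d0 @ d @ d'"
  have D': "awalk v D' w'" using awalk_appendI[OF D d'(1)] by (simp add: D'_def)
  have 1: "gpth v D' \<otimes> m \<otimes> pth v D' = \<zero>"
    using compression_closed_walk[OF D' b(2,3)] d' b by (simp add: D'_def)
  have "gpth v D' \<otimes> z \<otimes> pth v D' = gpth w d' \<otimes> (gpth v (d0 @ d) \<otimes> z \<otimes> pth v (d0 @ d)) \<otimes> pth w d'"
    using gpth_append[OF D d'(1)] pth_append[OF D d'(1)] D d' zc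
    by (simp add: D'_def m_assoc awalk_closed)
  then have 2: "gpth v D' \<otimes> z \<otimes> pth v D' = \<zero>"
    using d d' by (simp add: r_null l_null awalk_closed)
  have mc: "m \<in> carrier A" using b by (simp add: awalk_closed)
  have "gpth v D' \<otimes> (k \<odot> m \<oplus> z) \<otimes> pth v D' = k \<odot> (gpth v D' \<otimes> m \<otimes> pth v D') \<oplus> gpth v D' \<otimes> z \<otimes> pth v D'"
    using D' mc zc lspan_add by (simp add: awalk_closed l_distr r_distr smult_mult_l smult_mult_r)
  then have "gpth v D' \<otimes> (k \<odot> m \<oplus> z) \<otimes> pth v D' = \<zero>" using 1 2 lspan_add by simp
  moreover have "awalk w0 (d @ d') w'" using d d' awalk_appendI by blast
  ultimately show ?case by (auto simp: D'_def)
qed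

text \<open>With \<open>d0\<close> empty this reduces \<open>x\<close> itself; with
  \<open>d0\<close> a single edge it shows that this edge does not annihilate \<open>x\<close>, as
  vertices are nonzero.\<close>

lemma reduction_real:
  assumes x: "x \<in> span (paths_to v)" "x \<noteq> \<zero>" and d0: "awalk v d0 w0"
  shows "\<exists>a\<in>carrier A. \<exists>b\<in>carrier A. \<exists>w\<in>verts E. a \<otimes> ((x \<otimes> pth v d0) \<otimes> b) = vx w"
proof -
  interpret KF: field K by (rule field)
  obtain u p k z where p: "awalk u p v" and k: "k \<in> carrier K" "k \<noteq> \<zero>\<^bsub>K\<^esub>"
    and z: "z \<in> span (cycles_at v)" and eq: "gpth u p \<otimes> x = k \<odot> vx v \<oplus> z"
    using leading_term[OF x] by blast
  obtain d w where d: "awalk w0 d w" "gpth v (d0 @ d) \<otimes> z \<otimes> pth v (d0 @ d) = \<zero>"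
    using compression[OF z d0] by blast
  define D where "D = d0 @ d"
  have D: "awalk v D w" using awalk_appendI[OF d0 d(1)] by (simp add: D_def)
  have xc: "x \<in> carrier A" using lspan_closed[OF x(1) paths_to_closed] .
  have zc: "z \<in> carrier A" using lspan_closed[OF z cycles_at_closed] .
  have kinv: "inv\<^bsub>K\<^esub> k \<in> carrier K" "inv\<^bsub>K\<^esub> k \<otimes>\<^bsub>K\<^esub> k = \<one>\<^bsub>K\<^esub>"
    using k KF.field_Units by auto
  \<comment> \<open>The adjoint of \<open>p\<close> produces kv + z, that of \<open>D\<close>
    removes \<open>z\<close>, and the scalar normalises kw to w.\<close>
  define a where "a = inv\<^bsub>K\<^esub> k \<odot> (gpth v D \<otimes> gpth u p)"
  have ac: "a \<in> carrier A" using kinv D p by (simp add: a_def awalk_closed)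
  have "a \<otimes> ((x \<otimes> pth v d0) \<otimes> pth w0 d) = inv\<^bsub>K\<^esub> k \<odot> (gpth v D \<otimes> (gpth u p \<otimes> x) \<otimes> pth v D)"
    using kinv D p d d0 xc pth_append[OF d0 d(1)]
    by (simp add: a_def D_def[symmetric] smult_mult_l m_assoc awalk_closed)
  also have "gpth v D \<otimes> (gpth u p \<otimes> x) \<otimes> pth v D = k \<odot> (gpth v D \<otimes> pth v D) \<oplus> gpth v D \<otimes> z \<otimes> pth v D"
    using eq k D zc by (simp add: l_distr r_distr smult_mult_l smult_mult_r awalk_closed gpth_vx m_assoc vx_pth)
  also have "\<dots> = k \<odot> vx w" using d D k by (simp add: D_def[symmetric] gpth_pth awalk_closed)
  also have "inv\<^bsub>K\<^esub> k \<odot> (k \<odot> vx w) = vx w"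
    using k kinv D by (simp add: smult_assoc1[symmetric] awalk_closed)
  finally show ?thesis using ac d D by (intro bexI[of _ a] bexI[of _ "pth w0 d"] bexI[of _ w]) (auto simp: awalk_closed)
qed

text \<open>The ghost length drops as long as some edge does not annihilate \<open>x\<close>. If all
  edges do, then x = x(v - \<open>edge_sum F\<close>) = p(v - \<open>edge_sum F\<close>) with
  \<open>p\<close> free of ghost edges, and both possibilities for \<open>F\<close> are
  contradictory: if \<open>F\<close> contains all edges at v, the vertex relation gives x = 0; an
  edge f outside \<open>F\<close> gives pf = xf = 0, against the reduction of \<open>p\<close> begun
  with f.\<close>

lemma reduction_bounded:
  assumes "x \<in> span (bounded_monomials n v)" "x \<noteq> \<zero>" "v \<in> verts E" "x \<otimes> vx v = x"
  shows "\<exists>a\<in>carrier A. \<exists>b\<in>carrier A. \<exists>w\<in>verts E. a \<otimes> (x \<otimes> b) = vx w"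
  using assms
proof (induction n arbitrary: x v)
  case 0
  then have "x \<in> span (paths_to v)" using lspan_mono[OF 0(1) bounded_monomials_0] by simp
  moreover have "awalk v [] v" using 0 by (simp add: awalk_simps)
  ultimately show ?case using reduction_real[of x v "[]" v] 0 by simp
next
  case (Suc n)
  have xc: "x \<in> carrier A" using lspan_closed[OF Suc.prems(1) bounded_monomials_closed] .
  show ?case
  proof (cases "\<exists>e\<in>out_arcs E v. x \<otimes> ed e \<noteq> \<zero>")
    case True
    then obtain e where e: "e \<in> arcs E" "tail E e = v" "x \<otimes> ed e \<noteq> \<zero>" by auto
    have "(x \<otimes> ed e) \<otimes> vx (head E e) = x \<otimes> ed e" using e xc by (simp add: m_assoc)
    then obtain a b w where ab: "a \<in> carrier A" "b \<in> carrier A" "w \<in> verts E" "a \<otimes> ((x \<otimes> ed e) \<otimes> b) = vx w"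
      using Suc.IH[OF bounded_monomials_ed[OF Suc.prems(1) e(1,2)] e(3)] e by auto
    then show ?thesis using xc e
      by (intro bexI[of _ a] bexI[of _ "ed e \<otimes> b"] bexI[of _ w]) (auto simp: m_assoc)
  next
    case False
    then have z: "x \<otimes> ed e = \<zero>" if "e \<in> out_arcs E v" for e using that by blast
    obtain F p where F: "finite F" "F \<subseteq> out_arcs E v" "p \<in> span (paths_to v)"
      "x \<otimes> (vx v \<ominus> edge_sum F) = p \<otimes> (vx v \<ominus> edge_sum F)"
      using ex_real_part[OF Suc.prems(1,3)] by blast
    have Fa: "F \<subseteq> arcs E" using F by auto
    note Fc = edge_sum_closed[OF Fa]
    have pc: "p \<in> carrier A" using lspan_closed[OF F(3) paths_to_closed] .
    have "x \<otimes> edge_sum F = (\<Oplus>\<^bsub>A\<^esub>e\<in>F. x \<otimes> (ed e \<otimes> gh e))"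
      unfolding edge_sum_def using F Fa xc by (subst finsum_mult_left) auto
    also have "\<dots> = (\<Oplus>\<^bsub>A\<^esub>e\<in>F. \<zero>)"
    proof (rule finsum_cong')
      fix e assume e: "e \<in> F"
      then have "x \<otimes> (ed e \<otimes> gh e) = (x \<otimes> ed e) \<otimes> gh e" using xc Fa by (auto simp: m_assoc)
      then show "x \<otimes> (ed e \<otimes> gh e) = \<zero>" using z[of e] e F Fa by (auto simp: l_null)
    qed auto
    finally have "x \<otimes> edge_sum F = \<zero>" by simp
    then have xq: "x \<otimes> (vx v \<ominus> edge_sum F) = x"
      using r_diff[of "vx v" "edge_sum F" x] xc Fc Suc.prems by (simp add: minus_eq)
    show ?thesis
    proof (cases "F = out_arcs E v")
      case True
      then have "vx v = edge_sum F"
        unfolding edge_sum_def using vx_sum[OF Suc.prems(3)] F branching[OF Suc.prems(3)] by auto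
      then have "x = \<zero>" using xq Fc xc by (simp add: diff_self r_null)
      then show ?thesis using Suc.prems by simp
    next
      case False
      then obtain f where f: "f \<in> out_arcs E v" "f \<notin> F" using F(2) by blast
      have "(vx v \<ominus> edge_sum F) \<otimes> ed f = ed f"
        using edge_sum_ed[OF F(1) Fa, of f] f Fc Suc.prems
          l_diff[of "vx v" "edge_sum F" "ed f"] by (auto simp: minus_eq)
      then have "p \<otimes> ed f = (p \<otimes> (vx v \<ominus> edge_sum F)) \<otimes> ed f"
        using pc Fc f Suc.prems by (simp add: m_assoc)
      also have "\<dots> = \<zero>" using F(4) xq z[OF f(1)] by simp
      finally have pf: "p \<otimes> ed f = \<zero>" .
      have p0: "p \<noteq> \<zero>" using F(4) xq Suc.prems Fc by (auto simp: l_null)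
      have fw: "awalk v [f] (head E f)" using f by (auto simp: awalk_simps)
      obtain a b w where "a \<in> carrier A" "b \<in> carrier A" "w \<in> verts E"
        "a \<otimes> ((p \<otimes> pth v [f]) \<otimes> b) = vx w"
        using reduction_real[OF F(3) p0 fw] by blast
      then have "vx w = \<zero>" using pf f by (simp add: l_null r_null)
      then show ?thesis using vx_nonzero \<open>w \<in> verts E\<close> by simp
    qed
  qed
qed

theorem reduction:
  assumes "x \<in> carrier A" "x \<noteq> \<zero>"
  obtains a b w where "a \<in> carrier A" "b \<in> carrier A" "w \<in> verts E" "a \<otimes> (x \<otimes> b) = vx w"
proof -
  obtain v where v: "v \<in> verts E" "x \<otimes> vx v \<noteq> \<zero>" using local_unit[OF assms] by blast
  obtain n where "x \<otimes> vx v \<in> span (bounded_monomials n v)" using ex_bounded_monomials[OF assms(1) v(1)] by blast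
  then obtain a b w where "a \<in> carrier A" "b \<in> carrier A" "w \<in> verts E" "a \<otimes> ((x \<otimes> vx v) \<otimes> b) = vx w"
    using reduction_bounded[of "x \<otimes> vx v" n v] v assms by (auto simp: m_assoc)
  then show ?thesis using that[of a "vx v \<otimes> b" w] v assms by (simp add: m_assoc)
qed

text \<open>A walk from w to v gives v as the product of its adjoint, w and the walk itself, so all
  vertices lie in the ideal; each monomial is fixed by its initial vertex.\<close>

lemma two_sided_ideal_vertex:
  assumes I: "two_sided_ideal A I" and w: "w \<in> verts E" "vx w \<in> I"
  shows "I = carrier A"
proof -
  interpret I: additive_subgroup I A using I by (simp add: two_sided_ideal_def)
  have r: "x \<otimes> a \<in> I" and l: "a \<otimes> x \<in> I" if "x \<in> I" "a \<in> carrier A" for x a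
    using I that by (auto simp: two_sided_ideal_def)
  have vI: "vx v \<in> I" if v: "v \<in> verts E" for v
  proof -
    obtain p where p: "awalk w p v" using connected w v by blast
    have "gpth w p \<otimes> (vx w \<otimes> pth w p) = vx v" using p by (simp add: vx_pth gpth_pth)
    then show ?thesis using l[OF r[OF w(2)], of "pth w p" "gpth w p"] p by (simp add: awalk_closed)
  qed
  have "x \<in> I" if "x \<in> span monomials" for x
    using that
  proof induction
    case lspan_zero
    show ?case by simp
  next
    case (lspan_add k m x)
    obtain u p w q y where m: "m = pth u p \<otimes> gpth w q" "awalk u p y" "awalk w q y"
      using lspan_add by (auto simp: monomials_def)
    have "vx u \<otimes> (k \<odot> m) = k \<odot> m"
      using m lspan_add by (simp add: smult_mult_r awalk_closed m_assoc[symmetric] vx_pth)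
    moreover have "k \<odot> m \<in> carrier A" using m lspan_add by (simp add: awalk_closed)
    ultimately have "k \<odot> m \<in> I" using r[OF vI, of u "k \<odot> m"] m by (simp add: awalk_closed)
    then show ?case using lspan_add by simp
  qed
  then have "x \<in> I" if "x \<in> carrier A" for x using carrier_eq_lspan[OF that] by blast
  then show ?thesis using I.a_subset by auto
qed

lemma simple: "simple_ring A"
  unfolding simple_ring_def
proof (intro conjI allI impI)
  obtain v where "v \<in> verts E" using verts_nonempty by blast
  then show "\<exists>x\<in>carrier A. \<exists>y\<in>carrier A. x \<otimes> y \<noteq> \<zero>"
    using vx_nonzero by (intro bexI[of _ "vx v"]) auto
  fix I assume I: "two_sided_ideal A I"
  show "I = {\<zero>} \<or> I = carrier A"
  proof (rule disjCI)
    assume ne: "I \<noteq> carrier A"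
    interpret I: additive_subgroup I A using I by (simp add: two_sided_ideal_def)
    have "x = \<zero>" if x: "x \<in> I" for x
    proof (rule ccontr)
      assume "x \<noteq> \<zero>"
      then obtain a b w where "a \<in> carrier A" "b \<in> carrier A" "w \<in> verts E" "a \<otimes> (x \<otimes> b) = vx w"
        using reduction[of x] I.a_Hcarr[OF x] by blast
      moreover from this have "a \<otimes> (x \<otimes> b) \<in> I" using I x unfolding two_sided_ideal_def by blast
      ultimately show False using two_sided_ideal_vertex[OF I, of w] ne by simp
    qed
    then show "I = {\<zero>}" using I.zero_closed by auto
  qed
qed

text \<open>If ac = w, the map sending y to cya is multiplicative on the corner at \<open>w\<close>
  and sends w to e = ca. It carries a closed walk P and its adjoint Q, where QP = w \<noteq> PQ, to
  the required \<open>s\<close> and \<open>t\<close>. As \<open>c\<close> begins with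
  \<open>x\<close>, the idempotent lies in \<open>I\<close>.\<close>

lemma purely_infinite: "purely_infinite A"
  unfolding purely_infinite_def
proof (intro allI impI, elim conjE)
  fix I assume I: "right_ideal A I" and ne: "I \<noteq> {\<zero>}"
  interpret I: additive_subgroup I A using I by (simp add: right_ideal_def)
  obtain x where x: "x \<in> I" "x \<noteq> \<zero>" using ne I.zero_closed by blast
  then have xc: "x \<in> carrier A" by auto
  obtain a0 b0 w where ab0: "a0 \<in> carrier A" "b0 \<in> carrier A" and w: "w \<in> verts E"
    and eq0: "a0 \<otimes> (x \<otimes> b0) = vx w"
    using reduction[OF xc x(2)] by blast
  \<comment> \<open>Cutting with \<open>vx w\<close> makes \<open>a\<close> absorb w on the left and
    \<open>c\<close> absorb it on the right, while ac = w is kept.\<close>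
  define a where "a = vx w \<otimes> a0"
  define c where "c = (x \<otimes> b0) \<otimes> vx w"
  have ac: "a \<in> carrier A" and cc: "c \<in> carrier A" using ab0 xc w by (auto simp: a_def c_def)
  have acw: "a \<otimes> c = vx w"
  proof -
    have "a \<otimes> c = vx w \<otimes> (a0 \<otimes> (x \<otimes> b0)) \<otimes> vx w"
      using ab0 xc w by (simp add: a_def c_def m_assoc)
    then show ?thesis using eq0 w by simp
  qed
  have wa: "vx w \<otimes> a = a" using ab0 w by (simp add: a_def m_assoc[symmetric])
  have cw: "c \<otimes> vx w = c" using ab0 xc w by (simp add: c_def m_assoc)
  obtain f g where fg: "f \<in> out_arcs E w" "g \<in> out_arcs E w" "f \<noteq> g"
    using branching[OF w] by blast
  obtain q where q: "awalk (head E f) q w" using connected[of "head E f" w] fg w by auto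
  define P where "P = pth w (f # q)"
  define Q where "Q = gpth w (f # q)"
  have fq: "awalk w (f # q) w" using fg q by (auto simp: awalk_simps)
  have PQc: "P \<in> carrier A" "Q \<in> carrier A" using fq by (simp_all add: P_def Q_def awalk_closed del: pth.simps gpth.simps)
  have QP: "Q \<otimes> P = vx w" using gpth_pth[OF fq] by (simp add: P_def Q_def del: pth.simps gpth.simps)
  have wP: "vx w \<otimes> P = P" "P \<otimes> vx w = P" using vx_pth[OF fq] pth_vx[OF fq] by (simp_all add: P_def del: pth.simps)
  have wQ: "vx w \<otimes> Q = Q" "Q \<otimes> vx w = Q" using vx_gpth[OF fq] gpth_vx[OF fq] by (simp_all add: Q_def del: gpth.simps)
  \<comment> \<open>The walk leaves \<open>w\<close> by \<open>f\<close>, so its adjoint kills the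
    other edge \<open>g\<close>; PQ = w would force g = 0, and with it the vertex at the end of
    g.\<close>
  have PQ: "P \<otimes> Q \<noteq> vx w"
  proof
    assume "P \<otimes> Q = vx w"
    moreover have "Q \<otimes> ed g = \<zero>"
      using fg q gh_ed_orth[of f g] by (auto simp: Q_def m_assoc awalk_closed r_null)
    ultimately have "vx w \<otimes> ed g = \<zero>"
      using m_assoc[of P Q "ed g"] PQc fg by (auto simp: r_null)
    then have "ed g = \<zero>" using fg tail_ed[of g] by auto
    then have "vx (head E g) = \<zero>" using gh_ed[of g] fg by (auto simp: r_null)
    then show False using vx_nonzero[of "head E g"] fg by auto
  qed
  define e where "e = c \<otimes> a"
  define s where "s = c \<otimes> (P \<otimes> a)"
  define t where "t = c \<otimes> (Q \<otimes> a)"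
  have absorb: "(c \<otimes> (y \<otimes> a)) \<otimes> (c \<otimes> (z \<otimes> a)) = c \<otimes> ((y \<otimes> z) \<otimes> a)"
    if "y \<in> carrier A" "z \<in> carrier A" "vx w \<otimes> z = z" for y z
  proof -
    have "(c \<otimes> (y \<otimes> a)) \<otimes> (c \<otimes> (z \<otimes> a)) = c \<otimes> (y \<otimes> ((a \<otimes> c) \<otimes> z) \<otimes> a)"
      using that ac cc by (simp add: m_assoc)
    then show ?thesis using that acw by simp
  qed
  have e: "e = c \<otimes> (vx w \<otimes> a)" by (simp add: e_def wa)
  have "infinite_idempotent A e"
  proof (rule infinite_idempotentI[of e s t])
    show "e \<in> carrier A" "s \<in> carrier A" "t \<in> carrier A"
      using ac cc PQc by (simp_all add: e_def s_def t_def)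
    show "e \<otimes> e = e" "e \<otimes> s = s" "s \<otimes> e = s" "e \<otimes> t = t" "t \<otimes> e = t" "t \<otimes> s = e"
      unfolding e s_def t_def using PQc w wP wQ QP by (simp_all add: absorb)
    show "s \<otimes> t \<noteq> e"
    proof
      assume "s \<otimes> t = e"
      then have "c \<otimes> ((P \<otimes> Q) \<otimes> a) = e"
        using absorb[of P Q] PQc wQ by (simp add: s_def t_def)
      \<comment> \<open>The passage from y to cya is injective on the corner at \<open>w\<close>:
        multiplying by \<open>a\<close> on the left and \<open>c\<close> on the right recovers
        y.\<close>
      then have "a \<otimes> (c \<otimes> ((P \<otimes> Q) \<otimes> a)) \<otimes> c = a \<otimes> (c \<otimes> a) \<otimes> c" by (simp add: e_def)
      moreover have "a \<otimes> (c \<otimes> ((P \<otimes> Q) \<otimes> a)) \<otimes> c = (a \<otimes> c) \<otimes> (P \<otimes> Q) \<otimes> (a \<otimes> c)"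
        using ac cc PQc by (simp add: m_assoc)
      moreover have "a \<otimes> (c \<otimes> a) \<otimes> c = (a \<otimes> c) \<otimes> (a \<otimes> c)"
        using ac cc by (simp add: m_assoc)
      moreover have "vx w \<otimes> (P \<otimes> Q) \<otimes> vx w = P \<otimes> Q"
      proof -
        have "vx w \<otimes> (P \<otimes> Q) \<otimes> vx w = (vx w \<otimes> P) \<otimes> (Q \<otimes> vx w)"
          using PQc w by (simp add: m_assoc)
        then show ?thesis using wP wQ by simp
      qed
      ultimately show False using PQ acw w by simp
    qed
  qed
  moreover have "e \<in> I"
  proof -
    have "e = x \<otimes> (b0 \<otimes> (vx w \<otimes> a))" using ab0 xc w ac by (simp add: e_def c_def m_assoc)
    then show ?thesis using I x ab0 w ac unfolding right_ideal_def by auto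
  qed
  ultimately show "\<exists>e\<in>I. infinite_idempotent A e" by blast
qed

lemma purely_infinite_simple: "purely_infinite_simple A"
  by (simp add: purely_infinite_simple_def purely_infinite simple)

end

section \<open>Acyclic graphs and graphs of out-degree one\<close>

context leavitt_algebra
begin

section \<open>Acyclic graphs\<close>

lemma monomials_in_closed: "monomials_in W F \<subseteq> carrier A"
  by (auto simp: monomials_in_def awalk_closed)

lemma monomials_in_mono: "\<lbrakk>W \<subseteq> W'; F \<subseteq> F'\<rbrakk> \<Longrightarrow> monomials_in W F \<subseteq> monomials_in W' F'"
  unfolding monomials_in_def by blast

lemma ex_finite_monomials_in:
  assumes "x \<in> carrier A"
  shows "\<exists>W F. finite W \<and> finite F \<and> x \<in> span (monomials_in W F)"
  using carrier_eq_lspan[OF assms]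
proof induction
  case lspan_zero
  show ?case by (intro exI[of _ "{}"]) (auto intro: lspan.lspan_zero)
next
  case (lspan_add k m x)
  then obtain W F where WF: "finite W" "finite F" "x \<in> span (monomials_in W F)" by blast
  obtain u p w q v where m: "m = pth u p \<otimes> gpth w q" "awalk u p v" "awalk w q v"
    using lspan_add by (auto simp: monomials_def)
  define W' F' where "W' = W \<union> {u, w}" and "F' = F \<union> set p \<union> set q"
  have "m \<in> monomials_in W' F'"
    unfolding monomials_in_def W'_def F'_def using m
    by (intro CollectI exI[of _ u] exI[of _ p] exI[of _ w] exI[of _ q] exI[of _ v]) auto
  moreover have "x \<in> span (monomials_in W' F')"
    by (rule lspan_mono[OF WF(3) monomials_in_mono]) (auto simp: W'_def F'_def)
  ultimately have "k \<odot> m \<oplus> x \<in> span (monomials_in W' F')"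
    using lspan_add.hyps by (intro lspan.lspan_add)
  moreover have "finite W'" "finite F'" using WF by (auto simp: W'_def F'_def)
  ultimately show ?case by blast
qed

text \<open>The part of the walk from one occurrence of an edge up to the next would be a closed
  walk at its tail.\<close>

lemma acyclic_awalk_distinct:
  assumes acyc: "\<And>v p. awalk v p v \<Longrightarrow> p = []" and p: "awalk u p w"
  shows "distinct p"
proof (rule ccontr)
  assume "\<not> distinct p"
  then obtain xs ys zs y where d: "p = xs @ [y] @ ys @ [y] @ zs"
    using not_distinct_decomp by blast
  then obtain a where "awalk a (y # ys @ y # zs) w"
    using p by (auto simp: awalk_append_iff)
  then have "awalk (tail E y) (y # ys @ y # zs) w" by (simp add: awalk_simps)
  then have "awalk (tail E y) ((y # ys) @ (y # zs)) w" by simp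
  then obtain b where "awalk (tail E y) (y # ys) b" "awalk b (y # zs) w"
    unfolding awalk_append_iff by blast
  then have "awalk (tail E y) (y # ys) (tail E y)" by (auto simp: awalk_simps)
  then show False using acyc by blast
qed

text \<open>Walks without repeated edges over \<open>F\<close> have length at most
  \<open>card F\<close>, so only finitely many lists occur, even in an infinite graph.\<close>

lemma finite_monomials_in:
  assumes acyc: "\<And>v p. awalk v p v \<Longrightarrow> p = []" and "finite W" "finite F"
  shows "finite (monomials_in W F)"
proof -
  define L where "L = {p. set p \<subseteq> F \<and> length p \<le> card F}"
  have L: "p \<in> L" if "awalk u p v" "set p \<subseteq> F" for u p v
    using acyclic_awalk_distinct[OF acyc that(1)] that assms(3)
    by (auto simp: L_def distinct_card[symmetric] intro: card_mono)
  have "monomials_in W F \<subseteq> (\<lambda>((u, p), (w, q)). pth u p \<otimes> gpth w q) ` ((W \<times> L) \<times> (W \<times> L))"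
  proof
    fix m assume "m \<in> monomials_in W F"
    then obtain u p w q v where "m = pth u p \<otimes> gpth w q" "awalk u p v" "awalk w q v"
      "u \<in> W" "w \<in> W" "set p \<subseteq> F" "set q \<subseteq> F"
      unfolding monomials_in_def by blast
    then show "m \<in> (\<lambda>((u, p), (w, q)). pth u p \<otimes> gpth w q) ` ((W \<times> L) \<times> (W \<times> L))"
      using L by (intro image_eqI[of _ _ "((u, p), (w, q))"]) auto
  qed
  moreover have "finite L" unfolding L_def using assms(3) by (rule finite_lists_length_le)
  then have "finite ((\<lambda>((u, p), (w, q)). pth u p \<otimes> gpth w q) ` ((W \<times> L) \<times> (W \<times> L)))"
    using assms(2) by (intro finite_imageI finite_cartesian_product)
  ultimately show ?thesis by (rule finite_subset)
qed

lemma acyclic_no_infinite_idempotent: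
  assumes acyc: "\<And>v p. awalk v p v \<Longrightarrow> p = []"
  shows "\<not> infinite_idempotent A e"
proof
  assume "infinite_idempotent A e"
  then obtain s t where st: "s \<in> carrier A" "t \<in> carrier A" "e \<otimes> e = e"
    "e \<otimes> s = s" "t \<otimes> e = t" "t \<otimes> s = e" "s \<otimes> t \<noteq> e"
    by (rule infinite_idempotentE)
  obtain W F where 1: "finite W" "finite F" "s \<in> span (monomials_in W F)"
    using ex_finite_monomials_in[OF st(1)] by blast
  obtain W' F' where 2: "finite W'" "finite F'" "t \<in> span (monomials_in W' F')"
    using ex_finite_monomials_in[OF st(2)] by blast
  define M where "M = monomials_in (W \<union> W') (F \<union> F')"
  have "s \<in> span M" "t \<in> span M"
    unfolding M_def
    by (rule lspan_mono[OF 1(3) monomials_in_mono]; simp) (rule lspan_mono[OF 2(3) monomials_in_mono]; simp)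
  moreover have "finite M" unfolding M_def using 1 2 by (intro finite_monomials_in acyc) auto
  moreover have "m \<otimes> n \<in> span M" if "m \<in> M" "n \<in> M" for m n
    using monomials_in_mult[of m "W \<union> W'" "F \<union> F'" n] that lspan_incl[OF _ monomials_in_closed]
    by (auto simp: M_def lspan_zero)
  ultimately have "s \<otimes> t = e"
    using st no_infinite_idempotent_finite_span[OF field, of M s t e] monomials_in_closed
    by (auto simp: M_def)
  then show False using st by simp
qed

end

section \<open>Strongly connected graphs with exactly one edge at every vertex\<close>

locale cycle_leavitt_algebra = leavitt_algebra +
  assumes unique_out_arc: "v \<in> verts E \<Longrightarrow> \<exists>e. out_arcs E v = {e}"
    and connected: "\<lbrakk>u \<in> verts E; v \<in> verts E\<rbrakk> \<Longrightarrow> \<exists>p. awalk u p v"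
begin

text \<open>With a single edge at a vertex, the vertex relation says that this edge times its
  adjoint is the vertex; every walk thus becomes invertible.\<close>

lemma pth_gpth: "awalk u p v \<Longrightarrow> pth u p \<otimes> gpth u p = vx u"
proof (induction p arbitrary: u)
  case (Cons e p)
  then have e: "e \<in> arcs E" "tail E e = u" "awalk (head E e) p v" "u \<in> verts E" by (auto simp: awalk_simps)
  have "e \<in> out_arcs E u" using e by simp
  then have o: "out_arcs E u = {e}" using unique_out_arc[OF e(4)] by fastforce
  have "pth u (e # p) \<otimes> gpth u (e # p) = ed e \<otimes> (pth (head E e) p \<otimes> gpth (head E e) p) \<otimes> gh e"
    using e by (simp add: m_assoc awalk_closed)
  also have "\<dots> = ed e \<otimes> gh e" using Cons.IH[OF e(3)] e by simp
  also have "\<dots> = vx u" using vx_sum[OF e(4)] o e by simp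
  finally show ?case .
qed (auto simp: awalk_simps)

lemma awalk_unique: "\<lbrakk>awalk u p v; awalk u q w; length p = length q\<rbrakk> \<Longrightarrow> p = q"
proof (induction p arbitrary: u q)
  case (Cons e p)
  then obtain f q' where q: "q = f # q'" by (cases q) auto
  have "e \<in> out_arcs E u" "f \<in> out_arcs E u" "u \<in> verts E" using Cons.prems q by (auto simp: awalk_simps)
  then have "e = f" using unique_out_arc[of u] by (metis singletonD)
  then show ?case using Cons.IH[of "head E e" q'] Cons.prems q by (auto simp: awalk_simps)
qed auto

text \<open>From v there is at most one walk of each length, so gd and dg are the same list of
  edges.\<close>

lemma closed_walks_commute:
  assumes g: "awalk v g v" and d: "awalk v d v"
  shows "pth v g \<otimes> pth v d = pth v d \<otimes> pth v g"
    and "gpth v g \<otimes> gpth v d = gpth v d \<otimes> gpth v g"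
    and "pth v g \<otimes> gpth v d = gpth v d \<otimes> pth v g"
proof -
  have eq: "g @ d = d @ g"
    using awalk_unique[OF awalk_appendI[OF g d] awalk_appendI[OF d g]] by simp
  show p: "pth v g \<otimes> pth v d = pth v d \<otimes> pth v g"
    using pth_append[OF g d] pth_append[OF d g] eq by simp
  show "gpth v g \<otimes> gpth v d = gpth v d \<otimes> gpth v g"
    using gpth_append[OF g d] gpth_append[OF d g] eq by simp
  \<comment> \<open>The vertex is inserted on the right as \<open>d\<close> times its adjoint, so
    that \<open>g\<close> and \<open>d\<close> can be interchanged.\<close>
  have "gpth v d \<otimes> pth v g = gpth v d \<otimes> (pth v g \<otimes> pth v d) \<otimes> gpth v d"
    using g d by (simp add: m_assoc awalk_closed pth_gpth pth_vx)
  also have "\<dots> = (gpth v d \<otimes> pth v d) \<otimes> pth v g \<otimes> gpth v d"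
    unfolding p using g d by (simp add: m_assoc awalk_closed)
  finally show "pth v g \<otimes> gpth v d = gpth v d \<otimes> pth v g"
    using g d by (simp add: gpth_pth vx_pth)
qed

definition corner_monomials where
  "corner_monomials v = {pth v g \<otimes> gpth v d | g d. awalk v g v \<and> awalk v d v}"

lemma corner_monomials_closed: "corner_monomials v \<subseteq> carrier A"
  by (auto simp: corner_monomials_def awalk_closed)

lemma corner_monomials_commute:
  assumes "m \<in> corner_monomials v" "n \<in> corner_monomials v"
  shows "m \<otimes> n = n \<otimes> m"
proof -
  obtain g d where m: "m = pth v g \<otimes> gpth v d" "awalk v g v" "awalk v d v"
    using assms by (auto simp: corner_monomials_def)
  obtain g' d' where n: "n = pth v g' \<otimes> gpth v d'" "awalk v g' v" "awalk v d' v"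
    using assms by (auto simp: corner_monomials_def)
  have "pth v g \<otimes> n = n \<otimes> pth v g" "gpth v d \<otimes> n = n \<otimes> gpth v d"
    unfolding n by (rule commute_mult; use m n closed_walks_commute awalk_closed in simp)+
  then have "n \<otimes> m = m \<otimes> n"
    unfolding m(1) by (intro commute_mult) (use m n awalk_closed in auto)
  then show ?thesis by simp
qed

lemma corner_eq_lspan:
  assumes x: "x \<in> carrier A" and v: "v \<in> verts E"
  shows "vx v \<otimes> (x \<otimes> vx v) \<in> span (corner_monomials v)"
proof -
  let ?M = "(\<lambda>m. m \<otimes> vx v) ` monomials"
  have M: "?M \<subseteq> carrier A" using monomials_closed v by auto
  have "x \<otimes> vx v \<in> span ?M"
    by (rule lspan_mult_right[OF carrier_eq_lspan[OF x] monomials_closed M])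
      (use v lspan_incl[OF _ M] in auto)
  then show ?thesis
  proof (rule lspan_mult_left[OF _ M corner_monomials_closed])
    fix n assume "n \<in> ?M"
    then obtain u p w q y where n: "n = (pth u p \<otimes> gpth w q) \<otimes> vx v" "awalk u p y" "awalk w q y"
      by (auto simp: monomials_def)
    consider "u \<noteq> v" | "w \<noteq> v" | "u = v" "w = v" by blast
    then show "vx v \<otimes> n \<in> span (corner_monomials v)"
    proof cases
      case 1
      have "vx v \<otimes> n = (vx v \<otimes> pth u p) \<otimes> (gpth w q \<otimes> vx v)"
        using n v by (simp add: m_assoc awalk_closed)
      then show ?thesis using 1 n v by (simp add: vx_pth_orth awalk_closed l_null lspan_zero)
    next
      case 2
      then show ?thesis using n v
        by (simp add: m_assoc awalk_closed gpth_vx_orth r_null lspan_zero)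
    next
      case 3
      \<comment> \<open>The common end \<open>y\<close> of the two walks need not be
        \<open>v\<close>. Inserting \<open>k\<close> times its adjoint, for a walk \<open>k\<close>
        from \<open>y\<close> to \<open>v\<close>, makes both of them closed walks at
        \<open>v\<close>.\<close>
      obtain k where k: "awalk y k v" using connected[of y v] n v by (auto simp: awalk_closed)
      have "vx v \<otimes> n = pth u p \<otimes> gpth w q"
        using n 3 v by (simp add: m_assoc awalk_closed gpth_vx) (simp add: m_assoc[symmetric] awalk_closed vx_pth)
      also have "\<dots> = pth u p \<otimes> (pth y k \<otimes> gpth y k) \<otimes> gpth w q"
        using n k by (simp add: pth_gpth pth_vx)
      also have "\<dots> = pth v (p @ k) \<otimes> gpth v (q @ k)"
        using n k 3 by (simp add: m_assoc awalk_closed pth_append gpth_append)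
      finally have "vx v \<otimes> n \<in> corner_monomials v"
        unfolding corner_monomials_def using n k 3 awalk_appendI by blast
      then show ?thesis using lspan_incl[OF _ corner_monomials_closed] by simp
    qed
  qed (use v in simp)
qed

text \<open>Only ve = e is given, so \<open>s\<close> and \<open>t\<close> may lie outside the
  commutative corner, but sv and tv lie in it. That they commute gives (st)v = ev, and multiplying
  by e on the right yields st = e.\<close>

lemma no_infinite_idempotent_in_vertex_ideal:
  assumes "infinite_idempotent A e" "v \<in> verts E" "vx v \<otimes> e = e"
  shows False
proof -
  from assms(1) obtain s t where st: "e \<in> carrier A" "s \<in> carrier A" "t \<in> carrier A" "e \<otimes> e = e"
    "e \<otimes> s = s" "s \<otimes> e = s" "e \<otimes> t = t" "t \<otimes> e = t" "t \<otimes> s = e" "s \<otimes> t \<noteq> e"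
    by (rule infinite_idempotentE)
  define w where "w = vx v"
  have w: "w \<in> carrier A" "w \<otimes> e = e" using assms by (auto simp: w_def)
  have ws: "w \<otimes> s = s" using m_assoc[of w e s] w st by simp
  have wt: "w \<otimes> t = t" using m_assoc[of w e t] w st by simp
  have "s \<otimes> w \<in> span (corner_monomials v)" "t \<otimes> w \<in> span (corner_monomials v)"
    using corner_eq_lspan[of s v] corner_eq_lspan[of t v] assms st w ws wt
    by (simp_all add: w_def[symmetric] m_assoc[symmetric])
  then have "(s \<otimes> w) \<otimes> (t \<otimes> w) = (t \<otimes> w) \<otimes> (s \<otimes> w)"
    by (rule lspan_commute[OF _ _ corner_monomials_closed corner_monomials_commute])
  moreover have "(s \<otimes> w) \<otimes> (t \<otimes> w) = (s \<otimes> (w \<otimes> t)) \<otimes> w" using st w by (simp add: m_assoc)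
  moreover have "(t \<otimes> w) \<otimes> (s \<otimes> w) = (t \<otimes> (w \<otimes> s)) \<otimes> w" using st w by (simp add: m_assoc)
  ultimately have "((s \<otimes> t) \<otimes> w) \<otimes> e = (e \<otimes> w) \<otimes> e" using st ws wt by simp
  then have "(s \<otimes> t) \<otimes> (w \<otimes> e) = e \<otimes> (w \<otimes> e)" using st w m_assoc by simp
  then have "s \<otimes> (t \<otimes> e) = e" using st w m_assoc[of s t e] by simp
  then show False using st by simp
qed

lemma not_purely_infinite:
  assumes "v \<in> verts E" "vx v \<noteq> \<zero>"
  shows "\<not> purely_infinite A"
proof
  assume pi: "purely_infinite A"
  define I where "I = {x \<in> carrier A. vx v \<otimes> x = x}"
  have "right_ideal A I"
    using assms unfolding I_def by (intro right_ideal_fixed) simp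
  moreover have "vx v \<in> I" using assms(1) by (simp add: I_def)
  then have "I \<noteq> {\<zero>}" using assms(2) by blast
  ultimately obtain e where e: "e \<in> I" "infinite_idempotent A e"
    using pi unfolding purely_infinite_def by blast
  have "vx v \<otimes> e = e" using e(1) by (simp add: I_def)
  then show False using no_infinite_idempotent_in_vertex_ideal e(2) assms(1) by blast
qed

end

section \<open>The Leavitt path algebra and its action on functions on infinite walks\<close>

abbreviation leavitt_cong where
  "leavitt_cong K E \<equiv> alg_cong K (leavitt_gens E) (leavitt_rels E)"

abbreviation leavitt_class where
  "leavitt_class K E t \<equiv> leavitt_cong K E `` {t}"

abbreviation leavitt_terms where
  "leavitt_terms K E \<equiv> alg_terms K (leavitt_gens E)"

context
  fixes K :: "('k, 'n) ring_scheme" and E :: "('v, 'e) pre_digraph"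
  assumes field: "field K" and wf: "wf_digraph E"
begin

interpretation K: field K by (rule field)
interpretation wf_digraph E by (rule wf)

lemma leavitt_gens_terms:
  "v \<in> verts E \<Longrightarrow> TV v \<in> leavitt_terms K E"
  "e \<in> arcs E \<Longrightarrow> TE e \<in> leavitt_terms K E"
  "e \<in> arcs E \<Longrightarrow> TG e \<in> leavitt_terms K E"
  by (auto intro!: alg_terms.gen simp: leavitt_gens_def)

lemma leavitt_class_eqI:
  assumes "(s, t) \<in> leavitt_cong K E"
  shows "leavitt_class K E s = leavitt_class K E t"
  using equiv_class_eq[OF equiv_alg_cong[OF K.is_cring] assms] .

lemma leavitt_class_eqD:
  assumes "leavitt_class K E s = leavitt_class K E t" "t \<in> leavitt_terms K E"
  shows "(s, t) \<in> leavitt_cong K E"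
  using eq_equiv_class[OF assms(1) equiv_alg_cong[OF K.is_cring] assms(2)] .

lemma nonunital_algebra_leavitt_path_algebra: "nonunital_algebra K (leavitt_path_algebra K E)"
  unfolding leavitt_path_algebra_def by (rule nonunital_algebra_presented_algebra[OF K.is_cring])

interpretation L: nonunital_algebra K "leavitt_path_algebra K E"
  by (rule nonunital_algebra_leavitt_path_algebra)

lemma leavitt_class_ops:
  assumes "s \<in> leavitt_terms K E" "t \<in> leavitt_terms K E"
  shows "leavitt_class K E s \<oplus>\<^bsub>leavitt_path_algebra K E\<^esub> leavitt_class K E t = leavitt_class K E (TAdd s t)"
    and "leavitt_class K E s \<otimes>\<^bsub>leavitt_path_algebra K E\<^esub> leavitt_class K E t = leavitt_class K E (TMult s t)"
    and "a \<in> carrier K \<Longrightarrow>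
      a \<odot>\<^bsub>leavitt_path_algebra K E\<^esub> leavitt_class K E t = leavitt_class K E (TSmult a t)"
  unfolding leavitt_path_algebra_def by (simp_all add: presented_algebra_ops[OF K.is_cring assms])

lemma leavitt_class_closed:
  "t \<in> leavitt_terms K E \<Longrightarrow> leavitt_class K E t \<in> carrier (leavitt_path_algebra K E)"
  unfolding leavitt_path_algebra_def by (rule presented_algebra_carrierI[OF K.is_cring])

lemma leavitt_class_zero: "\<zero>\<^bsub>leavitt_path_algebra K E\<^esub> = leavitt_class K E TZero"
  unfolding leavitt_path_algebra_def by (rule presented_algebra_zero[OF K.is_cring])

lemma leavitt_class_neg:
  assumes "t \<in> leavitt_terms K E"
  shows "\<ominus>\<^bsub>leavitt_path_algebra K E\<^esub> leavitt_class K E t = leavitt_class K E (TNeg t)"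
proof (rule L.minus_equality)
  show "leavitt_class K E (TNeg t) \<oplus>\<^bsub>leavitt_path_algebra K E\<^esub> leavitt_class K E t =
      \<zero>\<^bsub>leavitt_path_algebra K E\<^esub>"
    using assms leavitt_class_eqI[OF alg_cong.add_neg[OF assms]]
    by (simp add: leavitt_class_ops leavitt_class_zero alg_terms.neg)
qed (use assms in \<open>auto intro: leavitt_class_closed alg_terms.neg\<close>)

lemma leavitt_carrierE:
  assumes "x \<in> carrier (leavitt_path_algebra K E)"
  obtains t where "t \<in> leavitt_terms K E" "x = leavitt_class K E t"
  using presented_algebra_carrierE[OF K.is_cring assms[unfolded leavitt_path_algebra_def]] .

text \<open>The fold over a list in the presentation becomes a genuine finite sum, in which the
  enumeration no longer appears.\<close>

lemma leavitt_class_sum: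
  assumes "distinct es" "set es \<subseteq> arcs E"
  shows "foldr (\<lambda>e. TAdd (TMult (TE e) (TG e))) es TZero \<in> leavitt_terms K E \<and>
    leavitt_class K E (foldr (\<lambda>e. TAdd (TMult (TE e) (TG e))) es TZero) =
    (\<Oplus>\<^bsub>leavitt_path_algebra K E\<^esub>e\<in>set es.
       leavitt_class K E (TE e) \<otimes>\<^bsub>leavitt_path_algebra K E\<^esub> leavitt_class K E (TG e))"
  using assms
proof (induction es)
  case Nil
  then show ?case by (simp add: leavitt_class_zero alg_terms.zero)
next
  case (Cons e es)
  let ?s = "foldr (\<lambda>e. TAdd (TMult (TE e) (TG e))) es TZero"
  have s: "?s \<in> leavitt_terms K E" using Cons by simp
  have e: "TMult (TE e) (TG e) \<in> leavitt_terms K E"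
    using Cons.prems by (auto intro!: alg_terms.mult leavitt_gens_terms)
  have "leavitt_class K E (TAdd (TMult (TE e) (TG e)) ?s) =
      leavitt_class K E (TE e) \<otimes>\<^bsub>leavitt_path_algebra K E\<^esub> leavitt_class K E (TG e)
      \<oplus>\<^bsub>leavitt_path_algebra K E\<^esub> leavitt_class K E ?s"
    using Cons.prems s e by (simp add: leavitt_class_ops leavitt_gens_terms)
  moreover have "(\<lambda>e. leavitt_class K E (TE e) \<otimes>\<^bsub>leavitt_path_algebra K E\<^esub> leavitt_class K E (TG e))
      \<in> set (e # es) \<rightarrow> carrier (leavitt_path_algebra K E)"
    using Cons.prems by (auto intro!: L.m_closed leavitt_class_closed leavitt_gens_terms)
  ultimately show ?case using Cons s e by (auto simp: alg_terms.add)
qed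

lemma leavitt_algebra_leavitt_path_algebra:
  "leavitt_algebra K (leavitt_path_algebra K E) E (\<lambda>v. leavitt_class K E (TV v))
     (\<lambda>e. leavitt_class K E (TE e)) (\<lambda>e. leavitt_class K E (TG e))"
proof (intro leavitt_algebra.intro leavitt_algebra_axioms.intro field wf
    nonunital_algebra_leavitt_path_algebra)
  note rel = leavitt_class_eqI[OF alg_cong.rel]
  note [simp] = leavitt_class_ops leavitt_class_closed leavitt_gens_terms alg_terms.intros
    leavitt_class_zero
  show "leavitt_class K E (TV v) \<otimes>\<^bsub>leavitt_path_algebra K E\<^esub> leavitt_class K E (TV v) = leavitt_class K E (TV v)"
    if "v \<in> verts E" for v
    using rel[OF leavitt_rels.vertex_idem[OF that]] that by simp
  show "leavitt_class K E (TV v) \<otimes>\<^bsub>leavitt_path_algebra K E\<^esub> leavitt_class K E (TV w) = \<zero>\<^bsub>leavitt_path_algebra K E\<^esub>"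
    if "v \<in> verts E" "w \<in> verts E" "v \<noteq> w" for v w
    using rel[OF leavitt_rels.vertex_orth[OF that]] that by simp
  show "leavitt_class K E (TV (tail E e)) \<otimes>\<^bsub>leavitt_path_algebra K E\<^esub> leavitt_class K E (TE e) = leavitt_class K E (TE e)"
    if "e \<in> arcs E" for e
    using rel[OF leavitt_rels.tail_edge[OF that]] that by simp
  show "leavitt_class K E (TE e) \<otimes>\<^bsub>leavitt_path_algebra K E\<^esub> leavitt_class K E (TV (head E e)) = leavitt_class K E (TE e)"
    if "e \<in> arcs E" for e
    using rel[OF leavitt_rels.edge_head[OF that]] that by simp
  show "leavitt_class K E (TV (head E e)) \<otimes>\<^bsub>leavitt_path_algebra K E\<^esub> leavitt_class K E (TG e) = leavitt_class K E (TG e)"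
    if "e \<in> arcs E" for e
    using rel[OF leavitt_rels.head_ghost[OF that]] that by simp
  show "leavitt_class K E (TG e) \<otimes>\<^bsub>leavitt_path_algebra K E\<^esub> leavitt_class K E (TV (tail E e)) = leavitt_class K E (TG e)"
    if "e \<in> arcs E" for e
    using rel[OF leavitt_rels.ghost_tail[OF that]] that by simp
  show "leavitt_class K E (TG e) \<otimes>\<^bsub>leavitt_path_algebra K E\<^esub> leavitt_class K E (TE e) = leavitt_class K E (TV (head E e))"
    if "e \<in> arcs E" for e
    using rel[OF leavitt_rels.ghost_edge[OF that]] that by simp
  show "leavitt_class K E (TG e) \<otimes>\<^bsub>leavitt_path_algebra K E\<^esub> leavitt_class K E (TE f) = \<zero>\<^bsub>leavitt_path_algebra K E\<^esub>"
    if "e \<in> arcs E" "f \<in> arcs E" "e \<noteq> f" for e f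
    using rel[OF leavitt_rels.ghost_edge_orth[OF that]] that by simp
  show "leavitt_class K E (TV v) = (\<Oplus>\<^bsub>leavitt_path_algebra K E\<^esub>e\<in>out_arcs E v.
      leavitt_class K E (TE e) \<otimes>\<^bsub>leavitt_path_algebra K E\<^esub> leavitt_class K E (TG e))"
    if v: "v \<in> verts E" "finite (out_arcs E v)" "out_arcs E v \<noteq> {}" for v
  proof -
    obtain es where es: "set es = out_arcs E v" "distinct es"
      using finite_distinct_list[OF v(2)] by blast
    have sub: "set es \<subseteq> arcs E" using es by auto
    show ?thesis
      using rel[OF leavitt_rels.vertex_sum[OF v es(2,1)]] leavitt_class_sum[OF es(2) sub] v
      unfolding es(1) by simp
  qed
  fix x P
  assume "x \<in> carrier (leavitt_path_algebra K E)"
  then obtain t where t: "t \<in> leavitt_terms K E" "x = leavitt_class K E t" by (rule leavitt_carrierE)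
  assume vx: "\<And>v. v \<in> verts E \<Longrightarrow> P (leavitt_class K E (TV v))"
    and ed: "\<And>e. e \<in> arcs E \<Longrightarrow> P (leavitt_class K E (TE e))"
    and gh: "\<And>e. e \<in> arcs E \<Longrightarrow> P (leavitt_class K E (TG e))"
    and zero: "P \<zero>\<^bsub>leavitt_path_algebra K E\<^esub>"
    and add: "\<And>x y. \<lbrakk>x \<in> carrier (leavitt_path_algebra K E); y \<in> carrier (leavitt_path_algebra K E); P x; P y\<rbrakk> \<Longrightarrow>
      P (x \<oplus>\<^bsub>leavitt_path_algebra K E\<^esub> y)"
    and neg: "\<And>x. \<lbrakk>x \<in> carrier (leavitt_path_algebra K E); P x\<rbrakk> \<Longrightarrow> P (\<ominus>\<^bsub>leavitt_path_algebra K E\<^esub> x)"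
    and mult: "\<And>x y. \<lbrakk>x \<in> carrier (leavitt_path_algebra K E); y \<in> carrier (leavitt_path_algebra K E); P x; P y\<rbrakk> \<Longrightarrow>
      P (x \<otimes>\<^bsub>leavitt_path_algebra K E\<^esub> y)"
    and smult: "\<And>k x. \<lbrakk>k \<in> carrier K; x \<in> carrier (leavitt_path_algebra K E); P x\<rbrakk> \<Longrightarrow>
      P (k \<odot>\<^bsub>leavitt_path_algebra K E\<^esub> x)"
  from t(1) have "P (leavitt_class K E t)"
  proof induction
    case (gen g)
    then show ?case using vx ed gh by (auto simp: leavitt_gens_def)
  next
    case zero
    then show ?case using \<open>P \<zero>\<^bsub>leavitt_path_algebra K E\<^esub>\<close> by simp
  next
    case (add s t)
    then show ?case using \<open>\<And>x y. \<lbrakk>x \<in> _; y \<in> _; P x; P y\<rbrakk> \<Longrightarrow> P (x \<oplus>\<^bsub>_\<^esub> y)\<close>[of "leavitt_class K E s" "leavitt_class K E t"]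
      by simp
  next
    case (neg t)
    then show ?case using \<open>\<And>x. \<lbrakk>x \<in> _; P x\<rbrakk> \<Longrightarrow> P (\<ominus>\<^bsub>_\<^esub> x)\<close>[of "leavitt_class K E t"] by (simp add: leavitt_class_neg)
  next
    case (mult s t)
    then show ?case using \<open>\<And>x y. \<lbrakk>x \<in> _; y \<in> _; P x; P y\<rbrakk> \<Longrightarrow> P (x \<otimes>\<^bsub>_\<^esub> y)\<close>[of "leavitt_class K E s" "leavitt_class K E t"]
      by simp
  next
    case (smult a t)
    then show ?case using \<open>\<And>k x. \<lbrakk>k \<in> _; x \<in> _; P x\<rbrakk> \<Longrightarrow> P (k \<odot>\<^bsub>_\<^esub> x)\<close>[of a "leavitt_class K E t"]
      by (simp add: leavitt_class_ops(3)[of t t])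
  qed
  then show "P x" using t by simp
qed (auto intro: leavitt_class_closed leavitt_gens_terms)

end

text \<open>For a hereditary set \<open>H\<close> of vertices, the Leavitt path algebra acts on the functions on the
  infinite walks avoiding \<open>H\<close>. This shows that vertices are nonzero, and the vertices in \<open>H\<close> lie
  in the kernel.\<close>

locale walk_action = K: field K + wf_digraph E
  for K :: "('k, 'n) ring_scheme" (structure) and E :: "('v, 'e) pre_digraph" +
  fixes H :: "'v set"
  assumes hereditary: "\<lbrakk>e \<in> arcs E; tail E e \<in> H\<rbrakk> \<Longrightarrow> head E e \<in> H"
begin

definition infinite_walk :: "(nat \<Rightarrow> 'e) \<Rightarrow> bool" where
  "infinite_walk p \<longleftrightarrow>
     (\<forall>n. p n \<in> arcs E \<and> tail E (p n) \<notin> H \<and> head E (p n) = tail E (p (Suc n)))"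

lemma infinite_walk_shift: "infinite_walk p \<Longrightarrow> infinite_walk (\<lambda>n. p (Suc n))"
  by (simp add: infinite_walk_def)

text \<open>Here heredity enters: an edge ending outside \<open>H\<close> must start outside
  \<open>H\<close>, so prepending it keeps the walk off \<open>H\<close>.\<close>

lemma infinite_walk_case_nat:
  assumes "infinite_walk p" "e \<in> arcs E" "tail E (p 0) = head E e"
  shows "infinite_walk (case_nat e p)"
  unfolding infinite_walk_def
proof
  fix n
  have "tail E (p 0) \<notin> H" using assms(1) unfolding infinite_walk_def by blast
  then have "tail E e \<notin> H" using hereditary[OF assms(2)] assms(3) by metis
  then show "case_nat e p n \<in> arcs E \<and> tail E (case_nat e p n) \<notin> H \<and>
      head E (case_nat e p n) = tail E (case_nat e p (Suc n))"
    using assms unfolding infinite_walk_def by (cases n) simp_all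
qed

text \<open>On indicator functions of walks, \<open>Edge e\<close> prepends \<open>e\<close> and
  \<open>Ghost e\<close> removes it. The formulas look reversed because a function is moved by
  evaluating it at the walk before the move.\<close>

primrec gen_act :: "('v, 'e) leavitt_gen \<Rightarrow> ((nat \<Rightarrow> 'e) \<Rightarrow> 'k) \<Rightarrow> (nat \<Rightarrow> 'e) \<Rightarrow> 'k" where
  "gen_act (Vertex v) f p = (if infinite_walk p \<and> tail E (p 0) = v then f p else \<zero>)"
| "gen_act (Edge e) f p = (if infinite_walk p \<and> p 0 = e then f (\<lambda>n. p (Suc n)) else \<zero>)"
| "gen_act (Ghost e) f p =
     (if infinite_walk p \<and> tail E (p 0) = head E e then f (case_nat e p) else \<zero>)"

text \<open>Defined on terms, with products acting by composition; \<open>act_cong\<close> makes it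
  an action of the classes.\<close>

primrec act :: "('k, ('v, 'e) leavitt_gen) alg_term \<Rightarrow> ((nat \<Rightarrow> 'e) \<Rightarrow> 'k) \<Rightarrow> (nat \<Rightarrow> 'e) \<Rightarrow> 'k" where
  "act (TGen g) f = gen_act g f"
| "act TZero f = (\<lambda>p. \<zero>)"
| "act (TAdd s t) f = (\<lambda>p. act s f p \<oplus> act t f p)"
| "act (TNeg t) f = (\<lambda>p. \<ominus> act t f p)"
| "act (TMult s t) f = act s (act t f)"
| "act (TSmult a t) f = (\<lambda>p. a \<otimes> act t f p)"

lemma act_closed:
  assumes "t \<in> leavitt_terms K E" "\<And>p. f p \<in> carrier K"
  shows "act t f p \<in> carrier K"
  using assms
proof (induction arbitrary: f p)
  case (gen g)
  then show ?case by (cases g) auto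
qed auto

lemma act_add:
  assumes "t \<in> leavitt_terms K E" "\<And>p. f p \<in> carrier K" "\<And>p. g p \<in> carrier K"
  shows "act t (\<lambda>p. f p \<oplus> g p) = (\<lambda>p. act t f p \<oplus> act t g p)"
  using assms
proof (induction arbitrary: f g)
  case (gen x)
  then show ?case by (cases x) auto
next
  case (mult s t)
  then show ?case by (simp add: act_closed)
qed (auto simp: act_closed K.a_ac K.minus_add K.r_distr)

lemma act_smult:
  assumes "t \<in> leavitt_terms K E" "\<And>p. f p \<in> carrier K" "a \<in> carrier K"
  shows "act t (\<lambda>p. a \<otimes> f p) = (\<lambda>p. a \<otimes> act t f p)"
  using assms
proof (induction arbitrary: f)
  case (gen x)
  then show ?case by (cases x) auto
next
  case (mult s t)
  then show ?case by (simp add: act_closed)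
qed (auto simp: act_closed K.r_distr K.r_minus K.m_lcomm)

lemma act_zero:
  assumes "t \<in> leavitt_terms K E"
  shows "act t (\<lambda>p. \<zero>) = (\<lambda>p. \<zero>)"
  using act_smult[OF assms, of "\<lambda>p. \<zero>" \<zero>] act_closed[OF assms, of "\<lambda>p. \<zero>"] by simp

text \<open>An edge times its adjoint cuts a function down to the walks that begin with this edge.
  For distinct edges these sets of walks are disjoint, so at most one summand survives.\<close>

lemma act_vertex_sum:
  assumes "distinct es" "set es \<subseteq> arcs E" "\<And>p. f p \<in> carrier K"
  shows "act (foldr (\<lambda>e. TAdd (TMult (TE e) (TG e))) es TZero) f p =
    (if infinite_walk p \<and> p 0 \<in> set es then f p else \<zero>)"
  using assms(1,2)
proof (induction es)
  case (Cons e es)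
  have "case_nat (p 0) (\<lambda>n. p (Suc n)) = p" by (auto split: nat.split)
  moreover have "tail E (p (Suc 0)) = head E (p 0)" if "infinite_walk p"
    using that unfolding infinite_walk_def by simp
  ultimately show ?case using Cons assms(3) by (auto simp: infinite_walk_shift)
qed simp

lemma act_rel:
  assumes "(s, t) \<in> leavitt_rels E" "\<And>p. f p \<in> carrier K"
  shows "act s f = act t f"
  using assms(1)
proof cases
  case (vertex_sum v es)
  have "set es \<subseteq> arcs E" using vertex_sum by auto
  then show ?thesis
    using vertex_sum act_vertex_sum[OF vertex_sum(6) _ assms(2)]
    by (auto simp: fun_eq_iff infinite_walk_def)
qed (auto simp: fun_eq_iff infinite_walk_shift infinite_walk_case_nat,
    auto simp: infinite_walk_def)

lemma act_cong:
  assumes "(s, t) \<in> leavitt_cong K E" "\<And>p. f p \<in> carrier K"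
  shows "act s f = act t f"
  using assms
proof (induction arbitrary: f)
  case (rel s t)
  then show ?case by (intro act_rel)
next
  case (mult_cong s s' t t')
  \<comment> \<open>The induction hypothesis for \<open>s\<close> is applied to the function
    \<open>act t f\<close>, which therefore must take values in the field.\<close>
  have "\<And>p. act t f p \<in> carrier K"
    using mult_cong alg_cong_in_terms[OF mult_cong.hyps(2) K.is_cring] by (auto intro: act_closed)
  then show ?case using mult_cong by simp
qed (auto simp: act_closed act_add act_smult K.a_ac K.l_neg K.r_neg K.l_distr K.r_distr K.m_assoc)

text \<open>Tested on the constant function one: \<open>v\<close> keeps its value at
  \<open>p\<close>, whereas zero does not.\<close>

lemma vertex_nonzero:
  assumes "infinite_walk p" "tail E (p 0) = v" "v \<in> verts E"
  shows "leavitt_class K E (TV v) \<noteq> \<zero>\<^bsub>leavitt_path_algebra K E\<^esub>"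
proof
  assume "leavitt_class K E (TV v) = \<zero>\<^bsub>leavitt_path_algebra K E\<^esub>"
  then have "(TV v, TZero) \<in> leavitt_cong K E"
    using leavitt_class_eqD[OF K.field_axioms wf_digraph_axioms]
      leavitt_class_zero[OF K.field_axioms wf_digraph_axioms] alg_terms.zero by metis
  then have "act (TV v) (\<lambda>p. \<one>) p = act TZero (\<lambda>p. \<one>) p" by (subst act_cong) auto
  then show False using assms by simp
qed

text \<open>The annihilator of the module of functions; by \<open>act_cong\<close> the choice of the
  representative \<open>t\<close> is immaterial.\<close>

definition kernel :: "('k, ('v, 'e) leavitt_gen) alg_term set set" where
  "kernel = {leavitt_class K E t | t. t \<in> leavitt_terms K E \<and>
     (\<forall>f. (\<forall>p. f p \<in> carrier K) \<longrightarrow> act t f = (\<lambda>p. \<zero>))}"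

lemma two_sided_ideal_kernel: "two_sided_ideal (leavitt_path_algebra K E) kernel"
proof -
  interpret L: nonunital_algebra K "leavitt_path_algebra K E"
    by (rule nonunital_algebra_leavitt_path_algebra[OF K.field_axioms wf_digraph_axioms])
  note kw = K.field_axioms wf_digraph_axioms
  have kI: "leavitt_class K E t \<in> kernel"
    if "t \<in> leavitt_terms K E" "\<And>f. (\<And>p. f p \<in> carrier K) \<Longrightarrow> act t f = (\<lambda>p. \<zero>)" for t
    using that unfolding kernel_def by blast
  have kE: "\<exists>t. x = leavitt_class K E t \<and> t \<in> leavitt_terms K E \<and>
      (\<forall>f. (\<forall>p. f p \<in> carrier K) \<longrightarrow> act t f = (\<lambda>p. \<zero>))" if "x \<in> kernel" for x
    using that unfolding kernel_def by blast
  have "additive_subgroup kernel (leavitt_path_algebra K E)"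
  proof (rule L.additive_subgroupI')
    show "kernel \<subseteq> carrier (leavitt_path_algebra K E)"
      using kE leavitt_class_closed[OF kw] by blast
    show "\<zero>\<^bsub>leavitt_path_algebra K E\<^esub> \<in> kernel"
      unfolding leavitt_class_zero[OF kw] by (rule kI) (auto intro: alg_terms.zero)
  next
    fix x y assume "x \<in> kernel" "y \<in> kernel"
    then obtain s t where
      s: "x = leavitt_class K E s" "s \<in> leavitt_terms K E" "\<And>f. (\<And>p. f p \<in> carrier K) \<Longrightarrow> act s f = (\<lambda>p. \<zero>)" and
      t: "y = leavitt_class K E t" "t \<in> leavitt_terms K E" "\<And>f. (\<And>p. f p \<in> carrier K) \<Longrightarrow> act t f = (\<lambda>p. \<zero>)"
      using kE by meson
    show "x \<oplus>\<^bsub>leavitt_path_algebra K E\<^esub> y \<in> kernel"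
      unfolding s(1) t(1) leavitt_class_ops[OF kw s(2) t(2)]
      by (rule kI) (auto simp: s t intro: alg_terms.add)
  next
    fix x assume "x \<in> kernel"
    then obtain t where
      t: "x = leavitt_class K E t" "t \<in> leavitt_terms K E" "\<And>f. (\<And>p. f p \<in> carrier K) \<Longrightarrow> act t f = (\<lambda>p. \<zero>)"
      using kE by meson
    show "\<ominus>\<^bsub>leavitt_path_algebra K E\<^esub> x \<in> kernel"
      unfolding t(1) leavitt_class_neg[OF kw t(2)]
      by (rule kI) (auto simp: t intro: alg_terms.neg)
  qed
  moreover have "x \<otimes>\<^bsub>leavitt_path_algebra K E\<^esub> a \<in> kernel \<and> a \<otimes>\<^bsub>leavitt_path_algebra K E\<^esub> x \<in> kernel"
    if xa: "x \<in> kernel" "a \<in> carrier (leavitt_path_algebra K E)" for x a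
  proof -
    obtain t where
      t: "x = leavitt_class K E t" "t \<in> leavitt_terms K E" "\<And>f. (\<And>p. f p \<in> carrier K) \<Longrightarrow> act t f = (\<lambda>p. \<zero>)"
      using kE[OF xa(1)] by blast
    obtain s where s: "s \<in> leavitt_terms K E" "a = leavitt_class K E s"
      using leavitt_carrierE[OF kw xa(2)] by blast
    show ?thesis
      unfolding t(1) s(2) leavitt_class_ops[OF kw t(2) s(1)] leavitt_class_ops[OF kw s(1) t(2)]
      by (intro conjI kI) (auto simp: t s act_closed act_zero intro: alg_terms.mult)
  qed
  ultimately show ?thesis by (auto simp: two_sided_ideal_def)
qed

text \<open>The kernel contains \<open>v\<close>, because no walk avoiding \<open>H\<close> starts
  at \<open>v\<close>, but not the initial vertex of \<open>p\<close>.\<close>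

lemma not_simple:
  assumes "infinite_walk p" and v: "v \<in> verts E" "v \<in> H"
    and nz: "leavitt_class K E (TV v) \<noteq> \<zero>\<^bsub>leavitt_path_algebra K E\<^esub>"
  shows "\<not> simple_ring (leavitt_path_algebra K E)"
proof
  note kw = K.field_axioms wf_digraph_axioms
  assume "simple_ring (leavitt_path_algebra K E)"
  then consider "kernel = {\<zero>\<^bsub>leavitt_path_algebra K E\<^esub>}" | "kernel = carrier (leavitt_path_algebra K E)"
    using two_sided_ideal_kernel unfolding simple_ring_def by blast
  then show False
  proof cases
    case 1
    have "act (TV v) f = (\<lambda>p. \<zero>)" for f
      using v by (auto simp: fun_eq_iff infinite_walk_def)
    then have "leavitt_class K E (TV v) \<in> kernel"
      using leavitt_gens_terms(1)[OF kw v(1)] unfolding kernel_def by blast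
    then show False using nz 1 by simp
  next
    case 2
    define w where "w = tail E (p 0)"
    have "p 0 \<in> arcs E" using assms(1) unfolding infinite_walk_def by blast
    then have w: "w \<in> verts E" by (simp add: w_def)
    then have "leavitt_class K E (TV w) \<in> kernel"
      using 2 leavitt_class_closed[OF kw leavitt_gens_terms(1)[OF kw w]] by simp
    \<comment> \<open>The class of \<open>w\<close> may enter \<open>kernel\<close> through a
      representative other than \<open>TV w\<close>, so the two actions have to be compared.\<close>
    then obtain t where t: "leavitt_class K E (TV w) = leavitt_class K E t" "t \<in> leavitt_terms K E"
      "\<And>f. (\<And>p. f p \<in> carrier K) \<Longrightarrow> act t f = (\<lambda>p. \<zero>)"
      unfolding kernel_def by blast
    have "act (TV w) (\<lambda>p. \<one>) = act t (\<lambda>p. \<one>)"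
      using act_cong[OF leavitt_class_eqD[OF kw t(1,2)]] by simp
    then have "act (TV w) (\<lambda>p. \<one>) p = \<zero>" using t(3) by simp
    then show False using assms(1) by (simp add: w_def)
  qed
qed

end

section \<open>Hopf graphs\<close>

text \<open>Reassociating brings a generator to the front of any product. Applied to the identity,
  this shows that the remaining factor is the inverse of a generator.\<close>

lemma subsemigroup_generated_cases:
  assumes "group G" "X \<subseteq> carrier G" "s \<in> subsemigroup_generated G X"
  shows "s \<in> carrier G \<and> (s \<in> X \<or> (\<exists>x\<in>X. \<exists>t\<in>subsemigroup_generated G X. s = x \<otimes>\<^bsub>G\<^esub> t))"
proof -
  interpret group G by fact
  show ?thesis
    using assms(3)
  proof induction
    case (incl x)
    then show ?case using assms(2) by blast
  next
    case (mult x y)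
    from mult.IH(1) show ?case
    proof (elim conjE disjE bexE)
      assume "x \<in> X"
      then show ?thesis using mult by blast
    next
      fix a t assume a: "a \<in> X" "t \<in> subsemigroup_generated G X" "x = a \<otimes>\<^bsub>G\<^esub> t"
      have tc: "t \<in> carrier G"
        using a(2) by induction (use assms(2) in auto)
      have "x \<otimes>\<^bsub>G\<^esub> y = a \<otimes>\<^bsub>G\<^esub> (t \<otimes>\<^bsub>G\<^esub> y)"
        using a assms(2) tc mult.IH(2) by (auto simp: m_assoc)
      then show ?thesis
        using a mult subsemigroup_generated.mult[OF a(2) mult.hyps(2)] by blast
    qed
  qed
qed

locale hopf_digraph = group G + K: field K
  for G :: "('a, 'm) monoid_scheme" (structure) and K :: "('k, 'n) ring_scheme"
  and r :: "'a set \<Rightarrow> nat"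
begin

abbreviation "\<Gamma> \<equiv> hopf_graph G r"
abbreviation "S \<equiv> ramification_semigroup G r"
abbreviation "X \<equiv> \<Union> (ramification_support G r)"
abbreviation "L \<equiv> leavitt_path_algebra K \<Gamma>"

sublocale wf_digraph \<Gamma>
  by (rule wf_digraph_hopf_graph) (rule is_group)

sublocale L: leavitt_algebra K L \<Gamma> "\<lambda>v. leavitt_class K \<Gamma> (TV v)"
  "\<lambda>e. leavitt_class K \<Gamma> (TE e)" "\<lambda>e. leavitt_class K \<Gamma> (TG e)"
  by (rule leavitt_algebra_leavitt_path_algebra[OF K.field_axioms wf_digraph_axioms])

section \<open>Walks in the Hopf graph and the semigroup S\<close>

lemma verts_hopf: "verts \<Gamma> = carrier G"
  by (simp add: hopf_graph_def)

lemma arcs_hopf: "(x, C, c, i) \<in> arcs \<Gamma> \<longleftrightarrow> x \<in> carrier G \<and> C \<in> conjugacy_classes G \<and> c \<in> C \<and> i < r C"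
  by (simp add: hopf_graph_def)

lemma tail_hopf: "tail \<Gamma> (x, C, c, i) = x" and head_hopf: "head \<Gamma> (x, C, c, i) = x \<otimes> c"
  by (simp_all add: hopf_graph_def)

lemma generators_closed: "X \<subseteq> carrier G"
  by (auto simp: ramification_support_def conjugacy_classes_def orbits_def orbit_def)

lemma semigroup_closed: "S \<subseteq> carrier G"
  unfolding ramification_semigroup_def
  using subsemigroup_generated_cases[OF is_group generators_closed] by blast

lemma semigroup_mult: "\<lbrakk>x \<in> S; y \<in> S\<rbrakk> \<Longrightarrow> x \<otimes> y \<in> S"
  unfolding ramification_semigroup_def by (rule subsemigroup_generated.mult)

lemma generators_semigroup: "x \<in> X \<Longrightarrow> x \<in> S"
  unfolding ramification_semigroup_def by (rule subsemigroup_generated.incl)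

lemma generator_arc:
  assumes "c \<in> X"
  obtains C where "\<And>x. x \<in> carrier G \<Longrightarrow> (x, C, c, 0) \<in> arcs \<Gamma>"
  using assms that by (auto simp: arcs_hopf ramification_support_def)

lemma arc_generator: "(x, C, c, i) \<in> arcs \<Gamma> \<Longrightarrow> c \<in> X"
  by (auto simp: arcs_hopf ramification_support_def)

text \<open>Each generator in a product is realised by an edge. The start is arbitrary in the
  induction because the second factor is walked from xs.\<close>

lemma semigroup_awalk:
  assumes "s \<in> S" "x \<in> carrier G"
  shows "\<exists>p. awalk x p (x \<otimes> s)"
  using assms unfolding ramification_semigroup_def
proof (induction arbitrary: x)
  case (incl c)
  then obtain C where C: "\<And>x. x \<in> carrier G \<Longrightarrow> (x, C, c, 0) \<in> arcs \<Gamma>" using generator_arc by blast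
  have "c \<in> carrier G" using incl generators_closed by blast
  then have "awalk x [(x, C, c, 0)] (x \<otimes> c)"
    using C incl by (simp add: awalk_simps tail_hopf head_hopf verts_hopf)
  then show ?case by blast
next
  case (mult s t)
  have sc: "s \<in> carrier G" "t \<in> carrier G"
    using mult.hyps subsemigroup_generated_cases[OF is_group generators_closed] by blast+
  obtain p q where "awalk x p (x \<otimes> s)" "awalk (x \<otimes> s) q ((x \<otimes> s) \<otimes> t)"
    using mult.IH(1)[OF mult.prems] mult.IH(2)[of "x \<otimes> s"] mult.prems sc by blast
  then show ?case using awalk_appendI mult.prems sc m_assoc by metis
qed

text \<open>The labels along the walk multiply to \<open>s\<close>; the empty walk is excluded since
  the identity may be missing from S.\<close>

lemma awalk_semigroup: "\<lbrakk>awalk x p y; p \<noteq> []\<rbrakk> \<Longrightarrow> \<exists>s\<in>S. y = x \<otimes> s"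
proof (induction p arbitrary: x)
  case (Cons e p)
  obtain x' C c i where e: "e = (x', C, c, i)" by (cases e) auto
  have a: "(x, C, c, i) \<in> arcs \<Gamma>" "e = (x, C, c, i)" "awalk (x \<otimes> c) p y"
    using Cons.prems e by (auto simp: awalk_simps tail_hopf head_hopf)
  have c: "c \<in> S" "c \<in> carrier G" "x \<in> carrier G"
    using arc_generator[OF a(1)] generators_semigroup generators_closed a(1) by (auto simp: arcs_hopf)
  show ?case
  proof (cases "p = []")
    case True
    then show ?thesis using a c by (auto simp: awalk_simps)
  next
    case False
    then obtain s where s: "s \<in> S" "y = (x \<otimes> c) \<otimes> s" using Cons.IH[OF a(3)] by blast
    then have "y = x \<otimes> (c \<otimes> s)" using c semigroup_closed by (auto simp: m_assoc)
    then show ?thesis using s c semigroup_mult by blast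
  qed
qed simp

text \<open>Repeating one label c leads through x, xc, xc^2 and so on. The same class and copy
  number 0 serve at every vertex, since the class of c lies in the support.\<close>

lemma power_walk:
  assumes H: "\<And>e. \<lbrakk>e \<in> arcs \<Gamma>; tail \<Gamma> e \<in> H\<rbrakk> \<Longrightarrow> head \<Gamma> e \<in> H"
    and c: "c \<in> X" and x: "x \<in> carrier G" and avoid: "\<And>n::nat. x \<otimes> c [^] n \<notin> H"
  shows "\<exists>p. walk_action.infinite_walk \<Gamma> H p \<and> tail \<Gamma> (p 0) = x"
proof -
  interpret walk_action K \<Gamma> H
    by unfold_locales (rule H)
  obtain C where C: "\<And>x. x \<in> carrier G \<Longrightarrow> (x, C, c, 0) \<in> arcs \<Gamma>" using generator_arc[OF c] by blast
  have cc: "c \<in> carrier G" using c generators_closed by blast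
  show ?thesis
    by (rule exI[of _ "\<lambda>n::nat. (x \<otimes> c [^] n, C, c, 0)"])
      (use x cc C avoid in \<open>auto simp: infinite_walk_def tail_hopf head_hopf m_assoc\<close>)
qed

text \<open>With \<open>H\<close> empty nothing has to be avoided, and a nonempty S provides a
  generator that can be repeated forever.\<close>

lemma hopf_vertex_nonzero:
  assumes "S \<noteq> {}" "x \<in> carrier G"
  shows "leavitt_class K \<Gamma> (TV x) \<noteq> \<zero>\<^bsub>L\<^esub>"
proof -
  interpret walk_action K \<Gamma> "{}" by unfold_locales simp
  obtain s where "s \<in> S" using assms by blast
  then obtain c where c: "c \<in> X"
    unfolding ramification_semigroup_def
    using subsemigroup_generated_cases[OF is_group generators_closed] by blast
  obtain p where "infinite_walk p" "tail \<Gamma> (p 0) = x"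
    using power_walk[of "{}" c x] c assms by blast
  then show ?thesis by (rule vertex_nonzero) (use assms verts_hopf in simp)
qed

section \<open>The cases in which S differs from G\<close>

lemma acyclic_not_purely_infinite_simple:
  assumes "\<one> \<notin> S"
  shows "\<not> purely_infinite_simple L"
proof
  assume pis: "purely_infinite_simple L"
  have "p = []" if p: "awalk v p v" for v p
  proof (rule ccontr)
    assume "p \<noteq> []"
    then obtain s where s: "s \<in> S" "v = v \<otimes> s" using awalk_semigroup[OF p] by blast
    have "v \<in> carrier G" using p verts_hopf by auto
    then have "s = \<one>" using s semigroup_closed r_cancel_one'[of v s] by auto
    then show False using s assms by simp
  qed
  then have no: "\<not> infinite_idempotent L e" for e by (rule L.acyclic_no_infinite_idempotent)
  \<comment> \<open>That the algebra is nonzero is taken from simplicity: S may be empty here, and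
    then no infinite walk shows a vertex to be nonzero.\<close>
  obtain x y where "x \<in> carrier L" "y \<in> carrier L" "x \<otimes>\<^bsub>L\<^esub> y \<noteq> \<zero>\<^bsub>L\<^esub>"
    using pis unfolding purely_infinite_simple_def simple_ring_def by blast
  then have "carrier L \<noteq> {\<zero>\<^bsub>L\<^esub>}" using L.l_null by auto
  moreover have "right_ideal L (carrier L)"
    unfolding right_ideal_def by (intro conjI L.additive_subgroupI') auto
  ultimately show False using pis no unfolding purely_infinite_simple_def purely_infinite_def by blast
qed

text \<open>S is hereditary because Sc \<subseteq> S for every generator c. A walk avoiding S starts
  at some g outside S and repeats a generator whose inverse lies in S: right multiplication by it
  cannot lead into S.\<close>

lemma proper_semigroup_not_simple:
  assumes "\<one> \<in> S" "S \<noteq> carrier G"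
  shows "\<not> simple_ring L"
proof -
  have her: "head \<Gamma> e \<in> S" if "e \<in> arcs \<Gamma>" "tail \<Gamma> e \<in> S" for e
  proof -
    obtain x C c i where e: "e = (x, C, c, i)" by (cases e) auto
    have "c \<in> S" using arc_generator that(1) generators_semigroup e by blast
    then show ?thesis using that(2) semigroup_mult by (simp add: e tail_hopf head_hopf)
  qed
  interpret walk_action K \<Gamma> S by unfold_locales (rule her)
  \<comment> \<open>The identity is a product of generators; splitting off the first factor exhibits
    its inverse in S. A product of length one means that the identity itself is a generator.\<close>
  have "\<exists>c\<in>X. inv c \<in> S"
  proof -
    consider "\<one> \<in> X" | c t where "c \<in> X" "t \<in> S" "\<one> = c \<otimes> t"
      using subsemigroup_generated_cases[OF is_group generators_closed, of \<one>] assms(1)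
      unfolding ramification_semigroup_def by blast
    then show ?thesis
    proof cases
      case 1
      then show ?thesis using assms(1) by (intro bexI[of _ \<one>]) auto
    next
      case 2
      then have "t = inv c" using generators_closed semigroup_closed
        by (metis UnionI inv_equality inv_inv l_inv subsetD inv_solve_left one_closed r_one)
      then show ?thesis using 2 by blast
    qed
  qed
  then obtain c where c: "c \<in> X" "inv c \<in> S" by blast
  have cc: "c \<in> carrier G" using c generators_closed by blast
  obtain g where g: "g \<in> carrier G" "g \<notin> S" using assms(2) semigroup_closed by blast
  have "g \<otimes> c [^] n \<notin> S" for n :: nat
  proof (induction n)
    case 0
    then show ?case using g by simp
  next
    case (Suc n)
    show ?case
    proof
      assume "g \<otimes> c [^] Suc n \<in> S"
      then have "(g \<otimes> c [^] Suc n) \<otimes> inv c \<in> S" using c semigroup_mult by blast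
      moreover have "(g \<otimes> c [^] Suc n) \<otimes> inv c = g \<otimes> c [^] n" using g cc by (simp add: m_assoc)
      ultimately show False using Suc by simp
    qed
  qed
  then obtain p where p: "infinite_walk p" using power_walk[OF her c(1) g(1)] by blast
  have "leavitt_class K \<Gamma> (TV \<one>) \<noteq> \<zero>\<^bsub>L\<^esub>" using assms(1) by (intro hopf_vertex_nonzero) auto
  then show ?thesis by (rule not_simple[OF p, of \<one>, rotated 2]) (use assms verts_hopf in auto)
qed

lemma strongly_connected:
  assumes "S = carrier G" "u \<in> verts \<Gamma>" "v \<in> verts \<Gamma>"
  shows "\<exists>p. awalk u p v"
proof -
  have "inv u \<otimes> v \<in> S" using assms verts_hopf by simp
  from semigroup_awalk[OF this, of u] obtain p where "awalk u p (u \<otimes> (inv u \<otimes> v))"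
    using assms verts_hopf by auto
  moreover have "u \<otimes> (inv u \<otimes> v) = v" using assms verts_hopf by (simp add: m_assoc[symmetric])
  ultimately show ?thesis by auto
qed

section \<open>The out-degree and the cases in which S equals G\<close>

lemma ctwo_le_degree:
  "ctwo \<le>o ramification_degree G r \<longleftrightarrow>
     (\<exists>C c i C' c' i'. (\<one>, C, c, i) \<in> arcs \<Gamma> \<and> (\<one>, C', c', i') \<in> arcs \<Gamma> \<and> (C, c, i) \<noteq> (C', c', i'))"
proof -
  define D where "D = (SIGMA C : conjugacy_classes G. {..<r C} \<times> C)"
  have "ramification_degree G r = |D|"
    by (simp add: ramification_degree_def Csum_def cprod_def D_def Field_card_of)
  then have "ctwo \<le>o ramification_degree G r \<longleftrightarrow> (\<exists>f. inj_on f (UNIV :: bool set) \<and> range f \<subseteq> D)"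
    by (simp add: ctwo_def card_of_ordLeq[symmetric])
  also have "\<dots> \<longleftrightarrow> (\<exists>a\<in>D. \<exists>b\<in>D. a \<noteq> b)"
  proof
    assume "\<exists>f. inj_on f (UNIV :: bool set) \<and> range f \<subseteq> D"
    then obtain f where f: "inj_on f (UNIV :: bool set)" "range f \<subseteq> D" by blast
    then have "f True \<noteq> f False" "f True \<in> D" "f False \<in> D" by (auto simp: inj_on_def)
    then show "\<exists>a\<in>D. \<exists>b\<in>D. a \<noteq> b" by blast
  next
    assume "\<exists>a\<in>D. \<exists>b\<in>D. a \<noteq> b"
    then obtain a b where "a \<in> D" "b \<in> D" "a \<noteq> b" by blast
    then show "\<exists>f. inj_on f (UNIV :: bool set) \<and> range f \<subseteq> D"
      by (intro exI[of _ "\<lambda>x. if x then a else b"]) (auto simp: inj_on_def)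
  qed
  also have "\<dots> \<longleftrightarrow> (\<exists>C c i C' c' i'. (\<one>, C, c, i) \<in> arcs \<Gamma> \<and> (\<one>, C', c', i') \<in> arcs \<Gamma> \<and> (C, c, i) \<noteq> (C', c', i'))"
    by (auto simp: D_def arcs_hopf) blast+
  finally show ?thesis .
qed

text \<open>By left translation every vertex emits edges with the same labels, so the degree found
  at the identity holds everywhere.\<close>

lemma arcs_translate: "\<lbrakk>(x, C, c, i) \<in> arcs \<Gamma>; y \<in> carrier G\<rbrakk> \<Longrightarrow> (y, C, c, i) \<in> arcs \<Gamma>"
  by (simp add: arcs_hopf)

lemma purely_infinite_simple_hopf:
  assumes S: "S = carrier G" and "ctwo \<le>o ramification_degree G r"
  shows "purely_infinite_simple L"
proof -
  obtain C c i C' c' i' where a: "(\<one>, C, c, i) \<in> arcs \<Gamma>" "(\<one>, C', c', i') \<in> arcs \<Gamma>" "(C, c, i) \<noteq> (C', c', i')"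
    using assms(2) unfolding ctwo_le_degree by blast
  interpret branching_leavitt_algebra K L \<Gamma> "\<lambda>v. leavitt_class K \<Gamma> (TV v)"
    "\<lambda>e. leavitt_class K \<Gamma> (TE e)" "\<lambda>e. leavitt_class K \<Gamma> (TG e)"
  proof unfold_locales
    fix v assume v: "v \<in> verts \<Gamma>"
    have "(v, C, c, i) \<in> out_arcs \<Gamma> v" "(v, C', c', i') \<in> out_arcs \<Gamma> v"
      using arcs_translate[OF a(1)] arcs_translate[OF a(2)] v by (simp_all add: tail_hopf verts_hopf)
    moreover have "(v, C, c, i) \<noteq> (v, C', c', i')" using a(3) by simp
    ultimately show "\<exists>e\<in>out_arcs \<Gamma> v. \<exists>f\<in>out_arcs \<Gamma> v. e \<noteq> f" by (intro bexI)
    show "leavitt_class K \<Gamma> (TV v) \<noteq> \<zero>\<^bsub>L\<^esub>"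
      by (rule hopf_vertex_nonzero) (use S v verts_hopf in auto)
    fix u assume "u \<in> verts \<Gamma>"
    then show "\<exists>p. awalk u p v" using strongly_connected[OF S] v by blast
  next
    show "verts \<Gamma> \<noteq> {}" using one_closed verts_hopf by blast
  qed
  show ?thesis by (rule purely_infinite_simple)
qed

text \<open>A generator exists because S is nonempty; it gives an edge at every vertex, and the
  degree bound leaves only this one. With strong connectedness the graph is a single cycle.\<close>

lemma degree_one_not_purely_infinite:
  assumes S: "S = carrier G" and "\<not> ctwo \<le>o ramification_degree G r"
  shows "\<not> purely_infinite L"
proof -
  have "\<one> \<in> S" using S by simp
  then obtain c where "c \<in> X"
    unfolding ramification_semigroup_def
    using subsemigroup_generated_cases[OF is_group generators_closed] by blast
  then obtain C where C: "\<And>x. x \<in> carrier G \<Longrightarrow> (x, C, c, 0) \<in> arcs \<Gamma>" using generator_arc by blast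
  interpret cycle_leavitt_algebra K L \<Gamma> "\<lambda>v. leavitt_class K \<Gamma> (TV v)"
    "\<lambda>e. leavitt_class K \<Gamma> (TE e)" "\<lambda>e. leavitt_class K \<Gamma> (TG e)"
  proof unfold_locales
    fix v assume v: "v \<in> verts \<Gamma>"
    have "e = (v, C, c, 0)" if e: "e \<in> out_arcs \<Gamma> v" for e
    proof -
      obtain x C' c' i where "e = (x, C', c', i)" by (cases e) auto
      then have e': "e = (v, C', c', i)" "(v, C', c', i) \<in> arcs \<Gamma>" using e by (auto simp: tail_hopf)
      then have "(\<one>, C', c', i) \<in> arcs \<Gamma>" using arcs_translate by blast
      then have "(C', c', i) = (C, c, 0)" using assms(2) C[of \<one>] unfolding ctwo_le_degree by blast
      then show ?thesis using e' by simp
    qed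
    moreover have "(v, C, c, 0) \<in> out_arcs \<Gamma> v" using C[of v] v by (simp add: tail_hopf verts_hopf)
    ultimately have "out_arcs \<Gamma> v = {(v, C, c, 0)}" by blast
    then show "\<exists>e. out_arcs \<Gamma> v = {e}" by blast
    fix u assume "u \<in> verts \<Gamma>"
    then show "\<exists>p. awalk u p v" using strongly_connected[OF S] v by blast
  qed
  show ?thesis
    by (rule not_purely_infinite[of \<one>]) (use hopf_vertex_nonzero[of \<one>] S verts_hopf in auto)
qed

end

theorem theorem3p5:
  fixes G :: "('a, 'm) monoid_scheme" and r :: "'a set \<Rightarrow> nat" and K :: "('k, 'n) ring_scheme"
  assumes "group G" and "field K"
  shows "purely_infinite_simple (leavitt_path_algebra K (hopf_graph G r)) \<longleftrightarrow>
           ramification_semigroup G r = carrier G \<and>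
           ctwo \<le>o ramification_degree G r"
proof -
  interpret hopf_digraph G K r
    using assms by (intro hopf_digraph.intro)
  \<comment> \<open>The cases 1 \<notin> S, 1 \<in> S \<noteq> G, and S = G with or without two
    edges per vertex are exhaustive; the first includes r = 0, where S is empty.\<close>
  show ?thesis
    using acyclic_not_purely_infinite_simple proper_semigroup_not_simple
      purely_infinite_simple_hopf degree_one_not_purely_infinite
    unfolding purely_infinite_simple_def by blast
qed

end
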